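(* Let $M$ be an almost quaternion-Hermitian manifold of dimension $4n$, $n\ge2$, with local adapted basis $I,J,K$, and let $\alpha_J,\alpha_K$ be the associated tensors (see context). Then (a) $(\nabla\omega_I)^{(3)}_{\mathcal W_1}$ is uniquely determined by $J_{(1)}\alpha_J^{(3)}-K_{(1)}\alpha_K^{(3)}$, (b) $(\nabla\omega_I)^{(3)}_{\mathcal W_3}$ is uniquely determined by $J_{(1)}\alpha_J^{(3)}+K_{(1)}\alpha_K^{(3)}$, (c) $(\nabla\omega_I)^{(K)}_{\mathcal W_2}$ is uniquely determined by $J_{(1)}\alpha_J^{(K)}-K_{(1)}\alpha_K^{(K)}$, and (d) $(\nabla\omega_I)^{(K)}_{\mathcal W_3}$ is uniquely determined by $J_{(1)}\alpha_J^{(K)}+K_{(1)}\alpha_K^{(K)}$. Here "$\Phi$ is uniquely determined by $\Psi$" means that, pointwise, $\Phi$ is the image of $\Psi$ under an injective linear map depending only on $g,I,J,K$ at the point.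
   Context: An almost quaternion-Hermitian manifold is a smooth $4n$-manifold $M$ ($n\ge2$) with a Riemannian metric $g=\langle\cdot,\cdot\rangle$ and a rank-three subbundle of $\mathrm{End}\,TM$ which locally has an adapted basis $I,J,K$: $I^2=J^2=-1$, $K=IJ=-JI$, $\langle AX,AY\rangle=\langle X,Y\rangle$ for $A=I,J,K$. Put $\omega_A(X,Y)=\langle X,AY\rangle$; $\nabla$ is the Levi-Civita connection and $\nabla\omega_A$ is the $(0,3)$-tensor $(X,Y,Z)\mapsto(\nabla_X\omega_A)(Y,Z)$. For a $(0,s)$-tensor $b$ put $A_{(i)}b(X_1,\dots,X_i,\dots,X_s)=-b(X_1,\dots,AX_i,\dots,X_s)$, and let $\langle a,b\rangle=\sum a(e_{i_1},\dots,e_{i_s})b(e_{i_1},\dots,e_{i_s})$ over an orthonormal basis. Define $$\lambda_I(X)=\tfrac1{4n}\langle\nabla_X\omega_J,\omega_K\rangle,\qquad \alpha_I=-\lambda_I\otimes g+\tfrac12(J_{(2)}-J_{(3)})\nabla\omega_K,$$ and $\lambda_J,\lambda_K,\alpha_J,\alpha_K$ by cyclic permutation of $I,J,K$. Each $\alpha_A$ lies in $T^*M\otimes\Lambda^2_0E$, where $\Lambda^2_0E$ here denotes the trace-free symmetric bilinear forms invariant under $I$, $J$ and $K$. Gray-Hervella decomposition: $\nabla\omega_I$ takes values in $\{b\in T^*M\otimes\Lambda^2T^*M: b(X,IY,IZ)=-b(X,Y,Z)\}=\mathcal W_1\oplus\mathcal W_2\oplus\mathcal W_3\oplus\mathcal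 W_4$ (orthogonal), where $\mathcal W_1$: $b(X,X,Z)=0$; $\mathcal W_2$: $b(X,Y,Z)+b(Y,Z,X)+b(Z,X,Y)=0$; $\mathcal W_3$: $b(IX,IY,Z)=b(X,Y,Z)$ and $\sum_i b(e_i,e_i,Z)=0$; $\mathcal W_4$: $b(X,Y,Z)=\langle X,Y\rangle\beta(Z)-\langle X,Z\rangle\beta(Y)-\langle X,IY\rangle\beta(IZ)+\langle X,IZ\rangle\beta(IY)$ for some one-form $\beta$. $(\nabla\omega_I)_{\mathcal W_i}$ denotes the $\mathcal W_i$-component. Let $Sp(n)$ be the group of isometries of $T_xM$ commuting with $I,J,K$, $E\cong\mathbb C^{2n}$ its standard representation, $\Lambda^3_0E$ the invariant complement of $\omega_E\wedge E$ in $\Lambda^3E$ ($\omega_E$ the invariant symplectic form; $\Lambda^3_0E=0$ for $n=2$), and $K$ (as a module) the irreducible $Sp(n)$-module of highest weight $(2,1)$; $E\otimes\Lambda_0^2E\cong\Lambda^3_0E+K+E$. The spaces $T^*M\otimes\Lambda^2_0E$ and $\mathcal W_i$ have (after complexification) only $Sp(n)$-irreducible constituents isomorphic to $\Lambda^3_0E$, $K$, $E$; superscripts $(3)$, $(K)$, $(E)$ denote the projections onto the corresponding $Sp(n)$-isotypic components. *)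

theory Defs
  imports "HOL-Analysis.Analysis" "HOL-Library.Function_Algebras"
begin

section \<open>Smooth manifolds and tensor fields\<close>

fun Ck_on :: "nat \<Rightarrow> 'a::real_normed_vector set \<Rightarrow> ('a \<Rightarrow> 'b::real_normed_vector) \<Rightarrow> bool" where
  "Ck_on 0 S f \<longleftrightarrow> continuous_on S f"
| "Ck_on (Suc k) S f \<longleftrightarrow>
     (\<forall>x\<in>S. f differentiable (at x)) \<and> (\<forall>v. Ck_on k S (\<lambda>x. frechet_derivative f (at x) v))"

text \<open>Intended for open \<open>S\<close> and finite-dimensional domains.\<close>

definition smooth_on :: "'a::real_normed_vector set \<Rightarrow> ('a \<Rightarrow> 'b::real_normed_vector) \<Rightarrow> bool" where
  "smooth_on S f \<longleftrightarrow> (\<forall>k. Ck_on k S f)"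

text \<open>A chart is a pair of its domain and its coordinate map.\<close>

type_synonym ('m, 'v) chart = "'m set \<times> ('m \<Rightarrow> 'v)"

definition transition :: "('m, 'v) chart \<Rightarrow> ('m, 'v) chart \<Rightarrow> 'v \<Rightarrow> 'v" where
  "transition c d = snd d \<circ> inv_into (fst c) (snd c)"

definition smooth_manifold :: "'m topology \<Rightarrow> ('m, 'v::euclidean_space) chart set \<Rightarrow> bool" where
  "smooth_manifold M \<A> \<longleftrightarrow>
     Hausdorff_space M \<and> second_countable M \<and>
     (\<Union>c\<in>\<A>. fst c) = topspace M \<and>
     (\<forall>c\<in>\<A>. openin M (fst c) \<and> open (snd c ` fst c) \<and>
        homeomorphic_map (subtopology M (fst c)) (top_of_set (snd c ` fst c)) (snd c)) \<and>
     (\<forall>c\<in>\<A>. \<forall>d\<in>\<A>. smooth_on (snd c ` (fst c \<inter> fst d)) (transition c d))"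

text \<open>
  The tangent space at \<open>x\<close> is represented in every chart \<open>c\<close> around \<open>x\<close> by the coordinate space
  \<open>'v\<close>; two such representations are identified by the derivative of the transition map. A tensor
  field assigns to a chart and a point its coordinate representation, subject to the corresponding
  transformation law. Values at points outside the domain of the chart are irrelevant.
\<close>

definition tangent_map :: "('m, 'v::euclidean_space) chart \<Rightarrow> ('m, 'v) chart \<Rightarrow> 'm \<Rightarrow> 'v \<Rightarrow> 'v" where
  "tangent_map c d x = frechet_derivative (transition c d) (at (snd c x))"

definition local_rep :: "('m, 'v) chart \<Rightarrow> (('m, 'v) chart \<Rightarrow> 'm \<Rightarrow> 'a) \<Rightarrow> 'v \<Rightarrow> 'a" where
  "local_rep c T p = T c (inv_into (fst c) (snd c) p)"

type_synonym 'v form2 = "'v \<Rightarrow> 'v \<Rightarrow> real"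
type_synonym 'v endo = "'v \<Rightarrow> 'v"
type_synonym 'v tensor3 = "'v \<Rightarrow> 'v \<Rightarrow> 'v \<Rightarrow> real"
type_synonym 'v ctensor3 = "'v \<Rightarrow> 'v \<Rightarrow> 'v \<Rightarrow> complex"
type_synonym ('m, 'v) metric_field = "('m, 'v) chart \<Rightarrow> 'm \<Rightarrow> 'v form2"
type_synonym ('m, 'v) endo_field = "('m, 'v) chart \<Rightarrow> 'm \<Rightarrow> 'v endo"

definition euclidean_form :: "('v::euclidean_space) form2 \<Rightarrow> bool" where
  "euclidean_form g \<longleftrightarrow> bilinear g \<and> (\<forall>X Y. g X Y = g Y X) \<and> (\<forall>X. X \<noteq> 0 \<longrightarrow> g X X > 0)"

definition riemannian_metric ::
  "('m, 'v::euclidean_space) chart set \<Rightarrow> ('m, 'v) metric_field \<Rightarrow> bool" where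
  "riemannian_metric \<A> g \<longleftrightarrow>
     (\<forall>c\<in>\<A>. \<forall>x\<in>fst c. euclidean_form (g c x)) \<and>
     (\<forall>c\<in>\<A>. \<forall>X Y. smooth_on (snd c ` fst c) (\<lambda>p. local_rep c g p X Y)) \<and>
     (\<forall>c\<in>\<A>. \<forall>d\<in>\<A>. \<forall>x\<in>fst c \<inter> fst d. \<forall>X Y.
        g c x X Y = g d x (tangent_map c d x X) (tangent_map c d x Y))"

definition smooth_endo_field ::
  "('m, 'v::euclidean_space) chart set \<Rightarrow> 'm set \<Rightarrow> ('m, 'v) endo_field \<Rightarrow> bool" where
  "smooth_endo_field \<A> U A \<longleftrightarrow>
     (\<forall>c\<in>\<A>. \<forall>x\<in>U \<inter> fst c. linear (A c x)) \<and>
     (\<forall>c\<in>\<A>. \<forall>X. smooth_on (snd c ` (U \<inter> fst c)) (\<lambda>p. local_rep c A p X)) \<and>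
     (\<forall>c\<in>\<A>. \<forall>d\<in>\<A>. \<forall>x\<in>U \<inter> fst c \<inter> fst d. \<forall>X.
        tangent_map c d x (A c x X) = A d x (tangent_map c d x X))"


section \<open>Almost quaternion-Hermitian manifolds\<close>

definition quaternion_hermitian ::
  "('v::euclidean_space) form2 \<Rightarrow> 'v endo \<Rightarrow> 'v endo \<Rightarrow> 'v endo \<Rightarrow> bool" where
  "quaternion_hermitian g I J K \<longleftrightarrow>
     euclidean_form g \<and> linear I \<and> linear J \<and> linear K \<and>
     (\<forall>X. I (I X) = - X) \<and> (\<forall>X. J (J X) = - X) \<and>
     (\<forall>X. K X = I (J X)) \<and> (\<forall>X. K X = - J (I X)) \<and>
     (\<forall>A\<in>{I, J, K}. \<forall>X Y. g (A X) (A Y) = g X Y)"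

text \<open>\<open>Q c x\<close> is the fibre at \<open>x\<close> of the rank-three subbundle of \<open>End TM\<close>, in the chart \<open>c\<close>.\<close>

definition local_adapted_basis ::
  "'m topology \<Rightarrow> ('m, 'v::euclidean_space) chart set \<Rightarrow> ('m, 'v) metric_field \<Rightarrow>
   (('m, 'v) chart \<Rightarrow> 'm \<Rightarrow> 'v endo set) \<Rightarrow> 'm set \<Rightarrow>
   ('m, 'v) endo_field \<Rightarrow> ('m, 'v) endo_field \<Rightarrow> ('m, 'v) endo_field \<Rightarrow> bool" where
  "local_adapted_basis M \<A> g Q U I J K \<longleftrightarrow>
     openin M U \<and>
     smooth_endo_field \<A> U I \<and> smooth_endo_field \<A> U J \<and> smooth_endo_field \<A> U K \<and>
     (\<forall>c\<in>\<A>. \<forall>x\<in>U \<inter> fst c.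
        quaternion_hermitian (g c x) (I c x) (J c x) (K c x) \<and>
        Q c x = {(\<lambda>X. r *\<^sub>R I c x X + s *\<^sub>R J c x X + t *\<^sub>R K c x X) | r s t. True})"

definition almost_quaternion_hermitian ::
  "'m topology \<Rightarrow> ('m, 'v::euclidean_space) chart set \<Rightarrow> ('m, 'v) metric_field \<Rightarrow>
   (('m, 'v) chart \<Rightarrow> 'm \<Rightarrow> 'v endo set) \<Rightarrow> bool" where
  "almost_quaternion_hermitian M \<A> g Q \<longleftrightarrow>
     smooth_manifold M \<A> \<and> riemannian_metric \<A> g \<and>
     (\<forall>x\<in>topspace M. \<exists>U I J K. x \<in> U \<and> local_adapted_basis M \<A> g Q U I J K)"


section \<open>The covariant derivatives of the fundamental forms\<close>

text \<open>
  Christoffel symbols at \<open>p\<close> of the Levi-Civita connection of the coordinate metric \<open>h\<close>: the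
  unique torsion-free and metric \<open>\<Gamma>\<close>, where the connection is \<open>\<nabla>\<^sub>X Y = D\<^sub>X Y + \<Gamma>(X, Y)\<close>.
\<close>

definition levi_civita :: "('v::euclidean_space \<Rightarrow> 'v form2) \<Rightarrow> 'v \<Rightarrow> 'v \<Rightarrow> 'v \<Rightarrow> 'v" where
  "levi_civita h p = (THE \<Gamma>. bilinear \<Gamma> \<and> (\<forall>X Y. \<Gamma> X Y = \<Gamma> Y X) \<and>
     (\<forall>X Y Z. frechet_derivative (\<lambda>q. h q Y Z) (at p) X = h p (\<Gamma> X Y) Z + h p Y (\<Gamma> X Z)))"

definition cov_deriv ::
  "('v::euclidean_space \<Rightarrow> 'v form2) \<Rightarrow> ('v \<Rightarrow> 'v form2) \<Rightarrow> 'v \<Rightarrow> 'v tensor3" where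
  "cov_deriv h w p X Y Z = frechet_derivative (\<lambda>q. w q Y Z) (at p) X
     - w p (levi_civita h p X Y) Z - w p Y (levi_civita h p X Z)"

definition fundamental_form :: "'v form2 \<Rightarrow> 'v endo \<Rightarrow> 'v form2" where
  "fundamental_form g A X Y = g X (A Y)"

definition nabla_omega ::
  "('m, 'v::euclidean_space) metric_field \<Rightarrow> ('m, 'v) endo_field \<Rightarrow> ('m, 'v) chart \<Rightarrow> 'm \<Rightarrow> 'v tensor3"
  where "nabla_omega g A c x =
     cov_deriv (local_rep c g) (\<lambda>p. fundamental_form (local_rep c g p) (local_rep c A p)) (snd c x)"


section \<open>Tensors over a Euclidean vector space\<close>

definition orthonormal_basis :: "('v::euclidean_space) form2 \<Rightarrow> 'v set \<Rightarrow> bool" where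
  "orthonormal_basis g B \<longleftrightarrow> finite B \<and> span B = UNIV \<and>
     (\<forall>x\<in>B. \<forall>y\<in>B. g x y = (if x = y then 1 else 0))"

text \<open>Sum over a \<open>g\<close>-orthonormal basis; it is only used for expressions, such as contractions,
  that do not depend on the choice of the basis.\<close>

definition basis_sum :: "('v::euclidean_space) form2 \<Rightarrow> ('v \<Rightarrow> 'a::comm_monoid_add) \<Rightarrow> 'a" where
  "basis_sum g f = (\<Sum>e\<in>(SOME B. orthonormal_basis g B). f e)"

definition inner2 :: "('v::euclidean_space) form2 \<Rightarrow> 'v form2 \<Rightarrow> 'v form2 \<Rightarrow> real" where
  "inner2 g a b = basis_sum g (\<lambda>x. basis_sum g (\<lambda>y. a x y * b x y))"

definition inner3 :: "('v::euclidean_space) form2 \<Rightarrow> 'v tensor3 \<Rightarrow> 'v tensor3 \<Rightarrow> real" where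
  "inner3 g a b = basis_sum g (\<lambda>x. basis_sum g (\<lambda>y. basis_sum g (\<lambda>z. a x y z * b x y z)))"

definition cinner3 :: "('v::euclidean_space) form2 \<Rightarrow> 'v ctensor3 \<Rightarrow> 'v ctensor3 \<Rightarrow> complex" where
  "cinner3 g a b = basis_sum g (\<lambda>x. basis_sum g (\<lambda>y. basis_sum g (\<lambda>z. a x y z * cnj (b x y z))))"

definition tscale :: "'a::times \<Rightarrow> ('v \<Rightarrow> 'v \<Rightarrow> 'v \<Rightarrow> 'a) \<Rightarrow> 'v \<Rightarrow> 'v \<Rightarrow> 'v \<Rightarrow> 'a" where
  "tscale r b = (\<lambda>X Y Z. r * b X Y Z)"

lemma vector_space_tscale:
  "vector_space (tscale :: 'a::field \<Rightarrow> ('v \<Rightarrow> 'v \<Rightarrow> 'v \<Rightarrow> 'a) \<Rightarrow> _)"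
  by unfold_locales (auto simp: tscale_def fun_eq_iff algebra_simps)

text \<open>Used with values in the reals and in the complex numbers; multilinearity is over the reals.\<close>

definition trilinear ::
  "('v::real_vector \<Rightarrow> 'v \<Rightarrow> 'v \<Rightarrow> 'a::real_vector) \<Rightarrow> bool" where
  "trilinear b \<longleftrightarrow> (\<forall>Y Z. linear (\<lambda>X. b X Y Z)) \<and> (\<forall>X Z. linear (\<lambda>Y. b X Y Z)) \<and>
     (\<forall>X Y. linear (\<lambda>Z. b X Y Z))"

definition slot1 :: "'v endo \<Rightarrow> 'v tensor3 \<Rightarrow> 'v tensor3" where
  "slot1 A b = (\<lambda>X Y Z. - b (A X) Y Z)"

definition slot2 :: "'v endo \<Rightarrow> 'v tensor3 \<Rightarrow> 'v tensor3" where
  "slot2 A b = (\<lambda>X Y Z. - b X (A Y) Z)"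

definition slot3 :: "'v endo \<Rightarrow> 'v tensor3 \<Rightarrow> 'v tensor3" where
  "slot3 A b = (\<lambda>X Y Z. - b X Y (A Z))"

definition orth_proj :: "('v::euclidean_space) form2 \<Rightarrow> 'v tensor3 set \<Rightarrow> 'v tensor3 \<Rightarrow> 'v tensor3" where
  "orth_proj g S b = (THE s. s \<in> S \<and> (\<forall>t\<in>S. inner3 g (b - s) t = 0))"


section \<open>The tensors \<open>\<lambda>\<^sub>A\<close> and \<open>\<alpha>\<^sub>A\<close>\<close>

text \<open>With the arguments \<open>I J K\<close> these are \<open>\<lambda>\<^sub>I\<close> and \<open>\<alpha>\<^sub>I\<close>; the others arise by cyclic permutation
  of the arguments. The number \<open>4n\<close> is \<open>DIM('v)\<close>.\<close>

definition lambda_form ::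
  "('m, 'v::euclidean_space) metric_field \<Rightarrow> ('m, 'v) endo_field \<Rightarrow> ('m, 'v) endo_field \<Rightarrow>
   ('m, 'v) endo_field \<Rightarrow> ('m, 'v) chart \<Rightarrow> 'm \<Rightarrow> 'v \<Rightarrow> real" where
  "lambda_form g I J K c x X =
     inner2 (g c x) (nabla_omega g J c x X) (fundamental_form (g c x) (K c x)) / real DIM('v)"

definition alpha ::
  "('m, 'v::euclidean_space) metric_field \<Rightarrow> ('m, 'v) endo_field \<Rightarrow> ('m, 'v) endo_field \<Rightarrow>
   ('m, 'v) endo_field \<Rightarrow> ('m, 'v) chart \<Rightarrow> 'm \<Rightarrow> 'v tensor3" where
  "alpha g I J K c x =
     - (\<lambda>X Y Z. lambda_form g I J K c x X * g c x Y Z)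
     + tscale (1/2) (slot2 (J c x) (nabla_omega g K c x) - slot3 (J c x) (nabla_omega g K c x))"


section \<open>The spaces of tensors at a point\<close>

text \<open>\<open>T\<^sup>* \<otimes> \<Lambda>\<^sup>2\<^sub>0E\<close>\<close>

definition TL20 ::
  "('v::euclidean_space) form2 \<Rightarrow> 'v endo \<Rightarrow> 'v endo \<Rightarrow> 'v endo \<Rightarrow> 'v tensor3 set" where
  "TL20 g I J K = {b. trilinear b \<and> (\<forall>X Y Z. b X Y Z = b X Z Y) \<and>
     (\<forall>A\<in>{I, J, K}. \<forall>X Y Z. b X (A Y) (A Z) = b X Y Z) \<and>
     (\<forall>X. basis_sum g (\<lambda>e. b X e e) = 0)}"

definition GH :: "('v::euclidean_space) endo \<Rightarrow> 'v tensor3 set" where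
  "GH I = {b. trilinear b \<and> (\<forall>X Y Z. b X Y Z = - b X Z Y) \<and> (\<forall>X Y Z. b X (I Y) (I Z) = - b X Y Z)}"

definition GH1 :: "('v::euclidean_space) endo \<Rightarrow> 'v tensor3 set" where
  "GH1 I = {b \<in> GH I. \<forall>X Z. b X X Z = 0}"

definition GH2 :: "('v::euclidean_space) endo \<Rightarrow> 'v tensor3 set" where
  "GH2 I = {b \<in> GH I. \<forall>X Y Z. b X Y Z + b Y Z X + b Z X Y = 0}"

definition GH3 :: "('v::euclidean_space) form2 \<Rightarrow> 'v endo \<Rightarrow> 'v tensor3 set" where
  "GH3 g I = {b \<in> GH I. (\<forall>X Y Z. b (I X) (I Y) Z = b X Y Z) \<and>
     (\<forall>Z. basis_sum g (\<lambda>e. b e e Z) = 0)}"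


section \<open>Modules of \<open>Sp(n)\<close>\<close>

definition Sp :: "('v::euclidean_space) form2 \<Rightarrow> 'v endo \<Rightarrow> 'v endo \<Rightarrow> 'v endo \<Rightarrow> 'v endo set" where
  "Sp g I J K = {a. linear a \<and> (\<forall>X Y. g (a X) (a Y) = g X Y) \<and>
     (\<forall>A\<in>{I, J, K}. \<forall>X. a (A X) = A (a X))}"

text \<open>The action of \<open>a \<in> Sp(n)\<close> on complex-valued tensors.\<close>

definition act :: "'v endo \<Rightarrow> 'v ctensor3 \<Rightarrow> 'v ctensor3" where
  "act a b = (\<lambda>X Y Z. b (inv a X) (inv a Y) (inv a Z))"

definition complexification :: "'v tensor3 set \<Rightarrow> 'v ctensor3 set" where
  "complexification W = {b. (\<lambda>X Y Z. Re (b X Y Z)) \<in> W \<and> (\<lambda>X Y Z. Im (b X Y Z)) \<in> W}"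

definition sp_module ::
  "('v::euclidean_space) form2 \<Rightarrow> 'v endo \<Rightarrow> 'v endo \<Rightarrow> 'v endo \<Rightarrow> 'v ctensor3 set \<Rightarrow> bool" where
  "sp_module g I J K S \<longleftrightarrow>
     S \<subseteq> {b. trilinear b} \<and> module.subspace tscale S \<and> (\<forall>a\<in>Sp g I J K. \<forall>b\<in>S. act a b \<in> S)"

definition sp_irreducible ::
  "('v::euclidean_space) form2 \<Rightarrow> 'v endo \<Rightarrow> 'v endo \<Rightarrow> 'v endo \<Rightarrow> 'v ctensor3 set \<Rightarrow> bool" where
  "sp_irreducible g I J K S \<longleftrightarrow> sp_module g I J K S \<and> S \<noteq> {0} \<and>
     (\<forall>R. R \<subseteq> S \<longrightarrow> sp_module g I J K R \<longrightarrow> R = {0} \<or> R = S)"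

definition sp_isomorphic ::
  "('v::euclidean_space) form2 \<Rightarrow> 'v endo \<Rightarrow> 'v endo \<Rightarrow> 'v endo \<Rightarrow>
   'v ctensor3 set \<Rightarrow> 'v ctensor3 set \<Rightarrow> bool" where
  "sp_isomorphic g I J K S R \<longleftrightarrow> (\<exists>f. bij_betw f S R \<and>
     (\<forall>b\<in>S. \<forall>b'\<in>S. f (b + b') = f b + f b') \<and> (\<forall>r. \<forall>b\<in>S. f (tscale r b) = tscale r (f b)) \<and>
     (\<forall>a\<in>Sp g I J K. \<forall>b\<in>S. f (act a b) = act a (f b)))"

subsection \<open>The module \<open>\<Lambda>\<^sup>3\<^sub>0E\<close>\<close>

text \<open>
  \<open>E\<close> is realised as the space of complex linear functionals on the complex vector space
  \<open>(T, I)\<close>, which \<open>\<omega>\<^sub>E = \<omega>\<^sub>J + i \<omega>\<^sub>K\<close> identifies with the standard representation \<open>(T, I)\<close> itself.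
\<close>

definition E_module :: "('v::euclidean_space) endo \<Rightarrow> ('v \<Rightarrow> complex) set" where
  "E_module I = {\<epsilon>. linear \<epsilon> \<and> (\<forall>X. \<epsilon> (I X) = \<i> * \<epsilon> X)}"

definition omega_E :: "'v form2 \<Rightarrow> 'v endo \<Rightarrow> 'v endo \<Rightarrow> 'v \<Rightarrow> 'v \<Rightarrow> complex" where
  "omega_E g J K X Y = of_real (fundamental_form g J X Y) + \<i> * of_real (fundamental_form g K X Y)"

definition L3E :: "('v::euclidean_space) endo \<Rightarrow> 'v ctensor3 set" where
  "L3E I = {b. trilinear b \<and> (\<forall>X Y Z. b (I X) Y Z = \<i> * b X Y Z) \<and>
     (\<forall>X Y Z. b Y X Z = - b X Y Z) \<and> (\<forall>X Y Z. b X Z Y = - b X Y Z)}"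

definition omega_wedge :: "'v form2 \<Rightarrow> 'v endo \<Rightarrow> 'v endo \<Rightarrow> ('v \<Rightarrow> complex) \<Rightarrow> 'v ctensor3" where
  "omega_wedge g J K \<epsilon> = (\<lambda>X Y Z. omega_E g J K X Y * \<epsilon> Z + omega_E g J K Y Z * \<epsilon> X
     + omega_E g J K Z X * \<epsilon> Y)"

text \<open>The invariant complement of \<open>\<omega>\<^sub>E \<and> E\<close> is its orthogonal complement for the invariant
  Hermitian form.\<close>

definition L30E ::
  "('v::euclidean_space) form2 \<Rightarrow> 'v endo \<Rightarrow> 'v endo \<Rightarrow> 'v endo \<Rightarrow> 'v ctensor3 set" where
  "L30E g I J K = {b \<in> L3E I. \<forall>\<epsilon>\<in>E_module I. cinner3 g b (omega_wedge g J K \<epsilon>) = 0}"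

subsection \<open>The module \<open>K\<close>\<close>

text \<open>Quaternionic orthonormal bases \<open>e 0, \<dots>, e (n - 1)\<close>.\<close>

definition quaternionic_frame ::
  "('v::euclidean_space) form2 \<Rightarrow> 'v endo \<Rightarrow> 'v endo \<Rightarrow> 'v endo \<Rightarrow> (nat \<Rightarrow> 'v) \<Rightarrow> bool" where
  "quaternionic_frame g I J K e \<longleftrightarrow>
     (\<forall>j < DIM('v) div 4. \<forall>k < DIM('v) div 4. g (e j) (e k) = (if j = k then 1 else 0) \<and>
        g (e j) (I (e k)) = 0 \<and> g (e j) (J (e k)) = 0 \<and> g (e j) (K (e k)) = 0)"

text \<open>
  A quaternionic orthonormal basis \<open>e\<close> determines the maximal torus whose element with parameter
  \<open>\<theta>\<close> maps \<open>e k\<close> to \<open>cos (\<theta> k) e k + sin (\<theta> k) I (e k)\<close> and is then determined by commuting with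
  \<open>I, J, K\<close>. The following says that \<open>b\<close> lies in the weight space of
  \<open>m 0 \<epsilon>\<^sub>1 + \<dots> + m (n - 1) \<epsilon>\<^sub>n\<close>.
\<close>

definition weight_vector ::
  "('v::euclidean_space) form2 \<Rightarrow> 'v endo \<Rightarrow> 'v endo \<Rightarrow> 'v endo \<Rightarrow> (nat \<Rightarrow> 'v) \<Rightarrow>
   (nat \<Rightarrow> int) \<Rightarrow> 'v ctensor3 \<Rightarrow> bool" where
  "weight_vector g I J K e m b \<longleftrightarrow> (\<forall>a\<in>Sp g I J K. \<forall>\<theta>.
     (\<forall>k < DIM('v) div 4. a (e k) = cos (\<theta> k) *\<^sub>R e k + sin (\<theta> k) *\<^sub>R I (e k)) \<longrightarrow>
     act a b = tscale (cis (\<Sum>k < DIM('v) div 4. of_int (m k) * \<theta> k)) b)"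

text \<open>
  \<open>m\<close> is lower than or equal to \<open>l\<close> iff \<open>l - m\<close> is a combination with nonnegative real coefficients
  of the simple roots \<open>\<epsilon>\<^sub>1 - \<epsilon>\<^sub>2, \<dots>, \<epsilon>\<^sub>n\<^sub>-\<^sub>1 - \<epsilon>\<^sub>n, 2 \<epsilon>\<^sub>n\<close>. The coefficients are the partial sums of
  \<open>l - m\<close>, the last one halved.
\<close>

definition weight_le :: "nat \<Rightarrow> (nat \<Rightarrow> int) \<Rightarrow> (nat \<Rightarrow> int) \<Rightarrow> bool" where
  "weight_le n m l \<longleftrightarrow> (\<forall>k\<le>n. (\<Sum>j<k. m j) \<le> (\<Sum>j<k. l j))"

text \<open>All quaternionic orthonormal bases are conjugate under \<open>Sp(n)\<close>, so the choice of \<open>e\<close> is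
  immaterial.\<close>

definition has_highest_weight ::
  "('v::euclidean_space) form2 \<Rightarrow> 'v endo \<Rightarrow> 'v endo \<Rightarrow> 'v endo \<Rightarrow>
   (nat \<Rightarrow> int) \<Rightarrow> 'v ctensor3 set \<Rightarrow> bool" where
  "has_highest_weight g I J K l S \<longleftrightarrow> (\<exists>e. quaternionic_frame g I J K e \<and>
     (\<exists>b\<in>S. b \<noteq> 0 \<and> weight_vector g I J K e l b) \<and>
     (\<forall>m. (\<exists>b\<in>S. b \<noteq> 0 \<and> weight_vector g I J K e m b) \<longrightarrow> weight_le (DIM('v) div 4) m l))"

subsection \<open>Isotypic components\<close>

text \<open>Isomorphism types of modules are given by predicates.\<close>

definition type_3 ::
  "('v::euclidean_space) form2 \<Rightarrow> 'v endo \<Rightarrow> 'v endo \<Rightarrow> 'v endo \<Rightarrow> 'v ctensor3 set \<Rightarrow> bool" where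
  "type_3 g I J K S \<longleftrightarrow> sp_isomorphic g I J K S (L30E g I J K)"

definition type_K ::
  "('v::euclidean_space) form2 \<Rightarrow> 'v endo \<Rightarrow> 'v endo \<Rightarrow> 'v endo \<Rightarrow> 'v ctensor3 set \<Rightarrow> bool" where
  "type_K g I J K S \<longleftrightarrow> sp_irreducible g I J K S \<and>
     has_highest_weight g I J K (\<lambda>k. if k = 0 then 2 else if k = 1 then 1 else 0) S"

text \<open>The isotypic component of the complexification of \<open>W\<close>, and its real points.\<close>

definition isotypic_component ::
  "('v::euclidean_space) form2 \<Rightarrow> 'v endo \<Rightarrow> 'v endo \<Rightarrow> 'v endo \<Rightarrow>
   ('v ctensor3 set \<Rightarrow> bool) \<Rightarrow> 'v tensor3 set \<Rightarrow> 'v ctensor3 set" where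
  "isotypic_component g I J K \<tau> W =
     module.span tscale (\<Union>{S. S \<subseteq> complexification W \<and> sp_module g I J K S \<and> \<tau> S})"

definition real_isotypic_component ::
  "('v::euclidean_space) form2 \<Rightarrow> 'v endo \<Rightarrow> 'v endo \<Rightarrow> 'v endo \<Rightarrow>
   ('v ctensor3 set \<Rightarrow> bool) \<Rightarrow> 'v tensor3 set \<Rightarrow> 'v tensor3 set" where
  "real_isotypic_component g I J K \<tau> W =
     {b \<in> W. (\<lambda>X Y Z. complex_of_real (b X Y Z)) \<in> isotypic_component g I J K \<tau> W}"

text \<open>The isotypic decomposition is orthogonal, so the projections are the orthogonal ones.\<close>

definition part_3 ::
  "('v::euclidean_space) form2 \<Rightarrow> 'v endo \<Rightarrow> 'v endo \<Rightarrow> 'v endo \<Rightarrow>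
   'v tensor3 set \<Rightarrow> 'v tensor3 \<Rightarrow> 'v tensor3" where
  "part_3 g I J K W = orth_proj g (real_isotypic_component g I J K (type_3 g I J K) W)"

definition part_K ::
  "('v::euclidean_space) form2 \<Rightarrow> 'v endo \<Rightarrow> 'v endo \<Rightarrow> 'v endo \<Rightarrow>
   'v tensor3 set \<Rightarrow> 'v tensor3 \<Rightarrow> 'v tensor3" where
  "part_K g I J K W = orth_proj g (real_isotypic_component g I J K (type_K g I J K) W)"


section \<open>Injective linear maps depending only on \<open>g, I, J, K\<close>\<close>

text \<open>
  A family of injective linear maps from \<open>T\<^sup>* \<otimes> \<Lambda>\<^sup>2\<^sub>0E\<close> to trilinear forms, one for each
  quaternion-Hermitian structure on \<open>'v\<close>. Compatibility with linear isomorphisms \<open>P\<close> makes the map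
  on tensors at a point of a manifold independent of the chart used to represent them.
\<close>

type_synonym 'v qh_map = "'v form2 \<Rightarrow> 'v endo \<Rightarrow> 'v endo \<Rightarrow> 'v endo \<Rightarrow> 'v tensor3 \<Rightarrow> 'v tensor3"

definition pull_form :: "'v endo \<Rightarrow> 'v form2 \<Rightarrow> 'v form2" where
  "pull_form P g = (\<lambda>X Y. g (P X) (P Y))"

definition pull_endo :: "'v endo \<Rightarrow> 'v endo \<Rightarrow> 'v endo" where
  "pull_endo P A = inv P \<circ> A \<circ> P"

definition pull_tensor :: "'v endo \<Rightarrow> 'v tensor3 \<Rightarrow> 'v tensor3" where
  "pull_tensor P b = (\<lambda>X Y Z. b (P X) (P Y) (P Z))"

definition injective_natural_map :: "('v::euclidean_space) qh_map \<Rightarrow> bool" where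
  "injective_natural_map L \<longleftrightarrow> (\<forall>g I J K. quaternion_hermitian g I J K \<longrightarrow>
     (\<forall>s\<in>TL20 g I J K. trilinear (L g I J K s)) \<and>
     (\<forall>s\<in>TL20 g I J K. \<forall>t\<in>TL20 g I J K. L g I J K (s + t) = L g I J K s + L g I J K t) \<and>
     (\<forall>r. \<forall>s\<in>TL20 g I J K. L g I J K (tscale r s) = tscale r (L g I J K s)) \<and>
     inj_on (L g I J K) (TL20 g I J K) \<and>
     (\<forall>P. linear P \<and> bij P \<longrightarrow> (\<forall>s\<in>TL20 g I J K.
        L (pull_form P g) (pull_endo P I) (pull_endo P J) (pull_endo P K) (pull_tensor P s)
          = pull_tensor P (L g I J K s))))"

end

(* Write the endomorphism-valued form nabla I as J p + K q. Then p and q are, up to sign and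
   their traces lambda, the tensors alpha_K and alpha_J; for alpha_K this uses the derivative of
   IJ + JI = 0. The components of nabla omega_I in W1 + W2 and in W3 + W4 are those with q = p (I .)
   and with q = - p (I .), so each of the two spaces contains one copy of T^* (x) Lambda^2_0 E, and
   the projection onto it is a combination of alpha_J and alpha_K with first arguments rotated by J
   and K, from which the injective maps are read off.

   It remains to see that the isotypic components of types (3) and K of W1, W2, W3 fill those of
   this copy. That holds because K has no equivariant maps to one-forms or to three-forms of type
   (3,0) + (0,3) for I, and Lambda^3_0 E none to one-forms or to the tensors in W1 + W2 with
   vanishing cyclic sum. For K, the element of
   Sp(n) that rotates a quaternionic line by I acts by -1 on a highest weight vector, whereas it has
   no eigenvalue -1 on the targets. For Lambda^3_0 E, the decomposable forms of quaternionic
   orthonormal triples span the module, and the rotations and transpositions of the three lines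
   force their images to vanish. *)

theory Submission
  imports Defs
begin

section \<open>Euclidean forms and contractions\<close>

text \<open>An isotypic component is the span of all submodules of one type, so it suffices to move
  single submodules S. Inside W1 + W2 or W3 + W4, each condition that cuts out W1, W2 or W3, and
  also the trace condition on the factor p, says that an equivariant map on S with values in a fixed
  target vanishes. It holds as soon as the type has no homomorphism into that target. Complex
  scalars enter because the eigenvalues of the rotations on the generating vectors are -1 and -i.
  The projections are computed by duality: a tensor is projected by pairing it with the tensors
  \<open>Phi A t\<close>. The adjoint of \<open>Phi A\<close> turns the pairing with nabla omega_I
  into pairings with alpha_K and alpha_J, where the lambda-terms drop out because t is trace-free.
  The factor 1/2 in the final maps arises since \<open>Phi A\<close> doubles inner products, and the
  rotations J_(1), K_(1) in the combinations of alpha_J and alpha_K are undone by evaluating them at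
  K X and J X.\<close>

locale euclidean =
  fixes g :: "('v::euclidean_space) form2"
  assumes euclidean_g: "euclidean_form g"
begin

lemma bilinear_g: "bilinear g" using euclidean_g by (simp add: euclidean_form_def)
lemma g_sym: "g X Y = g Y X" using euclidean_g by (simp add: euclidean_form_def)
lemma g_pos: "X \<noteq> 0 \<Longrightarrow> g X X > 0" using euclidean_g by (simp add: euclidean_form_def)

lemmas g_simps = bilinear_ladd[OF bilinear_g] bilinear_radd[OF bilinear_g] bilinear_lsub[OF bilinear_g]
  bilinear_rsub[OF bilinear_g] bilinear_lneg[OF bilinear_g] bilinear_rneg[OF bilinear_g]
  bilinear_lmul[OF bilinear_g] bilinear_rmul[OF bilinear_g] bilinear_lzero[OF bilinear_g]
  bilinear_rzero[OF bilinear_g]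

lemma linear_g: "linear (g X)" "linear (\<lambda>X. g X Y)"
  using bilinear_g by (simp_all add: bilinear_def)

lemma g_eq_0_iff: "g X X = 0 \<longleftrightarrow> X = 0"
  using g_pos[of X] g_simps by fastforce

lemma g_sum_left: "g (\<Sum>a\<in>A. f a) Y = (\<Sum>a\<in>A. g (f a) Y)"
  using linear_sum[OF linear_g(2)] by blast

section \<open>Orthonormal families and bases of a Euclidean form\<close>

definition gorthonormal :: "'v set \<Rightarrow> bool" where
  "gorthonormal B \<longleftrightarrow> finite B \<and> (\<forall>x\<in>B. \<forall>y\<in>B. g x y = (if x = y then 1 else 0))"

lemma g_sum_gorthonormal:
  assumes "gorthonormal B" "b \<in> B"
  shows "g (\<Sum>e\<in>B. c e *\<^sub>R e) b = c b"
proof -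
  have "g (\<Sum>e\<in>B. c e *\<^sub>R e) b = (\<Sum>e\<in>B. if e = b then c b else 0)"
    unfolding g_sum_left using assms by (intro sum.cong) (auto simp: g_simps gorthonormal_def)
  also have "\<dots> = c b" using assms by (simp add: gorthonormal_def)
  finally show ?thesis .
qed

lemma gorthonormal_independent:
  assumes "gorthonormal B"
  shows "independent B"
proof (rule independent_if_scalars_zero)
  show "finite B" using assms by (simp add: gorthonormal_def)
  fix f x assume "(\<Sum>x\<in>B. f x *\<^sub>R x) = 0" "x \<in> B"
  thus "f x = 0" using g_sum_gorthonormal[OF assms, of x f] by (simp add: g_simps)
qed

lemma gorthonormal_extend:
  assumes "gorthonormal B" "card B < DIM('v)"
  obtains x where "g x x = 1" "\<And>b. b \<in> B \<Longrightarrow> g x b = 0"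
proof -
  have "span B \<noteq> UNIV"
  proof
    assume "span B = UNIV"
    hence "dim B = DIM('v)" by (metis dim_UNIV dim_span)
    moreover have "dim B \<le> card B" using assms(1) by (intro dim_le_card') (simp add: gorthonormal_def)
    ultimately show False using assms(2) by simp
  qed
  then obtain y where y: "y \<notin> span B" by blast
  define z where "z = y - (\<Sum>e\<in>B. g y e *\<^sub>R e)"
  have "(\<Sum>e\<in>B. g y e *\<^sub>R e) \<in> span B" by (intro span_sum span_scale span_base)
  with y have "z \<noteq> 0" unfolding z_def by auto
  hence pz: "g z z > 0" by (rule g_pos)
  have o: "g z b = 0" if "b \<in> B" for b
    using g_sum_gorthonormal[OF assms(1) that] by (simp add: z_def g_simps)
  show thesis
  proof (rule that)
    show "g ((1 / sqrt (g z z)) *\<^sub>R z) ((1 / sqrt (g z z)) *\<^sub>R z) = 1"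
      using pz by (simp add: g_simps)
    show "g ((1 / sqrt (g z z)) *\<^sub>R z) b = 0" if "b \<in> B" for b
      using o[OF that] by (simp add: g_simps)
  qed
qed

lemma gorthonormal_span:
  assumes "gorthonormal B" "card B = DIM('v)"
  shows "orthonormal_basis g B"
proof -
  have "DIM('v) \<le> dim B"
    using gorthonormal_independent[OF assms(1)] assms(2) by (simp add: dim_eq_card_independent)
  moreover have "dim B = dim (span B)" by simp
  ultimately have "span B = UNIV"
    by (metis dim_eq_full dim_subset_UNIV le_antisym)
  thus ?thesis using assms by (auto simp: orthonormal_basis_def gorthonormal_def)
qed

lemma orthonormal_basis_exists: "\<exists>B. orthonormal_basis g B"
proof -
  have "\<exists>B. gorthonormal B \<and> card B = m" if "m \<le> DIM('v)" for m
    using that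
  proof (induction m)
    case 0
    show ?case by (intro exI[of _ "{}"]) (simp add: gorthonormal_def)
  next
    case (Suc m)
    then obtain B where B: "gorthonormal B" "card B = m" by auto
    then obtain x where x: "g x x = 1" "\<And>b. b \<in> B \<Longrightarrow> g x b = 0"
      using gorthonormal_extend[of B] Suc.prems by auto
    have "x \<notin> B" using x by force
    have "gorthonormal (insert x B)" using B(1) x g_sym by (auto simp: gorthonormal_def)
    moreover have "card (insert x B) = Suc m"
      using B \<open>x \<notin> B\<close> by (simp add: gorthonormal_def)
    ultimately show ?case by blast
  qed
  thus ?thesis using gorthonormal_span by blast
qed

section \<open>Contractions over the chosen orthonormal basis\<close>

definition onb :: "'v set" where "onb = (SOME B. orthonormal_basis g B)"

lemma onb: "orthonormal_basis g onb"
  unfolding onb_def using orthonormal_basis_exists by (rule someI_ex)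

lemma finite_onb: "finite onb" using onb by (simp add: orthonormal_basis_def)

lemma basis_sum_onb: "basis_sum g f = (\<Sum>e\<in>onb. f e)"
  by (simp add: basis_sum_def onb_def)

lemma orthonormal_expansion:
  assumes "orthonormal_basis g B"
  shows "(\<Sum>e\<in>B. g X e *\<^sub>R e) = X"
proof -
  have B: "gorthonormal B" "span B = UNIV" using assms by (auto simp: orthonormal_basis_def gorthonormal_def)
  define z where "z = X - (\<Sum>e\<in>B. g X e *\<^sub>R e)"
  have o: "g z b = 0" if "b \<in> B" for b
    using g_sum_gorthonormal[OF B(1) that] by (simp add: z_def g_simps)
  have "g z w = 0" if "w \<in> span B" for w
    using that
  proof (induction rule: span_induct_alt)
    case base thus ?case by (simp add: g_simps)
  next
    case (step c x y) thus ?case using o by (simp add: g_simps)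
  qed
  hence "g z z = 0" using B by simp
  thus ?thesis by (simp add: g_eq_0_iff z_def)
qed

text \<open>Expanding one argument in the other basis turns either side into the same double sum of
  the terms \<open>g e f *\<^sub>R \<beta> e f\<close>.\<close>

lemma sum_onb_eq:
  fixes \<beta> :: "'v \<Rightarrow> 'v \<Rightarrow> 'a::real_vector"
  assumes B: "orthonormal_basis g B" and \<beta>: "bilinear \<beta>"
  shows "basis_sum g (\<lambda>e. \<beta> e e) = (\<Sum>e\<in>B. \<beta> e e)"
proof -
  have l: "linear (\<beta> x)" "linear (\<lambda>x. \<beta> x y)" for x y using \<beta> by (simp_all add: bilinear_def)
  have "(\<Sum>e\<in>onb. \<beta> e e) = (\<Sum>e\<in>onb. \<beta> e (\<Sum>f\<in>B. g e f *\<^sub>R f))"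
    by (simp add: orthonormal_expansion[OF B])
  also have "\<dots> = (\<Sum>e\<in>onb. \<Sum>f\<in>B. g f e *\<^sub>R \<beta> e f)"
    by (simp add: linear_sum[OF l(1)] linear_cmul[OF l(1)] g_sym)
  also have "\<dots> = (\<Sum>f\<in>B. \<Sum>e\<in>onb. g f e *\<^sub>R \<beta> e f)" by (rule sum.swap)
  also have "\<dots> = (\<Sum>f\<in>B. \<beta> (\<Sum>e\<in>onb. g f e *\<^sub>R e) f)"
    by (simp add: linear_sum[OF l(2)] linear_cmul[OF l(2)])
  also have "\<dots> = (\<Sum>f\<in>B. \<beta> f f)" by (simp add: orthonormal_expansion[OF onb])
  finally show ?thesis by (simp add: basis_sum_onb)
qed

lemma isometry_bij:
  assumes "linear a" "\<And>X Y. g (a X) (a Y) = g X Y"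
  shows "bij a"
proof -
  have "inj a"
  proof (rule injI)
    fix x y assume "a x = a y"
    hence "g (a (x - y)) (a (x - y)) = 0" by (simp add: linear_diff[OF assms(1)] g_simps)
    thus "x = y" by (simp add: assms(2) g_eq_0_iff)
  qed
  thus ?thesis using linear_injective_imp_surjective[OF assms(1)] by (simp add: bij_def)
qed

lemma isometry_onb:
  assumes a: "linear a" "\<And>X Y. g (a X) (a Y) = g X Y" and B: "orthonormal_basis g B"
  shows "orthonormal_basis g (a ` B)"
proof -
  have "bij a" by (rule isometry_bij[OF a])
  have "span (a ` B) = UNIV"
    using B \<open>bij a\<close> by (simp add: linear_span_image[OF a(1)] orthonormal_basis_def bij_is_surj)
  thus ?thesis using B \<open>bij a\<close> by (auto simp: orthonormal_basis_def a(2) inj_eq bij_is_inj)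
qed

lemma basis_sum_isometry:
  fixes \<beta> :: "'v \<Rightarrow> 'v \<Rightarrow> 'a::real_vector"
  assumes a: "linear a" "\<And>X Y. g (a X) (a Y) = g X Y" and \<beta>: "bilinear \<beta>"
  shows "basis_sum g (\<lambda>e. \<beta> (a e) (a e)) = basis_sum g (\<lambda>e. \<beta> e e)"
proof -
  have "inj_on a onb" using isometry_bij[OF a] by (meson bij_is_inj inj_on_subset subset_UNIV)
  hence "(\<Sum>e\<in>a ` onb. \<beta> e e) = (\<Sum>e\<in>onb. \<beta> (a e) (a e))" by (rule sum.reindex_cong) auto
  thus ?thesis using sum_onb_eq[OF isometry_onb[OF a onb] \<beta>] by (simp add: basis_sum_onb)
qed

lemma basis_sum_g_contract:
  fixes f :: "'v \<Rightarrow> 'a::real_vector"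
  assumes "linear f"
  shows "basis_sum g (\<lambda>e. g X e *\<^sub>R f e) = f X"
proof -
  have "f X = f (\<Sum>e\<in>onb. g X e *\<^sub>R e)" by (simp add: orthonormal_expansion[OF onb])
  thus ?thesis by (simp add: basis_sum_onb linear_sum[OF assms] linear_cmul[OF assms])
qed

lemma basis_sum_swap:
  "basis_sum g (\<lambda>x. basis_sum g (\<lambda>y. F x y)) = basis_sum g (\<lambda>y. basis_sum g (\<lambda>x. F x y))"
  unfolding basis_sum_onb by (rule sum.swap)

lemma basis_sum_add: "basis_sum g (\<lambda>x. F x + G x) = basis_sum g F + basis_sum g G"
  by (simp add: basis_sum_onb sum.distrib)

lemma basis_sum_diff:
  fixes F G :: "'v \<Rightarrow> 'a::ab_group_add"
  shows "basis_sum g (\<lambda>x. F x - G x) = basis_sum g F - basis_sum g G"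
  by (simp add: basis_sum_onb sum_subtractf)

lemma basis_sum_neg:
  fixes F :: "'v \<Rightarrow> 'a::ab_group_add"
  shows "basis_sum g (\<lambda>x. - F x) = - basis_sum g F"
  by (simp add: basis_sum_onb sum_negf)

lemma basis_sum_0: "basis_sum g (\<lambda>x. 0) = 0"
  by (simp add: basis_sum_onb)

lemma basis_sum_mult:
  fixes F :: "'v \<Rightarrow> 'a::semiring_0"
  shows "basis_sum g (\<lambda>x. r * F x) = r * basis_sum g F"
    "basis_sum g (\<lambda>x. F x * r) = basis_sum g F * r"
  by (simp_all add: basis_sum_onb sum_distrib_left sum_distrib_right)

end

lemma linear_on_basis_sum:
  "(\<And>e. linear (\<lambda>X. F X e)) \<Longrightarrow> linear (\<lambda>X. basis_sum g (\<lambda>e. F X e))"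
  unfolding basis_sum_def by (intro linear_compose_sum) auto

section \<open>Trilinear maps\<close>

lemma trilinear_simps:
  assumes "trilinear b"
  shows "b (X + X') Y Z = b X Y Z + b X' Y Z" "b X (Y + Y') Z = b X Y Z + b X Y' Z"
    "b X Y (Z + Z') = b X Y Z + b X Y Z'"
    "b (X - X') Y Z = b X Y Z - b X' Y Z" "b X (Y - Y') Z = b X Y Z - b X Y' Z"
    "b X Y (Z - Z') = b X Y Z - b X Y Z'"
    "b (- X) Y Z = - b X Y Z" "b X (- Y) Z = - b X Y Z" "b X Y (- Z) = - b X Y Z"
    "b (r *\<^sub>R X) Y Z = r *\<^sub>R b X Y Z" "b X (r *\<^sub>R Y) Z = r *\<^sub>R b X Y Z"
    "b X Y (r *\<^sub>R Z) = r *\<^sub>R b X Y Z"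
    "b 0 Y Z = 0" "b X 0 Z = 0" "b X Y 0 = 0"
proof -
  note l = assms[unfolded trilinear_def, THEN conjunct1, rule_format]
    assms[unfolded trilinear_def, THEN conjunct2, THEN conjunct1, rule_format]
    assms[unfolded trilinear_def, THEN conjunct2, THEN conjunct2, rule_format]
  show "b (X + X') Y Z = b X Y Z + b X' Y Z" "b X (Y + Y') Z = b X Y Z + b X Y' Z"
    "b X Y (Z + Z') = b X Y Z + b X Y Z'"
    "b (X - X') Y Z = b X Y Z - b X' Y Z" "b X (Y - Y') Z = b X Y Z - b X Y' Z"
    "b X Y (Z - Z') = b X Y Z - b X Y Z'"
    "b (- X) Y Z = - b X Y Z" "b X (- Y) Z = - b X Y Z" "b X Y (- Z) = - b X Y Z"
    "b (r *\<^sub>R X) Y Z = r *\<^sub>R b X Y Z" "b X (r *\<^sub>R Y) Z = r *\<^sub>R b X Y Z"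
    "b X Y (r *\<^sub>R Z) = r *\<^sub>R b X Y Z"
    "b 0 Y Z = 0" "b X 0 Z = 0" "b X Y 0 = 0"
    using l[THEN linear_add] l[THEN linear_diff] l[THEN linear_neg] l[THEN linear_cmul] l[THEN linear_0]
    by simp_all
qed

lemma trilinearI:
  assumes "\<And>X X' Y Z. b (X + X') Y Z = b X Y Z + b X' Y Z" "\<And>X Y Y' Z. b X (Y + Y') Z = b X Y Z + b X Y' Z"
    "\<And>X Y Z Z'. b X Y (Z + Z') = b X Y Z + b X Y Z'"
    "\<And>r X Y Z. b (r *\<^sub>R X) Y Z = r *\<^sub>R b X Y Z" "\<And>r X Y Z. b X (r *\<^sub>R Y) Z = r *\<^sub>R b X Y Z"
    "\<And>r X Y Z. b X Y (r *\<^sub>R Z) = r *\<^sub>R b X Y Z"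
  shows "trilinear b"
  unfolding trilinear_def using assms by (auto intro!: linearI)

lemma trilinear_linear:
  assumes "trilinear b"
  shows "linear (\<lambda>X. b X Y Z)" "linear (\<lambda>Y. b X Y Z)" "linear (\<lambda>Z. b X Y Z)"
  using assms by (simp_all add: trilinear_def)

lemma trilinear_compose:
  assumes "trilinear b" "linear P" "linear Q" "linear R"
  shows "trilinear (\<lambda>X Y Z. b (P X) (Q Y) (R Z))"
  by (rule trilinearI)
     (simp_all add: trilinear_simps[OF assms(1)] linear_add[OF assms(2)] linear_add[OF assms(3)]
       linear_add[OF assms(4)] linear_cmul[OF assms(2)] linear_cmul[OF assms(3)] linear_cmul[OF assms(4)])

lemma trilinear_perm:
  assumes "trilinear b"
  shows "trilinear (\<lambda>X Y Z. b X Z Y)" "trilinear (\<lambda>X Y Z. b Y X Z)" "trilinear (\<lambda>X Y Z. b Y Z X)"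
    "trilinear (\<lambda>X Y Z. b Z X Y)" "trilinear (\<lambda>X Y Z. b Z Y X)"
  using assms by (auto simp: trilinear_def)

lemma trilinear_add: "trilinear a \<Longrightarrow> trilinear b \<Longrightarrow> trilinear (\<lambda>X Y Z. a X Y Z + b X Y Z)"
  by (rule trilinearI) (simp_all add: trilinear_simps algebra_simps)

lemma trilinear_diff: "trilinear a \<Longrightarrow> trilinear b \<Longrightarrow> trilinear (\<lambda>X Y Z. a X Y Z - b X Y Z)"
  by (rule trilinearI) (simp_all add: trilinear_simps algebra_simps)

lemma trilinear_neg: "trilinear a \<Longrightarrow> trilinear (\<lambda>X Y Z. - a X Y Z)"
  by (rule trilinearI) (simp_all add: trilinear_simps algebra_simps)

lemma trilinear_mult: "trilinear a \<Longrightarrow> trilinear (\<lambda>X Y Z. (r::'a::real_algebra) * a X Y Z)"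
  by (rule trilinearI) (simp_all add: trilinear_simps algebra_simps)

lemma trilinear_scaleR: "trilinear a \<Longrightarrow> trilinear (\<lambda>X Y Z. (r::real) *\<^sub>R a X Y Z)"
  by (rule trilinearI) (simp_all add: trilinear_simps algebra_simps)

lemma trilinear_zero: "trilinear (\<lambda>X Y Z. 0)"
  by (rule trilinearI) simp_all

interpretation tensors: vector_space "tscale :: 'a::field \<Rightarrow> ('v \<Rightarrow> 'v \<Rightarrow> 'v \<Rightarrow> 'a) \<Rightarrow> _"
  by (rule vector_space_tscale)

lemma tscale_apply [simp]: "tscale r b X Y Z = r * b X Y Z"
  by (simp add: tscale_def)

lemma sum_fun_apply: "(\<Sum>p\<in>A. f p) x = (\<Sum>p\<in>A. f p x)"
  by (induction A rule: infinite_finite_induct) auto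

lemma trilinear_plus: "trilinear a \<Longrightarrow> trilinear b \<Longrightarrow> trilinear (a + b)"
  using trilinear_add[of a b] by (simp add: plus_fun_def)

lemma trilinear_minus:
  fixes a b :: "'v::real_vector \<Rightarrow> 'v \<Rightarrow> 'v \<Rightarrow> 'a::real_vector"
  shows "trilinear a \<Longrightarrow> trilinear b \<Longrightarrow> trilinear (a - b)"
  using trilinear_diff[of a b] by (simp add: fun_diff_def)

lemma trilinear_tscale: "trilinear a \<Longrightarrow> trilinear (tscale (r::'a::real_algebra) a)"
  using trilinear_mult[of a r] by (simp add: tscale_def)

lemma trilinear_0: "trilinear 0"
  using trilinear_zero by (simp add: zero_fun_def)

lemma trilinear_eq_on_span:
  assumes b: "trilinear b" and A: "span A = UNIV"
    and 0: "\<And>x y z. x \<in> A \<Longrightarrow> y \<in> A \<Longrightarrow> z \<in> A \<Longrightarrow> b x y z = 0"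
  shows "b = 0"
proof -
  have l: "f x = 0" if "linear f" "\<And>x. x \<in> A \<Longrightarrow> f x = 0" for f :: "'a \<Rightarrow> 'b" and x
    using linear_eq_0_on_span[OF that, of A x] A by simp
  have "b x y z = 0" if "x \<in> A" "y \<in> A" for x y z
    by (rule l[OF trilinear_linear(3)[OF b]]) (use 0 that in auto)
  hence "b x y z = 0" if "x \<in> A" for x y z
    by (rule l[OF trilinear_linear(2)[OF b]]) (use that in auto)
  hence "b x y z = 0" for x y z
    by (rule l[OF trilinear_linear(1)[OF b]]) auto
  thus ?thesis by (simp add: fun_eq_iff)
qed

subsection \<open>Orthogonal projections\<close>

text \<open>Linearity is demanded in the first argument only, and symmetry only for orthogonality,
  so that the result covers both the real form \<open>inner3\<close> and the Hermitian form
  \<open>cinner3\<close>.\<close>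

lemma (in vector_space) gram_schmidt_projection:
  fixes h :: "'b \<Rightarrow> 'b \<Rightarrow> 'a"
  assumes add: "\<And>x x' y. h (x + x') y = h x y + h x' y"
    and scl: "\<And>r x y. h (scale r x) y = r * h x y"
    and refl: "\<And>x y. h x y = 0 \<Longrightarrow> h y x = 0"
    and "finite B" and aniso: "\<And>x. x \<in> span B \<Longrightarrow> h x x = 0 \<Longrightarrow> x = 0"
  shows "\<exists>u\<in>span B. \<forall>t\<in>span B. h (x - u) t = 0"
  using \<open>finite B\<close> aniso
proof (induction B arbitrary: x rule: finite_induct)
  case empty
  have "h x 0 = 0" for x
    using refl[of 0 x] scl[of 0 0 x] by simp
  thus ?case by simp
next
  case (insert c B)
  have diff: "h (x - x') y = h x y - h x' y" for x x' y
    using add[of "x - x'" x' y] by simp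
  have sub: "span B \<subseteq> span (insert c B)" by (rule span_mono) auto
  have an: "\<And>x. x \<in> span B \<Longrightarrow> h x x = 0 \<Longrightarrow> x = 0"
    using insert.prems sub by blast
  obtain d where d: "d \<in> span B" "\<forall>t\<in>span B. h (c - d) t = 0"
    using insert.IH[of c, OF an] by blast
  obtain u where u: "u \<in> span B" "\<forall>t\<in>span B. h (x - u) t = 0"
    using insert.IH[of x, OF an] by blast
  define c' where "c' = c - d"
  \<comment> \<open>\<open>c'\<close> is the part of \<open>c\<close> orthogonal to
    \<open>span B\<close>. If it is isotropic it is zero, so \<open>c\<close> adds nothing to the
    span; otherwise the component of \<open>x - u\<close> along \<open>c'\<close> is added.\<close>
  define w where "w = (if h c' c' = 0 then u else u + scale (h (x - u) c' / h c' c') c')"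
  have c': "c' \<in> span (insert c B)"
    unfolding c'_def using subsetD[OF sub d(1)] by (intro span_diff) (auto intro: span_base)
  have w: "w \<in> span (insert c B)"
    unfolding w_def using u sub c' by (auto intro!: span_add span_scale)
  have oc: "h (x - w) c' = 0"
  proof (cases "h c' c' = 0")
    case True
    hence "c' = 0" using insert.prems c' by blast
    thus ?thesis using refl[of 0 "x - w"] scl[of 0 0 "x - w"] by simp
  next
    case False
    have "x - w = (x - u) - scale (h (x - u) c' / h c' c') c'" using False by (simp add: w_def)
    thus ?thesis using False by (simp only: diff scl) simp
  qed
  have ob: "h (x - w) t = 0" if "t \<in> span B" for t
  proof (cases "h c' c' = 0")
    case True thus ?thesis using u that by (simp add: w_def)
  next
    case False
    have "x - w = (x - u) - scale (h (x - u) c' / h c' c') c'" using False by (simp add: w_def)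
    moreover have "h (x - u) t = 0" "h c' t = 0" using u d that by (auto simp: c'_def)
    ultimately show ?thesis by (simp only: diff[of "x - u"] scl) simp
  qed
  have "h (x - w) t = 0" if t: "t \<in> span (insert c B)" for t
  proof -
    obtain k where "t - scale k c \<in> span B" using t by (auto simp: span_insert)
    hence "(t - scale k c) + scale k d \<in> span B" using d by (intro span_add span_scale) auto
    hence "h (x - w) (t - scale k c') = 0"
      by (intro ob) (simp add: c'_def scale_right_diff_distrib algebra_simps)
    \<comment> \<open>The tensor \<open>t\<close> has to be in the first argument, where
      \<open>h\<close> is linear, before it can be split.\<close>
    hence "h (t - scale k c') (x - w) = 0" by (rule refl)
    moreover have "h c' (x - w) = 0" using oc by (rule refl)
    ultimately have "h t (x - w) = 0" by (simp add: diff scl)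
    thus ?thesis by (rule refl)
  qed
  thus ?case using w by blast
qed

text \<open>Products of three coordinate functionals span all trilinear maps. The finite basis makes
  \<open>gram_schmidt_projection\<close> applicable to every subspace.\<close>

lemma trilinear_finite_basis:
  fixes S :: "('v::euclidean_space \<Rightarrow> 'v \<Rightarrow> 'v \<Rightarrow> 'a::real_normed_field) set"
  assumes "tensors.subspace S" "S \<subseteq> {b. trilinear b}"
  shows "\<exists>B. finite B \<and> tensors.span B = S"
proof -
  define E :: "'v \<times> 'v \<times> 'v \<Rightarrow> 'v \<Rightarrow> 'v \<Rightarrow> 'v \<Rightarrow> 'a"
    where "E = (\<lambda>(i, j, k) X Y Z. of_real ((X \<bullet> i) * (Y \<bullet> j) * (Z \<bullet> k)))"
  define F where "F = E ` ((Basis::'v set) \<times> (Basis::'v set) \<times> (Basis::'v set))"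
  have "S \<subseteq> tensors.span F"
  proof
    fix b assume "b \<in> S"
    hence b: "trilinear b" using assms by auto
    have "b = (\<Sum>p\<in>Basis \<times> Basis \<times> Basis. tscale (b (fst p) (fst (snd p)) (snd (snd p))) (E p))"
    proof (intro ext)
      fix X Y Z
      have "b X Y Z = b (\<Sum>i\<in>Basis. (X \<bullet> i) *\<^sub>R i) (\<Sum>j\<in>Basis. (Y \<bullet> j) *\<^sub>R j) (\<Sum>k\<in>Basis. (Z \<bullet> k) *\<^sub>R k)"
        by (simp add: euclidean_representation)
      also have "\<dots> = (\<Sum>i\<in>Basis. (X \<bullet> i) *\<^sub>R b i (\<Sum>j\<in>Basis. (Y \<bullet> j) *\<^sub>R j) (\<Sum>k\<in>Basis. (Z \<bullet> k) *\<^sub>R k))"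
        by (subst linear_sum[OF trilinear_linear(1)[OF b]]) (simp only: trilinear_simps[OF b])
      also have "\<dots> = (\<Sum>i\<in>Basis. (X \<bullet> i) *\<^sub>R (\<Sum>j\<in>Basis. (Y \<bullet> j) *\<^sub>R b i j (\<Sum>k\<in>Basis. (Z \<bullet> k) *\<^sub>R k)))"
        by (subst linear_sum[OF trilinear_linear(2)[OF b]]) (simp only: trilinear_simps[OF b])
      also have "\<dots> = (\<Sum>i\<in>Basis. (X \<bullet> i) *\<^sub>R (\<Sum>j\<in>Basis. (Y \<bullet> j) *\<^sub>R (\<Sum>k\<in>Basis. (Z \<bullet> k) *\<^sub>R b i j k)))"
        by (subst linear_sum[OF trilinear_linear(3)[OF b]]) (simp only: trilinear_simps[OF b])
      also have "\<dots> = (\<Sum>i\<in>Basis. \<Sum>j\<in>Basis. \<Sum>k\<in>Basis. b i j k * of_real ((X \<bullet> i) * (Y \<bullet> j) * (Z \<bullet> k)))"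
        by (simp add: scaleR_conv_of_real sum_distrib_left mult_ac)
      also have "\<dots> = (\<Sum>p\<in>Basis \<times> Basis \<times> Basis. tscale (b (fst p) (fst (snd p)) (snd (snd p))) (E p)) X Y Z"
        by (simp add: sum.cartesian_product' E_def sum_fun_apply)
      finally show "b X Y Z = (\<Sum>p\<in>Basis \<times> Basis \<times> Basis. tscale (b (fst p) (fst (snd p)) (snd (snd p))) (E p)) X Y Z" .
    qed
    also have "\<dots> \<in> tensors.span F"
    proof (rule tensors.span_sum)
      fix p assume "p \<in> (Basis \<times> Basis \<times> Basis :: ('v \<times> 'v \<times> 'v) set)"
      hence "E p \<in> F" unfolding F_def by (rule imageI)
      hence "E p \<in> tensors.span F" by (rule tensors.span_base)
      from tensors.span_scale[OF this]
      show "tscale (b (fst p) (fst (snd p)) (snd (snd p))) (E p) \<in> tensors.span F" .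
    qed
    finally show "b \<in> tensors.span F" .
  qed
  obtain B where B: "B \<subseteq> S" "tensors.independent B" "S \<subseteq> tensors.span B"
    by (rule tensors.basis_exists[of S])
  have "finite F" by (simp add: F_def)
  hence "finite B" using tensors.independent_span_bound[of F B] B \<open>S \<subseteq> tensors.span F\<close> by blast
  moreover have "tensors.span B = S"
    using B assms(1) by (simp add: subset_antisym tensors.span_minimal)
  ultimately show ?thesis by blast
qed

section \<open>Inner products of real and complex 3-tensors\<close>

context euclidean
begin

lemma inner3_add: "inner3 g (a + a') b = inner3 g a b + inner3 g a' b"
  by (simp add: inner3_def distrib_right basis_sum_add)

lemma inner3_diff: "inner3 g (a - a') b = inner3 g a b - inner3 g a' b"
  by (simp add: inner3_def left_diff_distrib basis_sum_diff)

lemma inner3_tscale: "inner3 g (tscale r a) b = r * inner3 g a b"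
  by (simp add: inner3_def mult.assoc basis_sum_mult)

lemma inner3_sym: "inner3 g a b = inner3 g b a"
  by (simp add: inner3_def mult.commute)

lemma cinner3_add: "cinner3 g (a + a') b = cinner3 g a b + cinner3 g a' b"
  by (simp add: cinner3_def distrib_right basis_sum_add)

lemma cinner3_tscale: "cinner3 g (tscale r a) b = r * cinner3 g a b"
  by (simp add: cinner3_def mult.assoc basis_sum_mult)

lemma cinner3_sym: "cinner3 g a b = cnj (cinner3 g b a)"
  by (simp add: cinner3_def basis_sum_onb mult.commute)

lemma inner3_eq_0:
  assumes "trilinear b" "inner3 g b b = 0"
  shows "b = 0"
proof -
  have 0: "(\<Sum>x\<in>onb. \<Sum>y\<in>onb. \<Sum>z\<in>onb. b x y z * b x y z) = 0"
    using assms(2) by (simp add: inner3_def basis_sum_onb)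
  have "b x y z = 0" if "x \<in> onb" "y \<in> onb" "z \<in> onb" for x y z
    using 0 that by (simp add: sum_nonneg_eq_0_iff finite_onb sum_nonneg)
  thus ?thesis using onb by (intro trilinear_eq_on_span[OF assms(1)]) (auto simp: orthonormal_basis_def)
qed

lemma cinner3_eq_0:
  assumes "trilinear b" "cinner3 g b b = 0"
  shows "b = 0"
proof -
  have "(\<Sum>x\<in>onb. \<Sum>y\<in>onb. \<Sum>z\<in>onb. b x y z * cnj (b x y z)) = 0"
    using assms(2) by (simp add: cinner3_def basis_sum_onb)
  hence "of_real (\<Sum>x\<in>onb. \<Sum>y\<in>onb. \<Sum>z\<in>onb. (cmod (b x y z))\<^sup>2) = (0::complex)"
    by (simp add: complex_norm_square[symmetric] del: of_real_power)
  hence 0: "(\<Sum>x\<in>onb. \<Sum>y\<in>onb. \<Sum>z\<in>onb. (cmod (b x y z))\<^sup>2) = 0"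
    by (simp only: of_real_eq_0_iff)
  have "b x y z = 0" if "x \<in> onb" "y \<in> onb" "z \<in> onb" for x y z
    using 0 that by (simp add: sum_nonneg_eq_0_iff finite_onb sum_nonneg)
  thus ?thesis using onb by (intro trilinear_eq_on_span[OF assms(1)]) (auto simp: orthonormal_basis_def)
qed

lemma ctensor_projection:
  assumes "tensors.subspace S" "S \<subseteq> {b. trilinear b}"
  shows "\<exists>u\<in>S. \<forall>t\<in>S. cinner3 g (b - u) t = 0"
proof -
  obtain B where B: "finite B" "tensors.span B = S" using trilinear_finite_basis[OF assms] by auto
  show ?thesis
    using tensors.gram_schmidt_projection[of "cinner3 g" B b, OF cinner3_add cinner3_tscale _ B(1)]
      cinner3_eq_0 cinner3_sym B(2) assms(2) by (metis (no_types, lifting) complex_cnj_zero mem_Collect_eq subset_iff)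
qed

text \<open>\<open>orth_proj\<close> is a definite description; the difference of two candidates
  lies in \<open>S\<close> and is orthogonal to itself, hence zero because \<open>inner3\<close> is
  definite on trilinear maps.\<close>

lemma orth_proj_unique:
  assumes "tensors.subspace S" "S \<subseteq> {b. trilinear b}"
    and s: "s \<in> S" "\<And>t. t \<in> S \<Longrightarrow> inner3 g (b - s) t = 0"
  shows "orth_proj g S b = s"
  unfolding orth_proj_def
proof (rule the_equality)
  show "s \<in> S \<and> (\<forall>t\<in>S. inner3 g (b - s) t = 0)" using s by blast
  fix u assume u: "u \<in> S \<and> (\<forall>t\<in>S. inner3 g (b - u) t = 0)"
  have m: "u - s \<in> S" using u s assms(1) by (simp add: tensors.subspace_diff)
  hence "inner3 g (b - s) (u - s) = 0" "inner3 g (b - u) (u - s) = 0" using u s by blast+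
  hence "inner3 g (u - s) (u - s) = 0" by (simp add: inner3_diff)
  hence "u - s = 0" using m assms(2) inner3_eq_0 by blast
  thus "u = s" by simp
qed

lemma orth_proj_mem:
  assumes "tensors.subspace S" "S \<subseteq> {b. trilinear b}"
  shows "orth_proj g S b \<in> S" "t \<in> S \<Longrightarrow> inner3 g (orth_proj g S b) t = inner3 g b t"
proof -
  obtain B where B: "finite B" "tensors.span B = S" using trilinear_finite_basis[OF assms] by auto
  have "\<exists>u\<in>S. \<forall>t\<in>S. inner3 g (b - u) t = 0"
    using tensors.gram_schmidt_projection[of "inner3 g" B b, OF inner3_add inner3_tscale _ B(1)]
      inner3_eq_0 inner3_sym B(2) assms(2) by (metis (no_types, lifting) mem_Collect_eq subset_iff)
  then obtain u where u: "u \<in> S" "\<And>t. t \<in> S \<Longrightarrow> inner3 g (b - u) t = 0" by blast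
  have e: "orth_proj g S b = u" by (rule orth_proj_unique[OF assms u])
  show "orth_proj g S b \<in> S" using e u by simp
  show "t \<in> S \<Longrightarrow> inner3 g (orth_proj g S b) t = inner3 g b t"
    using u(2)[of t] by (simp add: e inner3_diff)
qed

end

section \<open>Quaternion-Hermitian vector spaces\<close>

locale qh = euclidean g for g :: "('v::euclidean_space) form2" +
  fixes I J K :: "'v endo"
  assumes qh: "quaternion_hermitian g I J K"
begin

lemma linear_IJK: "linear I" "linear J" "linear K"
  using qh by (simp_all add: quaternion_hermitian_def)

lemma K_eq: "K X = I (J X)"
  using qh by (simp add: quaternion_hermitian_def)

lemma IJK_simps:
  "I (I X) = - X" "J (J X) = - X" "J (I X) = - I (J X)"
  "I (X + Y) = I X + I Y" "I (X - Y) = I X - I Y" "I (- X) = - I X" "I (r *\<^sub>R X) = r *\<^sub>R I X" "I 0 = 0"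
  "J (X + Y) = J X + J Y" "J (X - Y) = J X - J Y" "J (- X) = - J X" "J (r *\<^sub>R X) = r *\<^sub>R J X" "J 0 = 0"
proof -
  show "I (I X) = - X" "J (J X) = - X" using qh by (simp_all add: quaternion_hermitian_def)
  have "\<forall>X. K X = I (J X)" "\<forall>X. K X = - J (I X)" using qh unfolding quaternion_hermitian_def by blast+
  thus "J (I X) = - I (J X)" by (metis minus_minus)
qed (simp_all add: linear_IJK[THEN linear_add] linear_IJK[THEN linear_diff] linear_IJK[THEN linear_neg]
      linear_IJK[THEN linear_cmul] linear_IJK[THEN linear_0])

lemma g_IJK:
  "g (I X) (I Y) = g X Y" "g (J X) (J Y) = g X Y" "g (K X) (K Y) = g X Y"
  using qh by (simp_all add: quaternion_hermitian_def)

lemma g_IJ_left: "g (I X) Y = - g X (I Y)" "g (J X) Y = - g X (J Y)"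
  using g_IJK(1)[of X "I Y"] g_IJK(2)[of X "J Y"] by (simp_all add: IJK_simps g_simps)

lemma g_self: "g X (I X) = 0" "g X (J X) = 0" "g X (I (J X)) = 0"
proof -
  show "g X (I X) = 0" using g_IJ_left(1)[of X X] g_sym[of X "I X"] by simp
  show "g X (J X) = 0" using g_IJ_left(2)[of X X] g_sym[of X "J X"] by simp
  have "g X (I (J X)) = - g (I (J X)) X" by (simp add: g_IJ_left IJK_simps g_simps)
  thus "g X (I (J X)) = 0" using g_sym[of X "I (J X)"] by simp
qed

text \<open>A normal form: \<open>K\<close> is replaced by \<open>I\<close> after \<open>J\<close>,
  \<open>I\<close> is moved in front of \<open>J\<close>, and all structure maps are moved to the
  right argument of \<open>g\<close>.\<close>

lemmas qsimps = K_eq IJK_simps g_IJ_left g_self g_simps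

section \<open>Quaternionic orthogonality and rotations of a quaternionic line\<close>

definition horth :: "'v \<Rightarrow> 'v \<Rightarrow> bool" where
  "horth X Y \<longleftrightarrow> g X Y = 0 \<and> g X (I Y) = 0 \<and> g X (J Y) = 0 \<and> g X (K Y) = 0"

lemma horth_sym: "horth X Y \<longleftrightarrow> horth Y X"
  unfolding horth_def
  using g_sym[of X Y] g_sym[of "I X" Y] g_sym[of "J X" Y] g_sym[of "K X" Y] by (auto simp: qsimps)

lemma horth_add: "horth X Z \<Longrightarrow> horth Y Z \<Longrightarrow> horth (X + Y) Z" "horth X Z \<Longrightarrow> horth Y Z \<Longrightarrow> horth (X - Y) Z"
    "horth Z X \<Longrightarrow> horth Z Y \<Longrightarrow> horth Z (X + Y)" "horth Z X \<Longrightarrow> horth Z Y \<Longrightarrow> horth Z (X - Y)"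
  by (simp_all add: horth_def qsimps)

lemma horth_mult: "horth X Z \<Longrightarrow> horth (r *\<^sub>R X) Z" "horth X Z \<Longrightarrow> horth (I X) Z"
    "horth X Z \<Longrightarrow> horth (J X) Z" "horth X Z \<Longrightarrow> horth (K X) Z"
    "horth Z X \<Longrightarrow> horth Z (r *\<^sub>R X)" "horth Z X \<Longrightarrow> horth Z (I X)"
    "horth Z X \<Longrightarrow> horth Z (J X)" "horth Z X \<Longrightarrow> horth Z (K X)"
  by (simp_all add: horth_def qsimps)

text \<open>For a unit vector \<open>u\<close>, the quaternionic-linear map with \<open>u \<mapsto> w\<close> that annihilates
  the quaternionic complement of \<open>u\<close>.\<close>

definition qmap :: "'v \<Rightarrow> 'v \<Rightarrow> 'v \<Rightarrow> 'v" where
  "qmap u w X = g X u *\<^sub>R w + g X (I u) *\<^sub>R I w + g X (J u) *\<^sub>R J w + g X (K u) *\<^sub>R K w"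

abbreviation proj :: "'v \<Rightarrow> 'v \<Rightarrow> 'v" where "proj u \<equiv> qmap u u"

text \<open>For a unit vector \<open>u\<close> this is the element of a maximal torus of Sp(n) with
  angle pi/2 on the quaternionic line of \<open>u\<close> and angle 0 elsewhere.\<close>

definition rot :: "'v \<Rightarrow> 'v \<Rightarrow> 'v" where
  "rot u X = X - proj u X + qmap u (I u) X"

lemma linear_qmap: "linear (qmap u w)"
  by (rule linearI) (simp_all add: qmap_def g_simps algebra_simps)

lemma qmap_commute: "qmap u w (I X) = I (qmap u w X)" "qmap u w (J X) = J (qmap u w X)"
  by (simp_all add: qmap_def qsimps algebra_simps)

lemma linear_rot: "linear (rot u)"
  unfolding rot_def by (intro linear_compose_add linear_compose_sub linear_qmap linear_ident)

lemma rot_commute: "rot u (I X) = I (rot u X)" "rot u (J X) = J (rot u X)" "rot u (K X) = K (rot u X)"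
  by (simp_all add: rot_def qmap_commute qsimps)

lemma proj_horth: "horth X u \<Longrightarrow> proj u X = 0" "horth X u \<Longrightarrow> qmap u w X = 0"
  by (simp_all add: horth_def qmap_def)

lemma rot_horth: "horth X u \<Longrightarrow> rot u X = X"
  by (simp add: rot_def proj_horth)

context
  fixes u assumes u: "g u u = 1"
begin

lemma qmap_u: "qmap u w u = w"
  by (simp add: qmap_def qsimps u)

lemma rot_u: "rot u u = I u"
  by (simp add: rot_def qmap_u)

text \<open>On the line of \<open>u\<close> the map differs from \<open>I\<close>: commuting with
  \<open>J\<close>, it sends \<open>J u\<close> to \<open>J (I u) = - I (J u)\<close>. So
  \<open>u\<close> and \<open>J u\<close> have opposite weights.\<close>

lemma rot_block: "rot u (I u) = - u" "rot u (J u) = - I (J u)" "rot u (I (J u)) = J u"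
  using rot_commute[of u u] by (simp_all add: rot_u qsimps rot_commute)

lemma proj_orth: "horth (X - proj u X) u"
  by (simp add: horth_def qmap_def qsimps u)

lemma rot_rot_proj: "rot u (rot u (proj u X)) = - proj u X"
  by (simp add: qmap_def linear_add[OF linear_rot] linear_diff[OF linear_rot] linear_cmul[OF linear_rot]
      linear_neg[OF linear_rot] rot_commute rot_u qsimps)

lemma rot_rot: "rot u (rot u X) = X - 2 *\<^sub>R proj u X"
proof -
  have "rot u (rot u ((X - proj u X) + proj u X)) = (X - proj u X) - proj u X"
    by (simp only: linear_add[OF linear_rot] rot_rot_proj rot_horth[OF proj_orth]) simp
  thus ?thesis by (simp add: scaleR_2)
qed

text \<open>\<open>rot u\<close> is the identity plus \<open>qmap u d\<close>, where
  \<open>d\<close> has squared length 2. The terms linear in \<open>d\<close> contribute -2 times,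
  the quadratic ones 2 times the inner product of the projections to the line of
  \<open>u\<close>.\<close>

lemma rot_isometry: "g (rot u X) (rot u Y) = g X Y"
proof -
  define d where "d = I u - u"
  have dd: "g d d = 2" "g d (I d) = 0" "g d (J d) = 0" "g d (K d) = 0"
    by (simp_all add: d_def qsimps u)
  have r: "rot u X = X + g X u *\<^sub>R d + g X (I u) *\<^sub>R I d + g X (J u) *\<^sub>R J d + g X (K u) *\<^sub>R K d" for X
    by (simp add: rot_def qmap_def d_def qsimps algebra_simps)
  have gd: "g X d = g X (I u) - g X u" "g X (I d) = - g X u - g X (I u)"
    "g X (J d) = - g X (K u) - g X (J u)" "g X (K d) = g X (J u) - g X (K u)" for X
    by (simp_all add: d_def qsimps)
  have s: "g d Y = g Y d" "g (I d) Y = g Y (I d)" "g (J d) Y = g Y (J d)" "g (K d) Y = g Y (K d)" for Y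
    by (rule g_sym)+
  have m: "g (I d) (I d) = 2" "g (I d) (J d) = 0" "g (I d) (K d) = 0"
    "g (J d) (J d) = 2" "g (J d) (K d) = 0" "g (K d) (K d) = 2"
    using dd by (simp_all add: g_IJK qsimps)
  have m': "g (J d) (I d) = 0" "g (K d) (I d) = 0" "g (K d) (J d) = 0"
    using m by (metis g_sym)+
  have d': "g (I d) d = 0" "g (J d) d = 0" "g (K d) d = 0"
    using dd by (metis g_sym)+
  have "g (rot u X) (rot u Y) = g X Y
      + (g Y u * g X d + g Y (I u) * g X (I d) + g Y (J u) * g X (J d) + g Y (K u) * g X (K d))
      + (g X u * g d Y + g X (I u) * g (I d) Y + g X (J u) * g (J d) Y + g X (K u) * g (K d) Y)
      + 2 * (g X u * g Y u + g X (I u) * g Y (I u) + g X (J u) * g Y (J u) + g X (K u) * g Y (K u))"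
    unfolding r by (simp only: g_simps dd m m' d') (simp add: algebra_simps)
  thus ?thesis
    unfolding s gd by (simp add: algebra_simps)
qed

lemma rot_Sp: "rot u \<in> Sp g I J K"
  unfolding Sp_def using linear_rot rot_isometry rot_commute by auto

end

section \<open>The group Sp(n) and its eigenvectors among tensors\<close>

lemma Sp_D:
  assumes "a \<in> Sp g I J K"
  shows "linear a" "g (a X) (a Y) = g X Y" "a (I X) = I (a X)" "a (J X) = J (a X)" "a (K X) = K (a X)"
    "bij a" "inv a (a X) = X" "a (inv a X) = X"
  using assms isometry_bij[of a]
  by (auto simp: Sp_def bij_is_inj bij_is_surj surj_f_inv_f)

lemma inv_Sp:
  assumes "a \<in> Sp g I J K"
  shows "inv a \<in> Sp g I J K"
proof -
  note a = Sp_D[OF assms]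
  have "linear (inv a)"
    using a by (metis bij_is_inj bij_is_surj inj_linear_imp_inv_linear)
  moreover have "g (inv a X) (inv a Y) = g X Y" for X Y
    using a(2)[of "inv a X" "inv a Y"] by (simp add: a)
  moreover have "inv a (A X) = A (inv a X)" if "A \<in> {I, J, K}" for A X
  proof -
    have "a (A (inv a X)) = A X" using that a by auto
    thus ?thesis using a(7)[of "A (inv a X)"] by simp
  qed
  ultimately show ?thesis by (auto simp: Sp_def)
qed

lemma act_eigen:
  assumes "a \<in> Sp g I J K" "act a b = tscale r b"
  shows "b X Y Z = r * b (a X) (a Y) (a Z)"
proof -
  have "act a b (a X) (a Y) (a Z) = b X Y Z" by (simp add: act_def Sp_D[OF assms(1)])
  thus ?thesis by (simp add: assms(2))
qed

section \<open>Equivariant maps\<close>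

text \<open>The maps are total functions, linear and equivariant on \<open>S\<close> only. The
  target is left open here and enters through \<open>V\<close> in \<open>no_hom\<close>.\<close>

definition sp_hom :: "'v ctensor3 set \<Rightarrow> ('v ctensor3 \<Rightarrow> 'v ctensor3) \<Rightarrow> bool" where
  "sp_hom S f \<longleftrightarrow> (\<forall>b\<in>S. \<forall>b'\<in>S. f (b + b') = f b + f b') \<and>
     (\<forall>r. \<forall>b\<in>S. f (tscale r b) = tscale r (f b)) \<and>
     (\<forall>a\<in>Sp g I J K. \<forall>b\<in>S. f (act a b) = act a (f b))"

definition no_hom :: "('v ctensor3 set \<Rightarrow> bool) \<Rightarrow> 'v ctensor3 set \<Rightarrow> bool" where
  "no_hom \<tau> V \<longleftrightarrow> (\<forall>S f. sp_module g I J K S \<longrightarrow> \<tau> S \<longrightarrow> sp_hom S f \<longrightarrow> f ` S \<subseteq> V \<longrightarrow> (\<forall>b\<in>S. f b = 0))"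

text \<open>One-forms \<open>\<beta>\<close> are represented by the 3-tensors \<open>\<beta> \<otimes> g\<close>, so that all equivariant maps
  have values in 3-tensors.\<close>

definition V1 :: "'v ctensor3 set" where
  "V1 = {\<lambda>X Y Z. g Y Z *\<^sub>R \<beta> X | \<beta>. linear \<beta>}"

text \<open>The complexification of W1, in a form where \<open>I\<close> moves between the first two
  arguments. It is the target of \<open>cyclic_sum\<close> on W1 + W2: a module without
  homomorphisms into it lies in W2.\<close>

definition Vskew :: "'v ctensor3 set" where
  "Vskew = {b. trilinear b \<and> (\<forall>X Y Z. b Y X Z = - b X Y Z) \<and> (\<forall>X Y Z. b X Z Y = - b X Y Z) \<and>
     (\<forall>X Y Z. b (I X) Y Z = b X (I Y) Z)}"

text \<open>The complexification of W2. It is the target of the identity minus a third of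
  \<open>cyclic_sum\<close>: a module in W1 + W2 without homomorphisms into it lies in W1.\<close>

definition Vcyc :: "'v ctensor3 set" where
  "Vcyc = {b. trilinear b \<and> (\<forall>X Y Z. b X Z Y = - b X Y Z) \<and>
     (\<forall>X Y Z. b (I X) Y Z = b X (I Y) Z) \<and> (\<forall>X Y Z. b X Y Z + b Y Z X + b Z X Y = 0)}"

lemma sp_homD:
  assumes "sp_hom S f"
  shows "b \<in> S \<Longrightarrow> b' \<in> S \<Longrightarrow> f (b + b') = f b + f b'" "b \<in> S \<Longrightarrow> f (tscale r b) = tscale r (f b)"
    "a \<in> Sp g I J K \<Longrightarrow> b \<in> S \<Longrightarrow> f (act a b) = act a (f b)"
  using assms by (auto simp: sp_hom_def)

lemma sp_moduleD:
  assumes "sp_module g I J K S"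
  shows "b \<in> S \<Longrightarrow> trilinear b" "tensors.subspace S"
    "a \<in> Sp g I J K \<Longrightarrow> b \<in> S \<Longrightarrow> act a b \<in> S"
  using assms by (auto simp: sp_module_def)

lemma act_simps: "act a (b + b') = act a b + act a b'" "act a (tscale r b) = tscale r (act a b)" "act a 0 = 0"
  by (simp_all add: act_def fun_eq_iff)

lemma tscale_zero: "tscale r (0 :: 'v ctensor3) = 0" "tscale 0 b = (0 :: 'v ctensor3)"
  by (simp_all add: fun_eq_iff)

lemma hom_kernel_subspace:
  assumes S: "tensors.subspace S" and f: "sp_hom S f"
  shows "tensors.subspace {b \<in> S. f b = 0}"
proof -
  have "f 0 = 0"
    using sp_homD(2)[OF f tensors.subspace_0[OF S], of 0] by (simp add: tscale_zero)
  thus ?thesis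
    using tensors.subspace_0[OF S] tensors.subspace_add[OF S] tensors.subspace_scale[OF S]
    by (intro tensors.subspaceI) (simp_all add: sp_homD[OF f] tscale_zero)
qed

lemma sp_module_kernel:
  assumes S: "sp_module g I J K S" and f: "sp_hom S f"
  shows "sp_module g I J K {b \<in> S. f b = 0}"
  unfolding sp_module_def using sp_moduleD[OF S] hom_kernel_subspace[OF sp_moduleD(2)[OF S] f]
  by (auto simp: sp_homD[OF f] act_simps)

lemma sp_hom_inv:
  assumes S: "sp_module g I J K S" and f: "sp_hom S f" and bij: "bij_betw f S R"
  shows "sp_hom R (inv_into S f)"
proof -
  note s = sp_moduleD[OF S]
  let ?h = "inv_into S f"
  have h: "?h b \<in> S" "f (?h b) = b" if "b \<in> R" for b
    using bij_betw_inv_into[OF bij] bij_betw_inv_into_right[OF bij that] that by (auto simp: bij_betw_def)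
  have l: "?h (f b) = b" if "b \<in> S" for b using bij that by (rule bij_betw_inv_into_left)
  have "?h (b + b') = ?h b + ?h b'" if "b \<in> R" "b' \<in> R" for b b'
    using l[OF tensors.subspace_add[OF s(2) h(1)[OF that(1)] h(1)[OF that(2)]]]
    by (simp only: sp_homD(1)[OF f h(1)[OF that(1)] h(1)[OF that(2)]] h(2) that)
  moreover have "?h (tscale r b) = tscale r (?h b)" if "b \<in> R" for r b
    using l[OF tensors.subspace_scale[OF s(2) h(1)[OF that], of r]]
    by (simp only: sp_homD(2)[OF f h(1)[OF that]] h(2) that)
  moreover have "?h (act a b) = act a (?h b)" if "a \<in> Sp g I J K" "b \<in> R" for a b
    using l[OF s(3)[OF that(1) h(1)[OF that(2)]]]
    by (simp only: sp_homD(3)[OF f that(1) h(1)[OF that(2)]] h(2) that)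
  ultimately show ?thesis unfolding sp_hom_def by blast
qed

lemma sp_hom_compose:
  assumes "sp_hom S f" "sp_hom R h" "f ` S \<subseteq> R"
  shows "sp_hom S (h \<circ> f)"
  unfolding sp_hom_def comp_def
proof (intro conjI ballI allI)
  have m: "f b \<in> R" if "b \<in> S" for b using assms(3) that by blast
  show "h (f (b + b')) = h (f b) + h (f b')" if "b \<in> S" "b' \<in> S" for b b'
    by (simp only: sp_homD(1)[OF assms(1) that] sp_homD(1)[OF assms(2) m[OF that(1)] m[OF that(2)]])
  show "h (f (tscale r b)) = tscale r (h (f b))" if "b \<in> S" for r b
    by (simp only: sp_homD(2)[OF assms(1) that] sp_homD(2)[OF assms(2) m[OF that]])
  show "h (f (act a b)) = act a (h (f b))" if "a \<in> Sp g I J K" "b \<in> S" for a b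
    by (simp only: sp_homD(3)[OF assms(1) that] sp_homD(3)[OF assms(2) that(1) m[OF that(2)]])
qed

subsection \<open>The module \<open>K\<close>\<close>

text \<open>The eigenvalue of \<open>rot u\<close> on a vector of weight \<open>2 \<epsilon>\<^sub>1 + \<dots>\<close> is \<open>- 1\<close>.\<close>

lemma V1_eigen_zero:
  assumes "b \<in> V1" "g u u = 1" "act (rot u) b = tscale (- 1) b"
  shows "b = 0"
proof -
  obtain \<beta> where \<beta>: "linear \<beta>" and b: "b = (\<lambda>X Y Z. g Y Z *\<^sub>R \<beta> X)"
    using assms(1) by (auto simp: V1_def)
  have e: "\<beta> X = - \<beta> (rot u X)" for X
    using act_eigen[OF rot_Sp[OF assms(2)] assms(3), of X u u]
    by (simp add: b rot_isometry[OF assms(2)] assms(2))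
  \<comment> \<open>The rotation is the identity on the complement of the line of \<open>u\<close>,
    and its square is -1 on the line, so its eigenvalues are 1, i and -i.\<close>
  have 1: "\<beta> (X - proj u X) = 0" for X
    using e[of "X - proj u X"] by (simp add: rot_horth[OF proj_orth[OF assms(2)]])
  have 2: "\<beta> (proj u X) = 0" for X
    using e[of "proj u X"] e[of "rot u (proj u X)"]
    by (simp add: rot_rot_proj[OF assms(2)] linear_neg[OF \<beta>])
  have "\<beta> X = 0" for X
    using 1[of X] 2[of X] by (simp add: linear_diff[OF \<beta>])
  thus ?thesis by (simp add: b fun_eq_iff)
qed

text \<open>Each argument is split into its part in the line of \<open>u\<close> and the rest. With
  no argument in the line, \<open>rot u\<close> acts by 1. With an odd number, its square acts by -1
  instead of 1. With two, alternation and \<open>bI\<close> leave only the values on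
  \<open>u, J u\<close>, whose weights cancel, so \<open>rot u\<close> acts by 1 again.\<close>

lemma Vskew_eigen_zero:
  assumes "b \<in> Vskew" and u: "g u u = 1" and "act (rot u) b = tscale (- 1) b"
  shows "b = 0"
proof -
  have b: "trilinear b" and s12: "\<And>X Y Z. b Y X Z = - b X Y Z" and s23: "\<And>X Y Z. b X Z Y = - b X Y Z"
    and bI: "\<And>X Y Z. b (I X) Y Z = b X (I Y) Z"
    using assms(1) unfolding Vskew_def by blast+
  note t = trilinear_simps[OF b]
  have e: "b X Y Z = - b (rot u X) (rot u Y) (rot u Z)" for X Y Z
    using act_eigen[OF rot_Sp[OF u] assms(3), of X Y Z] by simp
  have e2: "b X Y Z = b (rot u (rot u X)) (rot u (rot u Y)) (rot u (rot u Z))" for X Y Z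
    using e[of X Y Z] e[of "rot u X" "rot u Y" "rot u Z"] by simp
  define c where "c X = X - proj u X" for X
  have rc: "rot u (c X) = c X" for X
    unfolding c_def by (rule rot_horth[OF proj_orth[OF u]])
  note rp = rot_rot_proj[OF u]
  have ccc: "b (c X) (c Y) (c Z) = 0" for X Y Z
    using e[of "c X" "c Y" "c Z"] by (simp add: rc)
  have ppp: "b (proj u X) (proj u Y) (proj u Z) = 0" for X Y Z
    using e2[of "proj u X" "proj u Y" "proj u Z"] by (simp add: rp t)
  have pcc: "b (proj u X) (c Y) (c Z) = 0" for X Y Z
    using e2[of "proj u X" "c Y" "c Z"] by (simp add: rp rc t)
  have diag: "b X X Z = 0" for X Z using s12[of X X Z] by simp
  have ppc: "b (proj u X) (proj u Y) (c Z) = 0" for X Y Z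
  proof -
    have Id: "b X (I X) Z = 0" for X Z
      using bI[of X X Z] s12[of "I X" X Z] by simp
    have 1: "b u (J u) (c Z) = 0"
      using e[of u "J u" "c Z"] bI[of u "I (J u)" "c Z"]
      by (simp add: rc rot_u[OF u] rot_block[OF u] t IJK_simps)
    have 2: "b u (I (J u)) (c Z) = 0"
      using e[of u "I (J u)" "c Z"] bI[of u "J u" "c Z"]
      by (simp add: rc rot_u[OF u] rot_block[OF u] t IJK_simps)
    have 3: "b (I u) (J u) (c Z) = 0" "b (I u) (I (J u)) (c Z) = 0"
      using 1 2 by (simp_all add: bI t IJK_simps)
    have 4: "b (J u) (I u) (c Z) = 0" "b (I (J u)) (I u) (c Z) = 0" "b (J u) u (c Z) = 0"
      "b (I (J u)) u (c Z) = 0" "b (I (J u)) (J u) (c Z) = 0" "b (I u) u (c Z) = 0"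
      using 1 2 3 Id[of "J u" "c Z"] Id[of u "c Z"] s12 by (metis neg_equal_0_iff_equal)+
    show ?thesis
      by (simp add: qmap_def K_eq t 1 2 3 4 Id diag)
  qed
  have pcp: "b (proj u X) (c Y) (proj u Z) = 0" for X Y Z
    using ppc s23 by (metis neg_equal_0_iff_equal)
  have cpp: "b (c X) (proj u Y) (proj u Z) = 0" for X Y Z
    using pcp s12 by (metis neg_equal_0_iff_equal)
  have cpc: "b (c X) (proj u Y) (c Z) = 0" for X Y Z
    using pcc s12 by (metis neg_equal_0_iff_equal)
  have ccp: "b (c X) (c Y) (proj u Z) = 0" for X Y Z
    using cpc s23 by (metis neg_equal_0_iff_equal)
  have "b X Y Z = 0" for X Y Z
  proof -
    have "b X Y Z = b (c X + proj u X) (c Y + proj u Y) (c Z + proj u Z)" by (simp add: c_def)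
    also have "\<dots> = 0" by (simp only: t ccc ppp pcc ppc pcp cpp cpc ccp) simp
    finally show ?thesis .
  qed
  thus ?thesis by (simp add: fun_eq_iff)
qed

lemma highest_weight_eigen:
  assumes "has_highest_weight g I J K (\<lambda>k. if k = 0 then 2 else if k = 1 then 1 else 0) S"
    and dim: "DIM('v) \<ge> 4"
  shows "\<exists>u b. g u u = 1 \<and> b \<in> S \<and> b \<noteq> 0 \<and> act (rot u) b = tscale (- 1) b"
proof -
  obtain e b where e: "quaternionic_frame g I J K e" and b: "b \<in> S" "b \<noteq> 0"
    and w: "weight_vector g I J K e (\<lambda>k. if k = 0 then 2 else if k = 1 then 1 else 0) b"
    using assms(1) unfolding has_highest_weight_def by blast
  let ?n = "DIM('v) div 4"
  have n: "?n > 0" using dim by simp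
  have u: "g (e 0) (e 0) = 1" using e n by (simp add: quaternionic_frame_def)
  \<comment> \<open>With this angle the torus element is \<open>rot (e 0)\<close>, and the
    coefficient 2 of the weight turns pi/2 into pi, which gives the eigenvalue -1.\<close>
  define \<theta> where "\<theta> k = (if k = 0 then pi / 2 else 0)" for k :: nat
  have "rot (e 0) (e k) = cos (\<theta> k) *\<^sub>R e k + sin (\<theta> k) *\<^sub>R I (e k)" if "k < ?n" for k
  proof (cases "k = 0")
    case True thus ?thesis by (simp add: \<theta>_def rot_u[OF u])
  next
    case False
    hence "horth (e k) (e 0)" using e n that by (auto simp: quaternionic_frame_def horth_def)
    thus ?thesis using False by (simp add: \<theta>_def rot_horth)
  qed
  hence a: "act (rot (e 0)) b = tscale (cis (\<Sum>k < ?n. of_int (if k = 0 then 2 else if k = 1 then 1 else 0) * \<theta> k)) b"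
    using w rot_Sp[OF u] unfolding weight_vector_def by blast
  have "(\<Sum>k < ?n. of_int (if k = 0 then 2 else if k = 1 then 1 else 0) * \<theta> k) = (\<Sum>k < ?n. if k = 0 then pi else 0)"
    by (intro sum.cong) (auto simp: \<theta>_def)
  also have "\<dots> = pi" using n by simp
  finally show ?thesis using a b u by (auto simp: cis_pi)
qed

text \<open>The image of a highest weight vector is again an eigenvector for -1, hence zero by the
  hypothesis on \<open>V\<close>. So the kernel is a nonzero submodule of an irreducible
  module.\<close>

lemma type_K_no_hom:
  assumes dim: "DIM('v) \<ge> 4"
    and V: "\<And>b u. b \<in> V \<Longrightarrow> g u u = 1 \<Longrightarrow> act (rot u) b = tscale (- 1) b \<Longrightarrow> b = 0"
  shows "no_hom (type_K g I J K) V"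
  unfolding no_hom_def
proof (intro allI impI ballI)
  fix S f b
  assume S: "sp_module g I J K S" and K: "type_K g I J K S" and f: "sp_hom S f" and fV: "f ` S \<subseteq> V" and "b \<in> S"
  obtain u c where u: "g u u = 1" and c: "c \<in> S" "c \<noteq> 0" "act (rot u) c = tscale (- 1) c"
    using highest_weight_eigen[OF _ dim, of S] K unfolding type_K_def by blast
  have "act (rot u) (f c) = f (act (rot u) c)" using sp_homD(3)[OF f rot_Sp[OF u] c(1)] by (rule sym)
  hence "act (rot u) (f c) = tscale (- 1) (f c)" by (simp only: c(3) sp_homD(2)[OF f c(1)])
  moreover have "f c \<in> V" using fV c(1) by (rule subsetD[OF _ imageI])
  ultimately have "f c = 0" using V u by blast
  have "{b \<in> S. f b = 0} = {0} \<or> {b \<in> S. f b = 0} = S"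
    using K sp_module_kernel[OF S f] unfolding type_K_def sp_irreducible_def
    by (elim conjE) (drule spec[of _ "{b \<in> S. f b = 0}"], simp)
  moreover have "{b \<in> S. f b = 0} \<noteq> {0}" using \<open>f c = 0\<close> c(1,2) by blast
  ultimately show "f b = 0" using \<open>b \<in> S\<close> by blast
qed

subsection \<open>The module \<open>\<Lambda>\<^sup>3\<^sub>0E\<close>\<close>

text \<open>The element of E dual to \<open>x\<close>. It is complex linear in \<open>Y\<close> but
  antilinear in \<open>x\<close>, whence the factors \<open>- \<i>\<close> in
  \<open>wedge3_I\<close>.\<close>

definition \<xi> :: "'v \<Rightarrow> 'v \<Rightarrow> complex" where
  "\<xi> x Y = Complex (g x Y) (g (I x) Y)"

definition xi3 :: "'v \<Rightarrow> 'v \<Rightarrow> 'v \<Rightarrow> 'v ctensor3" where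
  "xi3 x y z = (\<lambda>X Y Z. \<xi> x X * \<xi> y Y * \<xi> z Z)"

definition wedge3 :: "'v \<Rightarrow> 'v \<Rightarrow> 'v \<Rightarrow> 'v ctensor3" where
  "wedge3 x y z = (\<lambda>X Y Z. xi3 x y z X Y Z - xi3 x z y X Y Z - xi3 y x z X Y Z
     + xi3 y z x X Y Z + xi3 z x y X Y Z - xi3 z y x X Y Z)"

lemma linear_xi: "linear (\<xi> x)"
  by (rule linearI) (simp_all add: \<xi>_def g_simps complex_eq_iff)

lemma xi_I: "\<xi> x (I Y) = \<i> * \<xi> x Y" "\<xi> (I x) Y = - \<i> * \<xi> x Y"
  by (simp_all add: \<xi>_def qsimps complex_eq_iff)

lemma trilinear_xi3: "trilinear (xi3 x y z)"
  by (rule trilinearI)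
    (simp_all add: xi3_def linear_add[OF linear_xi] linear_cmul[OF linear_xi] algebra_simps)

lemma trilinear_wedge3: "trilinear (wedge3 x y z)"
  unfolding wedge3_def by (intro trilinear_add trilinear_diff trilinear_xi3)

lemma wedge3_L3E: "wedge3 x y z \<in> L3E I"
  unfolding L3E_def using trilinear_wedge3[of x y z]
  by (auto simp: wedge3_def xi3_def xi_I algebra_simps)

lemma act_wedge3:
  assumes "a \<in> Sp g I J K"
  shows "act a (wedge3 x y z) = wedge3 (a x) (a y) (a z)"
proof -
  have "\<xi> x (inv a Y) = \<xi> (a x) Y" for x Y
    using Sp_D(2)[OF assms, of _ "inv a Y"] Sp_D(3)[OF assms]
    by (simp add: \<xi>_def Sp_D(8)[OF assms] flip: Sp_D(3)[OF assms])
  thus ?thesis by (simp add: act_def wedge3_def xi3_def)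
qed

lemma wedge3_I: "wedge3 (I x) y z = tscale (- \<i>) (wedge3 x y z)"
  "wedge3 x (I y) z = tscale (- \<i>) (wedge3 x y z)" "wedge3 x y (I z) = tscale (- \<i>) (wedge3 x y z)"
  by (simp_all add: wedge3_def xi3_def xi_I fun_eq_iff algebra_simps)

text \<open>The real and imaginary parts of \<open>\<xi>\<close> reproduce \<open>F x\<close> and
  \<open>- \<i> * F (I x)\<close>, which coincide; hence the factor 2. Three contractions give the 8
  of \<open>cinner3_xi3\<close>, and the six permutations then give the 48 of
  \<open>cinner3_wedge3\<close>.\<close>

lemma contract_xi:
  assumes "linear F" "\<And>X. F (I X) = \<i> * F X"
  shows "basis_sum g (\<lambda>e. F e * cnj (\<xi> x e)) = 2 * F x"
proof -
  have "basis_sum g (\<lambda>e. F e * cnj (\<xi> x e))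
      = basis_sum g (\<lambda>e. g x e *\<^sub>R F e - \<i> * (g (I x) e *\<^sub>R F e))"
    unfolding basis_sum_onb by (intro sum.cong) (auto simp: \<xi>_def complex_eq_iff)
  also have "\<dots> = F x - \<i> * F (I x)"
    by (simp only: basis_sum_diff basis_sum_mult basis_sum_g_contract[OF assms(1)])
  also have "\<dots> = 2 * F x" by (simp add: assms(2) mult.assoc[symmetric])
  finally show ?thesis .
qed

lemma L3E_D:
  assumes "b \<in> L3E I"
  shows "trilinear b" "b (I X) Y Z = \<i> * b X Y Z" "b Y X Z = - b X Y Z" "b X Z Y = - b X Y Z"
    "b X (I Y) Z = \<i> * b X Y Z" "b X Y (I Z) = \<i> * b X Y Z"
proof -
  show 1: "trilinear b" "b (I X) Y Z = \<i> * b X Y Z" "b Y X Z = - b X Y Z" "b X Z Y = - b X Y Z" for X Y Z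
    using assms unfolding L3E_def by blast+
  show 2: "b X (I Y) Z = \<i> * b X Y Z" for X Y Z
    using 1(3)[of "I Y" X Z] 1(3)[of Y X Z] by (simp add: 1(2))
  show "b X Y (I Z) = \<i> * b X Y Z"
    using 1(4)[of X "I Z" Y] 1(4)[of X Z Y] by (simp add: 2)
qed

lemma cinner3_xi3:
  assumes "b \<in> L3E I"
  shows "cinner3 g b (xi3 x y z) = 8 * b x y z"
proof -
  note b = L3E_D[OF assms]
  have c: "basis_sum g (\<lambda>Z. b X Y Z * cnj (\<xi> z Z)) = 2 * b X Y z"
    "basis_sum g (\<lambda>Y. b X Y Z * cnj (\<xi> y Y)) = 2 * b X y Z"
    "basis_sum g (\<lambda>X. b X Y Z * cnj (\<xi> x X)) = 2 * b x Y Z" for X Y Z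
    by (rule contract_xi; simp add: trilinear_linear[OF b(1)] b(2,5,6))+
  have "cinner3 g b (xi3 x y z) = basis_sum g (\<lambda>X. basis_sum g (\<lambda>Y.
      basis_sum g (\<lambda>Z. b X Y Z * cnj (\<xi> z Z)) * cnj (\<xi> y Y)) * cnj (\<xi> x X))"
    unfolding cinner3_def xi3_def basis_sum_onb by (simp add: sum_distrib_left sum_distrib_right mult_ac)
  also have "\<dots> = 8 * b x y z"
    by (simp add: c mult.assoc basis_sum_mult)
  finally show ?thesis .
qed

lemma cinner3_wedge3:
  assumes "b \<in> L3E I"
  shows "cinner3 g b (wedge3 x y z) = 48 * b x y z"
proof -
  have p: "b x z y = - b x y z" "b y x z = - b x y z" "b y z x = b x y z" "b z x y = b x y z" "b z y x = - b x y z"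
    using L3E_D(3)[OF assms, where X=x and Y=y and Z=z] L3E_D(4)[OF assms, where X=x and Y=y and Z=z]
      L3E_D(4)[OF assms, where X=y and Y=x and Z=z] L3E_D(3)[OF assms, where X=x and Y=z and Z=y]
      L3E_D(4)[OF assms, where X=z and Y=x and Z=y] by simp_all
  have "cinner3 g b (wedge3 x y z) = cinner3 g b (xi3 x y z) - cinner3 g b (xi3 x z y)
      - cinner3 g b (xi3 y x z) + cinner3 g b (xi3 y z x) + cinner3 g b (xi3 z x y) - cinner3 g b (xi3 z y x)"
    by (simp add: cinner3_def wedge3_def right_diff_distrib distrib_left basis_sum_add basis_sum_diff)
  also have "\<dots> = 48 * b x y z"
    unfolding cinner3_xi3[OF assms] p by simp
  finally show ?thesis .
qed

lemma omega_E_simps: "omega_E g J K (I X) Y = \<i> * omega_E g J K X Y" "omega_E g J K Y X = - omega_E g J K X Y"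
  "omega_E g J K X (I Y) = \<i> * omega_E g J K X Y"
proof -
  have s: "g Y (J X) = - g X (J Y)" "g Y (I (J X)) = - g X (I (J Y))" for X Y
    using g_sym[of Y "J X"] g_sym[of Y "I (J X)"] by (simp_all add: qsimps)
  show "omega_E g J K Y X = - omega_E g J K X Y"
    unfolding omega_E_def fundamental_form_def K_eq s[of Y X] by (simp add: complex_eq_iff)
  show "omega_E g J K (I X) Y = \<i> * omega_E g J K X Y" "omega_E g J K X (I Y) = \<i> * omega_E g J K X Y"
    by (simp_all add: omega_E_def fundamental_form_def qsimps complex_eq_iff)
qed

lemma omega_E_linear: "linear (omega_E g J K X)" "linear (\<lambda>X. omega_E g J K X Y)"
  by (auto intro!: linearI simp: omega_E_def fundamental_form_def qsimps algebra_simps scaleR_conv_of_real)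

lemma omega_E_horth: "horth X Y \<Longrightarrow> omega_E g J K X Y = 0"
  by (simp add: horth_def omega_E_def fundamental_form_def)

lemma omega_wedge_L3E:
  assumes "\<epsilon> \<in> E_module I"
  shows "omega_wedge g J K \<epsilon> \<in> L3E I"
proof -
  have \<epsilon>: "linear \<epsilon>" "\<And>X. \<epsilon> (I X) = \<i> * \<epsilon> X" using assms by (auto simp: E_module_def)
  have "trilinear (omega_wedge g J K \<epsilon>)"
    by (rule trilinearI)
      (simp_all add: omega_wedge_def linear_add[OF omega_E_linear(1)] linear_add[OF omega_E_linear(2)]
        linear_cmul[OF omega_E_linear(1)] linear_cmul[OF omega_E_linear(2)] linear_add[OF \<epsilon>(1)]
        linear_cmul[OF \<epsilon>(1)] algebra_simps)
  thus ?thesis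
    unfolding L3E_def mem_Collect_eq
  proof (intro conjI allI)
    fix X Y Z
    have s: "omega_E g J K Y X = - omega_E g J K X Y" "omega_E g J K Z Y = - omega_E g J K Y Z"
      "omega_E g J K X Z = - omega_E g J K Z X"
      by (rule omega_E_simps(2))+
    show "omega_wedge g J K \<epsilon> (I X) Y Z = \<i> * omega_wedge g J K \<epsilon> X Y Z"
      by (simp add: omega_wedge_def \<epsilon>(2) omega_E_simps(1,3) algebra_simps)
    show "omega_wedge g J K \<epsilon> Y X Z = - omega_wedge g J K \<epsilon> X Y Z"
      unfolding omega_wedge_def by (simp add: s)
    show "omega_wedge g J K \<epsilon> X Z Y = - omega_wedge g J K \<epsilon> X Y Z"
      unfolding omega_wedge_def by (simp add: s)
  qed
qed

section \<open>Decomposable forms of quaternionic orthonormal triples\<close>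

definition triples :: "('v \<times> 'v \<times> 'v) set" where
  "triples = {(x, y, z). g x x = 1 \<and> g y y = 1 \<and> g z z = 1 \<and> horth x y \<and> horth x z \<and> horth y z}"

text \<open>Up to conjugation and a factor, pairing with \<open>wedge3 x y z\<close> is evaluation
  at \<open>x, y, z\<close>, and there every summand of \<open>omega_wedge\<close> contains
  \<open>omega_E\<close> of two orthogonal lines.\<close>

lemma wedge3_L30E:
  assumes "(x, y, z) \<in> triples"
  shows "wedge3 x y z \<in> L30E g I J K"
proof -
  have h: "horth x y" "horth y z" "horth z x" using assms horth_sym by (auto simp: triples_def)
  have "cinner3 g (wedge3 x y z) (omega_wedge g J K \<epsilon>) = 0" if "\<epsilon> \<in> E_module I" for \<epsilon>
    using cinner3_wedge3[OF omega_wedge_L3E[OF that], of x y z]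
      cinner3_sym[of "wedge3 x y z" "omega_wedge g J K \<epsilon>"]
    by (simp add: omega_wedge_def omega_E_horth h)
  thus ?thesis using wedge3_L3E by (simp add: L30E_def)
qed

lemma subspace_L3E: "tensors.subspace (L3E I)"
proof (rule tensors.subspaceI)
  show "0 \<in> L3E I" by (simp add: L3E_def trilinear_0)
next
  fix a b assume a: "a \<in> L3E I" and b: "b \<in> L3E I"
  have "(a + b) (I X) Y Z = \<i> * (a + b) X Y Z" "(a + b) Y X Z = - (a + b) X Y Z"
    "(a + b) X Z Y = - (a + b) X Y Z" for X Y Z
    by (simp_all only: plus_fun_apply L3E_D(2)[OF a] L3E_D(2)[OF b] L3E_D(3)[OF a, where X=X and Y=Y and Z=Z] L3E_D(3)[OF b, where X=X and Y=Y and Z=Z]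
      L3E_D(4)[OF a, where X=X and Y=Y and Z=Z] L3E_D(4)[OF b, where X=X and Y=Y and Z=Z] distrib_left minus_add_distrib)
  thus "a + b \<in> L3E I"
    unfolding L3E_def using trilinear_plus[OF L3E_D(1)[OF a] L3E_D(1)[OF b]] by blast
next
  fix r a assume a: "a \<in> L3E I"
  have "tscale r a (I X) Y Z = \<i> * tscale r a X Y Z" "tscale r a Y X Z = - tscale r a X Y Z"
    "tscale r a X Z Y = - tscale r a X Y Z" for X Y Z
    by (simp_all only: tscale_apply L3E_D(2)[OF a] L3E_D(3)[OF a, where X=X and Y=Y and Z=Z] L3E_D(4)[OF a, where X=X and Y=Y and Z=Z]
      mult.left_commute mult_minus_right)
  thus "tscale r a \<in> L3E I"
    unfolding L3E_def using trilinear_tscale[OF L3E_D(1)[OF a]] by blast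
qed

lemma subspace_L30E: "tensors.subspace (L30E g I J K)"
proof (rule tensors.subspaceI)
  have "cinner3 g 0 b = 0" for b by (simp add: cinner3_def basis_sum_0)
  thus "0 \<in> L30E g I J K"
    using tensors.subspace_0[OF subspace_L3E] by (simp add: L30E_def)
next
  fix a b assume "a \<in> L30E g I J K" "b \<in> L30E g I J K"
  thus "a + b \<in> L30E g I J K"
    using tensors.subspace_add[OF subspace_L3E, of a b] by (simp add: L30E_def cinner3_add)
next
  fix r a assume "a \<in> L30E g I J K"
  thus "tscale r a \<in> L30E g I J K"
    using tensors.subspace_scale[OF subspace_L3E, of a r] by (simp add: L30E_def cinner3_tscale)
qed

lemma L30E_trilinear: "L30E g I J K \<subseteq> {b. trilinear b}"
  unfolding L30E_def L3E_def by blast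

lemma horth_gD:
  assumes "horth x y"
  shows "g x y = 0" "g x (I y) = 0" "g x (J y) = 0" "g x (I (J y)) = 0"
  using assms by (auto simp: horth_def K_eq)

definition quat_unit :: "'v \<Rightarrow> nat \<Rightarrow> 'v" where
  "quat_unit x a = (if a = 0 then x else if a = 1 then I x else if a = 2 then J x else K x)"

lemma quat_family_orthonormal:
  assumes e: "\<And>j. j < m \<Longrightarrow> g (e j) (e j) = 1" "\<And>j k. j < m \<Longrightarrow> k < m \<Longrightarrow> j \<noteq> k \<Longrightarrow> horth (e j) (e k)"
  defines "f \<equiv> (\<lambda>(j, a). quat_unit (e j) a)" and "P \<equiv> {..<m} \<times> {..<4::nat}"
  shows "gorthonormal (f ` P)" "inj_on f P" "card (f ` P) = 4 * m"
proof -
  have gf: "g (f p) (f q) = (if p = q then 1 else 0)" if "p \<in> P" "q \<in> P" for p q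
  proof -
    obtain j a k b where pq: "p = (j, a)" "q = (k, b)" by (cases p, cases q)
    have jk: "j < m" "k < m" and ab: "a \<in> {0,1,2,3}" "b \<in> {0,1,2,3}"
      using that by (auto simp: P_def pq)
    show ?thesis
    proof (cases "j = k")
      case True
      have "g (quat_unit (e k) a) (quat_unit (e k) b) = (if a = b then 1 else 0)"
        using ab e(1)[OF jk(2)] by (auto simp: quat_unit_def qsimps)
      thus ?thesis by (simp add: pq f_def True)
    next
      case False
      have "g (quat_unit (e j) a) (quat_unit (e k) b) = 0"
        using ab horth_gD[OF e(2)[OF jk False]] by (auto simp: quat_unit_def qsimps)
      thus ?thesis using False by (simp add: pq f_def)
    qed
  qed
  have "finite P" by (simp add: P_def)
  show inj: "inj_on f P"
  proof (rule inj_onI)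
    fix p q assume "p \<in> P" "q \<in> P" "f p = f q"
    thus "p = q" using gf[of p q] gf[of q q] by (auto split: if_splits)
  qed
  have "g (f p) (f q) = (if f p = f q then 1 else 0)" if "p \<in> P" "q \<in> P" for p q
    using gf[OF that] inj_on_eq_iff[OF inj that] by simp
  thus "gorthonormal (f ` P)" using \<open>finite P\<close> unfolding gorthonormal_def by blast
  show "card (f ` P) = 4 * m" using card_image[OF inj] by (simp add: P_def)
qed

text \<open>A unit vector orthogonal to all four real basis vectors of each line found so far is
  quaternionically orthogonal to these lines, so the real extension step suffices.\<close>

lemma quat_frame_exists:
  assumes "4 * N = DIM('v)"
  obtains e where "\<And>j. j < N \<Longrightarrow> g (e j) (e j) = 1"
    "\<And>j k. j < N \<Longrightarrow> k < N \<Longrightarrow> j \<noteq> k \<Longrightarrow> horth (e j) (e k)"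
proof -
  have "\<exists>e. (\<forall>j<m. g (e j) (e j) = 1) \<and> (\<forall>j<m. \<forall>k<m. j \<noteq> k \<longrightarrow> horth (e j) (e k))" if "m \<le> N" for m
    using that
  proof (induction m)
    case 0
    show ?case by simp
  next
    case (Suc m)
    then obtain e where e: "\<And>j. j < m \<Longrightarrow> g (e j) (e j) = 1"
      "\<And>j k. j < m \<Longrightarrow> k < m \<Longrightarrow> j \<noteq> k \<Longrightarrow> horth (e j) (e k)" by auto
    let ?B = "(\<lambda>(j, a). quat_unit (e j) a) ` ({..<m} \<times> {..<4::nat})"
    have "card ?B < DIM('v)"
      using quat_family_orthonormal(3)[of m e, OF e] Suc.prems assms by simp
    then obtain x where x: "g x x = 1" "\<And>b. b \<in> ?B \<Longrightarrow> g x b = 0"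
      using gorthonormal_extend[OF quat_family_orthonormal(1)[of m e, OF e]] by blast
    have "horth x (e j)" if "j < m" for j
    proof -
      have "g x (quat_unit (e j) a) = 0" if "a < 4" for a
        using x(2) \<open>j < m\<close> that by (auto simp: image_iff)
      from this[of 0] this[of 1] this[of 2] this[of 3] show ?thesis
        by (simp add: quat_unit_def horth_def)
    qed
    hence "(\<forall>j<Suc m. g ((e(m := x)) j) ((e(m := x)) j) = 1)
        \<and> (\<forall>j<Suc m. \<forall>k<Suc m. j \<noteq> k \<longrightarrow> horth ((e(m := x)) j) ((e(m := x)) k))"
      using e x(1) horth_sym by (auto simp: less_Suc_eq)
    thus ?case by blast
  qed
  from this[of N] that show thesis by blast
qed

lemma basis_sum_rotate:
  "basis_sum g (\<lambda>X. basis_sum g (\<lambda>Y. basis_sum g (\<lambda>Z. F Y Z X)))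
    = basis_sum g (\<lambda>X. basis_sum g (\<lambda>Y. basis_sum g (\<lambda>Z. F X Y Z)))"
  by (subst basis_sum_swap) (subst basis_sum_swap, rule refl)

text \<open>The trace \<open>t\<close> is itself an element of E, so \<open>b\<close> is orthogonal
  to \<open>omega_wedge g J K t\<close>. The three cyclic summands contribute equally, and each one
  is twice the squared norm of \<open>t\<close>.\<close>

lemma L30E_trace:
  assumes "b \<in> L30E g I J K"
  shows "basis_sum g (\<lambda>Y. b (J Y) Y Z) = 0"
proof -
  have L: "b \<in> L3E I" using assms by (simp add: L30E_def)
  note b = L3E_D[OF L]
  define t where "t Z = basis_sum g (\<lambda>Y. b (J Y) Y Z)" for Z
  have lt: "linear t"
    unfolding t_def by (intro linear_on_basis_sum trilinear_linear(3)[OF b(1)])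
  have "t \<in> E_module I"
    using lt by (simp add: E_module_def t_def b(6) basis_sum_mult)
  hence 0: "cinner3 g b (omega_wedge g J K t) = 0" using assms by (simp add: L30E_def)
  define F where "F X Y Z = b X Y Z * cnj (omega_E g J K X Y) * cnj (t Z)" for X Y Z
  have cyc: "b Y Z X = b X Y Z" for X Y Z
    using b(4)[where X=Y and Y=X and Z=Z] b(3)[where X=X and Y=Y and Z=Z] by simp
  have "b X Y Z * cnj (omega_wedge g J K t X Y Z) = F X Y Z + F Y Z X + F Z X Y" for X Y Z
    by (simp add: F_def omega_wedge_def algebra_simps cyc[of X Y Z] cyc[of Z X Y, symmetric])
  hence "cinner3 g b (omega_wedge g J K t) = basis_sum g (\<lambda>X. basis_sum g (\<lambda>Y. basis_sum g (\<lambda>Z. F X Y Z)))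
      + basis_sum g (\<lambda>X. basis_sum g (\<lambda>Y. basis_sum g (\<lambda>Z. F Y Z X)))
      + basis_sum g (\<lambda>X. basis_sum g (\<lambda>Y. basis_sum g (\<lambda>Z. F Z X Y)))"
    by (simp add: cinner3_def basis_sum_add)
  also have "\<dots> = 3 * basis_sum g (\<lambda>X. basis_sum g (\<lambda>Y. basis_sum g (\<lambda>Z. F Y Z X)))"
    using basis_sum_rotate[of F] basis_sum_rotate[of "\<lambda>X Y Z. F Z X Y"] by simp
  also have "basis_sum g (\<lambda>X. basis_sum g (\<lambda>Y. basis_sum g (\<lambda>Z. F Y Z X)))
      = basis_sum g (\<lambda>Z. basis_sum g (\<lambda>Y. basis_sum g (\<lambda>X. F X Y Z)))"
    by (subst basis_sum_swap[of "\<lambda>Y Z. F Y Z _"]) (rule refl)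
  also have "\<dots> = basis_sum g (\<lambda>Z. 2 * t Z * cnj (t Z))"
  proof -
    \<comment> \<open>The two parts of \<open>omega_E\<close> give \<open>b (J Y) Y Z\<close> and
      \<open>- \<i> * b (K Y) Y Z\<close>, which agree because \<open>b\<close> is complex linear
      and \<open>K\<close> is \<open>I\<close> after \<open>J\<close>.\<close>
    have "basis_sum g (\<lambda>X. b X Y Z * cnj (omega_E g J K X Y)) = 2 * b (J Y) Y Z" for Y Z
    proof -
      have "basis_sum g (\<lambda>X. b X Y Z * cnj (omega_E g J K X Y))
          = basis_sum g (\<lambda>X. g (J Y) X *\<^sub>R b X Y Z - \<i> * (g (K Y) X *\<^sub>R b X Y Z))"
        unfolding basis_sum_onb omega_E_def fundamental_form_def
        by (intro sum.cong refl) (simp add: g_sym[of _ "J Y"] g_sym[of _ "K Y"] scaleR_conv_of_real algebra_simps)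
      also have "\<dots> = b (J Y) Y Z - \<i> * b (K Y) Y Z"
        by (simp only: basis_sum_diff basis_sum_mult basis_sum_g_contract[OF trilinear_linear(1)[OF b(1)]])
      also have "\<dots> = 2 * b (J Y) Y Z" by (simp add: K_eq b(2) mult.assoc[symmetric])
      finally show ?thesis .
    qed
    thus ?thesis by (simp add: F_def basis_sum_mult t_def)
  qed
  finally have "basis_sum g (\<lambda>Z. t Z * cnj (t Z)) = 0" using 0 by (simp add: basis_sum_mult mult.assoc)
  hence "of_real (\<Sum>Z\<in>onb. (cmod (t Z))\<^sup>2) = (0::complex)"
    by (simp add: basis_sum_onb complex_norm_square[symmetric] del: of_real_power)
  hence "(\<Sum>Z\<in>onb. (cmod (t Z))\<^sup>2) = 0" by (simp only: of_real_eq_0_iff)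
  hence "t Z = 0" if "Z \<in> onb" for Z
    using that by (simp add: sum_nonneg_eq_0_iff finite_onb)
  moreover have "Z \<in> span onb" using onb by (simp add: orthonormal_basis_def)
  ultimately have "t Z = 0" using linear_eq_0_on_span[OF lt] by blast
  thus ?thesis by (simp add: t_def)
qed

text \<open>By complex linearity only the vectors \<open>e j\<close> and \<open>J (e j)\<close> of a
  frame matter. Three different lines form a triple. Three arguments in one line give zero, since
  the line has complex dimension 2. For one argument \<open>z\<close> in one line and two in
  another, the values \<open>b z (e j) (J (e j))\<close> agree for all lines other than that of
  \<open>z\<close>, and their sum is the vanishing trace.\<close>

lemma L30E_eq_0:
  assumes dim: "DIM('v) = 4 * N" "N \<ge> 2" and b: "b \<in> L30E g I J K"
    and 0: "\<And>x y z. (x, y, z) \<in> triples \<Longrightarrow> b x y z = 0"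
  shows "b = 0"
proof -
  have L: "b \<in> L3E I" using b by (simp add: L30E_def)
  note b3 = L3E_D[OF L]
  note t = trilinear_simps[OF b3(1)]
  obtain e where e: "\<And>j. j < N \<Longrightarrow> g (e j) (e j) = 1"
    "\<And>j k. j < N \<Longrightarrow> k < N \<Longrightarrow> j \<noteq> k \<Longrightarrow> horth (e j) (e k)"
    using quat_frame_exists[of N] dim by metis
  have diag: "b X X Z = 0" "b Z X X = 0" "b X Z X = 0" for X Z
    using b3(3)[where X=X and Y=X and Z=Z] b3(4)[where X=Z and Y=X and Z=X]
      b3(3)[where X=X and Y=Z and Z=X] by auto
  text \<open>Comparing the planes \<open>e j, J (e j)\<close> and \<open>e k, J (e k)\<close> by means of the triple
    \<open>z, e j + e k, J (e j - e k)\<close>.\<close>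
  have eq: "b z (e j) (J (e j)) = b z (e k) (J (e k))"
    if "j < N" "k < N" "j \<noteq> k" "g z z = 1" "horth z (e j)" "horth z (e k)" for z j k
  proof -
    let ?s = "1 / sqrt 2"
    note h = horth_gD[OF e(2)[OF that(1,2,3)]] horth_gD[OF e(2)[OF that(2,1) that(3)[symmetric]]]
      e(1)[OF that(1)] e(1)[OF that(2)]
    have "(z, ?s *\<^sub>R (e j + e k), ?s *\<^sub>R J (e j - e k)) \<in> triples"
      using that(4-6) h unfolding triples_def
      by (auto simp: horth_add horth_mult qsimps) (simp_all add: horth_def qsimps)
    moreover have "(z, e j, J (e k)) \<in> triples" "(z, e k, J (e j)) \<in> triples"
      using that e by (auto simp: triples_def g_IJK horth_mult)
    ultimately have "b z (e j + e k) (J (e j - e k)) = 0" "b z (e j) (J (e k)) = 0" "b z (e k) (J (e j)) = 0"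
      using 0 by (force simp: t)+
    thus ?thesis by (simp add: t IJK_simps)
  qed
  have tr: "(\<Sum>j<N. b z (e j) (J (e j))) = 0" for z
  proof -
    let ?f = "\<lambda>(j, a). quat_unit (e j) a" and ?P = "{..<N} \<times> {..<4::nat}"
    note f = quat_family_orthonormal[of N e, OF e]
    have B: "orthonormal_basis g (?f ` ?P)" using gorthonormal_span[OF f(1)] f(3) dim by simp
    have bl: "bilinear (\<lambda>X Y. b (J X) Y z)"
      unfolding bilinear_def by (auto intro!: linearI simp: t IJK_simps)
    have "0 = (\<Sum>Y\<in>?f ` ?P. b (J Y) Y z)"
      using sum_onb_eq[OF B bl] L30E_trace[OF b, of z] by simp
    also have "\<dots> = (\<Sum>p\<in>?P. b (J (?f p)) (?f p) z)"
      by (rule sum.reindex_cong[OF f(2) refl refl])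
    also have "\<dots> = (\<Sum>j<N. \<Sum>a<4. b (J (quat_unit (e j) a)) (quat_unit (e j) a) z)"
      by (simp add: sum.cartesian_product')
    \<comment> \<open>All four basis vectors of a quaternionic line contribute the same
      value.\<close>
    also have "\<dots> = (\<Sum>j<N. - 4 * b z (e j) (J (e j)))"
    proof (rule sum.cong[OF refl])
      fix j
      have c: "b (J (e j)) (e j) z = - b z (e j) (J (e j))" "b (e j) (J (e j)) z = b z (e j) (J (e j))"
        using b3(4)[where X="J (e j)" and Y=z and Z="e j"] b3(3)[where X=z and Y="J (e j)" and Z="e j"]
          b3(4)[where X=z and Y="e j" and Z="J (e j)"]  b3(3)[where X="J (e j)" and Y="e j" and Z=z] by simp_all
      show "(\<Sum>a<4. b (J (quat_unit (e j) a)) (quat_unit (e j) a) z) = - 4 * b z (e j) (J (e j))"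
        by (simp add: eval_nat_numeral quat_unit_def K_eq IJK_simps t b3(2,5) c mult.assoc[symmetric])
    qed
    finally have "0 = - 4 * (\<Sum>j<N. b z (e j) (J (e j)))" unfolding sum_distrib_left .
    thus ?thesis by simp
  qed
  have h0: "b z (e j) (J (e j)) = 0" if "i < N" "j < N" "i \<noteq> j" "z \<in> {e i, J (e i)}" for i j z
  proof -
    have z: "g z z = 1" "horth z (e k)" if "k < N" "k \<noteq> i" for k
      using \<open>z \<in> _\<close> that e[of i] \<open>i < N\<close> e(2)[of i k] by (auto simp: g_IJK horth_mult)
    have zi: "b z (e i) (J (e i)) = 0" using that(4) diag by auto
    have "(\<Sum>k<N. b z (e k) (J (e k))) = (\<Sum>k\<in>{..<N} - {i}. b z (e k) (J (e k)))"
      using zi \<open>i < N\<close> by (simp add: sum.remove[of _ i])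
    also have "\<dots> = (\<Sum>k\<in>{..<N} - {i}. b z (e j) (J (e j)))"
    proof (rule sum.cong[OF refl])
      fix k assume "k \<in> {..<N} - {i}"
      thus "b z (e k) (J (e k)) = b z (e j) (J (e j))"
        using eq[of k j z] z that by (cases "k = j") auto
    qed
    also have "\<dots> = of_nat (N - 1) * b z (e j) (J (e j))" using \<open>i < N\<close> by simp
    finally show ?thesis using tr[of z] dim(2) by simp
  qed
  have D0: "b x y z = 0"
    if "i < N" "j < N" "k < N" and x: "x \<in> {e i, J (e i)}" and y: "y \<in> {e j, J (e j)}" and z: "z \<in> {e k, J (e k)}"
    for i j k x y z
  proof -
    have pair: "b x y z = 0" if "i < N" "j < N" "i \<noteq> j" "x \<in> {e i, J (e i)}" "y \<in> {e j, J (e j)}" "z \<in> {e j, J (e j)}" for i j x y z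
      using that h0[OF that(1-4)] b3(4)[where X=x and Y="e j" and Z="J (e j)"] diag by auto
    consider "i = j" "j = k" | "j = k" "i \<noteq> j" | "i = j" "j \<noteq> k" | "i = k" "j \<noteq> k" | "i \<noteq> j" "i \<noteq> k" "j \<noteq> k" by blast
    thus ?thesis
    proof cases
      case 1 thus ?thesis using x y z diag by auto
    next
      case 2 thus ?thesis using pair[of i j x y z] that by auto
    next
      case 3 thus ?thesis using pair[of k j z x y] that
          b3(4)[where X=x and Y=z and Z=y] b3(3)[where X=x and Y=z and Z=y] by auto
    next
      case 4 thus ?thesis using pair[of j i y x z] that b3(3)[where X=x and Y=y and Z=z] by auto
    next
      case 5
      have "(x, y, z) \<in> triples"
        using x y z e that(1-3) 5 by (auto simp: triples_def g_IJK horth_mult)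
      thus ?thesis by (rule 0)
    qed
  qed
  note f = quat_family_orthonormal[of N e, OF e]
  have B: "orthonormal_basis g ((\<lambda>(j, a). quat_unit (e j) a) ` ({..<N} \<times> {..<4::nat}))"
    using gorthonormal_span[OF f(1)] f(3) dim by simp
  show ?thesis
  proof (rule trilinear_eq_on_span[OF b3(1)])
    show "span ((\<lambda>(j, a). quat_unit (e j) a) ` ({..<N} \<times> {..<4::nat})) = UNIV"
      using B by (simp add: orthonormal_basis_def)
    have I: "\<exists>j<N. \<exists>d\<in>{e j, J (e j)}. x = d \<or> x = I d"
      if "x \<in> (\<lambda>(j, a). quat_unit (e j) a) ` ({..<N} \<times> {..<4::nat})" for x
      using that by (auto simp: quat_unit_def K_eq split: if_splits)
    fix x y z
    assume "x \<in> (\<lambda>(j, a). quat_unit (e j) a) ` ({..<N} \<times> {..<4::nat})"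
      "y \<in> (\<lambda>(j, a). quat_unit (e j) a) ` ({..<N} \<times> {..<4::nat})"
      "z \<in> (\<lambda>(j, a). quat_unit (e j) a) ` ({..<N} \<times> {..<4::nat})"
    from this[THEN I] obtain i j k x' y' z' where
      *: "i < N" "j < N" "k < N" "x' \<in> {e i, J (e i)}" "y' \<in> {e j, J (e j)}" "z' \<in> {e k, J (e k)}"
      and "x = x' \<or> x = I x'" "y = y' \<or> y = I y'" "z = z' \<or> z = I z'" by blast
    thus "b x y z = 0" using D0[OF *] b3(2,5,6) by auto
  qed
qed

text \<open>An element orthogonal to the span vanishes on all triples by
  \<open>cinner3_wedge3\<close>. For n = 2 there are no triples and both sides are zero.\<close>

lemma L30E_span:
  assumes dim: "DIM('v) = 4 * N" "N \<ge> 2"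
  shows "L30E g I J K = tensors.span ((\<lambda>(x, y, z). wedge3 x y z) ` triples)" (is "_ = tensors.span ?V")
proof
  have V: "?V \<subseteq> L30E g I J K" using wedge3_L30E by auto
  show sub: "tensors.span ?V \<subseteq> L30E g I J K"
    by (rule tensors.span_minimal[OF V subspace_L30E])
  show "L30E g I J K \<subseteq> tensors.span ?V"
  proof
    fix c assume c: "c \<in> L30E g I J K"
    obtain u where u: "u \<in> tensors.span ?V" "\<forall>t\<in>tensors.span ?V. cinner3 g (c - u) t = 0"
      using ctensor_projection[OF tensors.subspace_span order_trans[OF sub L30E_trilinear]] by blast
    have m: "c - u \<in> L30E g I J K"
      using c u(1) sub by (intro tensors.subspace_diff[OF subspace_L30E]) auto
    have "(c - u) x y z = 0" if "(x, y, z) \<in> triples" for x y z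
    proof -
      have "wedge3 x y z \<in> tensors.span ?V" using that by (intro tensors.span_base) force
      hence "cinner3 g (c - u) (wedge3 x y z) = 0" using u(2) by blast
      moreover have "c - u \<in> L3E I" using m by (simp add: L30E_def)
      ultimately show ?thesis using cinner3_wedge3[of "c - u"] by simp
    qed
    hence "c - u = 0" by (rule L30E_eq_0[OF dim m])
    thus "c \<in> tensors.span ?V" using u(1) by simp
  qed
qed

text \<open>By \<open>rot_rot\<close> the square of \<open>rot u\<close> is the quaternionic
  reflection in \<open>u\<close>, and the reflection in the direction \<open>x - y\<close>
  transposes the orthonormal vectors \<open>x\<close> and \<open>y\<close>. Thus transpositions of
  lines come from rotations.\<close>

lemma rot_rot_swap:
  assumes "g x x = 1" "g y y = 1" "horth x y"
  defines "u \<equiv> (1 / sqrt 2) *\<^sub>R (x - y)"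
  shows "g u u = 1" "rot u (rot u x) = y" "rot u (rot u y) = x"
    "horth x z \<Longrightarrow> horth y z \<Longrightarrow> rot u (rot u z) = z"
proof -
  have yx: "horth y x" using assms(3) horth_sym by blast
  note h = horth_gD[OF assms(3)] horth_gD[OF yx]
  show u: "g u u = 1" using h assms(1,2) by (simp add: u_def qsimps)
  have p: "proj u x = (1 / 2) *\<^sub>R (x - y)" "proj u y = - (1 / 2) *\<^sub>R (x - y)"
    using h assms(1,2) by (simp_all add: qmap_def u_def qsimps)
  show "rot u (rot u x) = y" by (simp only: rot_rot[OF u] p) simp
  show "rot u (rot u y) = x" by (simp only: rot_rot[OF u] p) simp
  show "rot u (rot u z) = z" if "horth x z" "horth y z"
  proof -
    have "horth z u" unfolding u_def using that horth_sym by (simp add: horth_add horth_mult)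
    thus ?thesis by (simp add: rot_horth)
  qed
qed

text \<open>The symmetries of \<open>wedge3 (w 0) (w 1) (w 2)\<close>, inherited by its image under an
  equivariant map.\<close>

definition wedge_symmetric :: "(nat \<Rightarrow> 'v) \<Rightarrow> 'v ctensor3 \<Rightarrow> bool" where
  "wedge_symmetric w c \<longleftrightarrow> (\<forall>i<3. g (w i) (w i) = 1) \<and> (\<forall>i<3. \<forall>j<3. i \<noteq> j \<longrightarrow> horth (w i) (w j)) \<and>
     (\<forall>i<3. act (rot (w i)) c = tscale (- \<i>) c) \<and>
     (\<forall>i<3. \<forall>j<3. i \<noteq> j \<longrightarrow> (let u = (1 / sqrt 2) *\<^sub>R (w i - w j) in
        act (rot u) (act (rot u) c) = tscale (- 1) c))"

lemma less_3_cases: "(i::nat) < 3 \<longleftrightarrow> i = 0 \<or> i = Suc 0 \<or> i = 2"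
  by auto

lemma wedge3_symmetric:
  assumes w: "\<forall>i<3. g (w i) (w i) = 1" "\<forall>i<3. \<forall>j<3. i \<noteq> j \<longrightarrow> horth (w i) (w j)"
  shows "wedge_symmetric w (wedge3 (w 0) (w 1) (w 2))"
proof -
  have u: "g (w i) (w i) = 1" if "i < 3" for i using w that by blast
  have h: "horth (w i) (w j)" if "i < 3" "j < 3" "i \<noteq> j" for i j using w that by blast
  have fx: "rot (w i) (w j) = w j" if "i < 3" "j < 3" "i \<noteq> j" for i j
    using h[of j i] that by (auto intro: rot_horth)
  have "act (rot (w i)) (wedge3 (w 0) (w 1) (w 2)) = tscale (- \<i>) (wedge3 (w 0) (w 1) (w 2))" if "i < 3" for i
    unfolding act_wedge3[OF rot_Sp[OF u[OF that]]]
    using that by (auto simp: less_3_cases fx rot_u[OF u] wedge3_I)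
  moreover have "act (rot u) (act (rot u) (wedge3 (w 0) (w 1) (w 2))) = tscale (- 1) (wedge3 (w 0) (w 1) (w 2))"
    if "i < 3" "j < 3" "i \<noteq> j" and ud: "u = (1 / sqrt 2) *\<^sub>R (w i - w j)" for i j u
  proof -
    note r = rot_rot_swap[OF u[OF that(1)] u[OF that(2)] h[OF that(1-3)], folded ud]
    have r3: "rot u (rot u (w k)) = w k" if "k < 3" "k \<noteq> i" "k \<noteq> j" for k
      using that \<open>i < 3\<close> \<open>j < 3\<close> by (intro r(4) h) auto
    have s: "wedge3 (w 1) (w 0) (w 2) = tscale (- 1) (wedge3 (w 0) (w 1) (w 2))"
      "wedge3 (w 0) (w 2) (w 1) = tscale (- 1) (wedge3 (w 0) (w 1) (w 2))"
      "wedge3 (w 2) (w 1) (w 0) = tscale (- 1) (wedge3 (w 0) (w 1) (w 2))"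
      by (simp_all add: wedge3_def fun_eq_iff)
    show ?thesis
      unfolding act_wedge3[OF rot_Sp[OF r(1)]]
      using that(1-3) r(2,3) r3 s unfolding less_3_cases by (elim disjE) simp_all
  qed
  ultimately show ?thesis unfolding wedge_symmetric_def Let_def using w by blast
qed

lemma wedge_symmetric_hom:
  assumes "sp_hom (L30E g I J K) f" and w: "\<forall>i<3. g (w i) (w i) = 1" "\<forall>i<3. \<forall>j<3. i \<noteq> j \<longrightarrow> horth (w i) (w j)"
  shows "wedge_symmetric w (f (wedge3 (w 0) (w 1) (w 2)))"
proof -
  let ?v = "wedge3 (w 0) (w 1) (w 2)"
  have "(w 0, w 1, w 2) \<in> triples" using w by (auto simp: triples_def)
  hence v: "?v \<in> L30E g I J K" by (rule wedge3_L30E)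
  note S = wedge3_symmetric[OF w]
  \<comment> \<open>The second of two successive rotations acts on a rotated form, to which
    equivariance of \<open>f\<close> applies only inside the module.\<close>
  have a: "act a ?v \<in> L30E g I J K" if "a \<in> Sp g I J K" for a
  proof -
    have "(a (w 0), a (w 1), a (w 2)) \<in> triples"
      using w by (auto simp: triples_def horth_def Sp_D(2)[OF that] simp flip: Sp_D(3,4,5)[OF that])
    thus ?thesis unfolding act_wedge3[OF that] by (rule wedge3_L30E)
  qed
  have "act (rot (w i)) (f ?v) = tscale (- \<i>) (f ?v)" if "i < 3" for i
  proof -
    have "act (rot (w i)) ?v = tscale (- \<i>) ?v" "rot (w i) \<in> Sp g I J K"
      using S that rot_Sp by (auto simp: wedge_symmetric_def)
    thus ?thesis using sp_homD(3)[OF assms(1) _ v, of "rot (w i)"] sp_homD(2)[OF assms(1) v, of "- \<i>"]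
      by simp
  qed
  moreover have "act (rot u) (act (rot u) (f ?v)) = tscale (- 1) (f ?v)"
    if "i < 3" "j < 3" "i \<noteq> j" "u = (1 / sqrt 2) *\<^sub>R (w i - w j)" for i j u
  proof -
    have u: "rot u \<in> Sp g I J K"
      using rot_rot_swap(1)[of "w i" "w j"] w that by (intro rot_Sp) simp
    have "act (rot u) (act (rot u) ?v) = tscale (- 1) ?v"
      using S that unfolding wedge_symmetric_def Let_def by blast
    thus ?thesis
      using sp_homD(3)[OF assms(1) u v] sp_homD(3)[OF assms(1) u a[OF u]] sp_homD(2)[OF assms(1) v, of "- 1"]
      by simp
  qed
  ultimately show ?thesis unfolding wedge_symmetric_def Let_def using w by blast
qed

lemma i_cancel:
  assumes "z = - \<i> * z"
  shows "z = 0"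
proof -
  have "Re z = Im z" using arg_cong[OF assms, of Re] by simp
  moreover have "Im z = - Re z" using arg_cong[OF assms, of Im] by simp
  ultimately have "Re z = 0" "Im z = 0" by linarith+
  thus ?thesis by (simp add: complex_eq_iff)
qed

text \<open>A vector orthogonal to the line of some \<open>w i\<close> is fixed by
  \<open>rot (w i)\<close>, so \<open>\<beta>\<close> vanishes on it. Every vector is a sum of one
  orthogonal to \<open>w 0\<close> and one in the line of \<open>w 0\<close>, which is orthogonal to
  \<open>w 1\<close>.\<close>

lemma V1_wedge_symmetric_zero:
  assumes "b \<in> V1" "wedge_symmetric w b"
  shows "b = 0"
proof -
  obtain \<beta> where \<beta>: "linear \<beta>" and b: "b = (\<lambda>X Y Z. g Y Z *\<^sub>R \<beta> X)"
    using assms(1) by (auto simp: V1_def)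
  have z: "\<beta> X = 0" if "i < 3" "horth X (w i)" for i X
  proof -
    have u: "g (w i) (w i) = 1" and a: "act (rot (w i)) b = tscale (- \<i>) b"
      using assms(2) that by (auto simp: wedge_symmetric_def)
    have "\<beta> X = - \<i> * \<beta> X"
      using act_eigen[OF rot_Sp[OF u] a, of X "w i" "w i"]
      by (simp add: b rot_isometry[OF u] u rot_horth[OF that(2)])
    thus ?thesis by (rule i_cancel)
  qed
  have w: "g (w 0) (w 0) = 1" "horth (w 0) (w 1)" using assms(2) by (auto simp: wedge_symmetric_def)
  have "\<beta> X = 0" for X
  proof -
    have "\<beta> (X - proj (w 0) X) = 0" using proj_orth[OF w(1)] by (intro z[of 0]) simp_all
    moreover have "\<beta> (proj (w 0) X) = 0"
      unfolding qmap_def using w(2) by (intro z[of 1]) (simp_all add: horth_add horth_mult)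
    ultimately show ?thesis by (simp add: linear_diff[OF \<beta>])
  qed
  thus ?thesis by (simp add: b fun_eq_iff)
qed

text \<open>The space splits into the lines of \<open>w 0, w 1, w 2\<close> and a remainder. If one
  of the three lines contains no argument, its rotation fixes all arguments and forces the value to
  vanish. Otherwise each line contains exactly one argument, and by \<open>bI\<close> the values on
  \<open>w\<close> and \<open>J \<circ> w\<close> decide; they are treated in
  \<open>core\<close>.\<close>

lemma Vcyc_wedge_symmetric_zero:
  assumes "b \<in> Vcyc" "wedge_symmetric w b"
  shows "b = 0"
proof -
  have b: "trilinear b" and s23: "\<And>X Y Z. b X Z Y = - b X Y Z"
    and bI: "\<And>X Y Z. b X (I Y) Z = b (I X) Y Z" and cyc: "\<And>X Y Z. b X Y Z + b Y Z X + b Z X Y = 0"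
    using assms(1) unfolding Vcyc_def mem_Collect_eq by metis+
  have bI': "b X Y (I Z) = b (I X) Y Z" for X Y Z
    using s23[of X "I Z" Y] s23[of "I X" Z Y] bI[of X Z Y] by simp
  note t = trilinear_simps[OF b]
  have u: "g (w i) (w i) = 1" if "i < 3" for i using assms(2) that by (auto simp: wedge_symmetric_def)
  have h: "horth (w i) (w j)" if "i < 3" "j < 3" "i \<noteq> j" for i j
    using assms(2) that by (auto simp: wedge_symmetric_def)
  have e: "b X Y Z = - \<i> * b (rot (w i) X) (rot (w i) Y) (rot (w i) Z)" if "i < 3" for i X Y Z
    using assms(2) that by (intro act_eigen rot_Sp u) (auto simp: wedge_symmetric_def)
  have swap: "b X Y Z = - b (rot u (rot u X)) (rot u (rot u Y)) (rot u (rot u Z))"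
    if "i < 3" "j < 3" "i \<noteq> j" "u = (1 / sqrt 2) *\<^sub>R (w i - w j)" for i j u X Y Z
  proof -
    have r: "rot u \<in> Sp g I J K"
      using rot_rot_swap(1)[OF u[OF that(1)] u[OF that(2)] h[OF that(1-3)]] that(4) by (intro rot_Sp) simp
    have "act (rot u) (act (rot u) b) = tscale (- 1) b"
      using assms(2) that unfolding wedge_symmetric_def Let_def by blast
    hence "act (rot u) (act (rot u) b) (rot u (rot u X)) (rot u (rot u Y)) (rot u (rot u Z))
        = tscale (- 1) b (rot u (rot u X)) (rot u (rot u Y)) (rot u (rot u Z))" by simp
    thus ?thesis by (simp add: act_def Sp_D(7)[OF r])
  qed
  have fixd: "rot (w i) (w j) = w j" if "i < 3" "j < 3" "i \<noteq> j" for i j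
    using h[of j i] that by (intro rot_horth) auto
  have core: "b (a i) (a' j) (a'' k) = 0"
    if ijk: "i < 3" "j < 3" "k < 3" "i \<noteq> j" "i \<noteq> k" "j \<noteq> k"
      and a: "a \<in> {w, J \<circ> w}" "a' \<in> {w, J \<circ> w}" "a'' \<in> {w, J \<circ> w}" for i j k a a' a''
  proof -
    \<comment> \<open>The sign with which \<open>rot (w i)\<close> multiplies by \<open>I\<close>:
      plus on \<open>w i\<close>, minus on \<open>J (w i)\<close>, as in
      \<open>rot_block\<close>.\<close>
    define \<sigma> where "\<sigma> a = (if a = w then 1 else - 1 :: real)" for a
    have JI: "J \<circ> w \<noteq> w"
      using g_self(2)[of "w 0"] u[of 0] by (metis comp_apply zero_less_numeral zero_neq_one)
    have r: "rot (w i) (a i) = \<sigma> a *\<^sub>R I (a i)" if "a \<in> {w, J \<circ> w}" "i < 3" for a i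
      using that JI by (auto simp: \<sigma>_def rot_u[OF u] rot_block[OF u])
    have f: "rot (w i) (a j) = a j" if "a \<in> {w, J \<circ> w}" "i < 3" "j < 3" "i \<noteq> j" for a i j
      using that by (auto simp: fixd rot_commute)
    have 1: "b (a i) (a' j) (a'' k) = - \<i> * of_real (\<sigma> c) * b (I (a i)) (a' j) (a'' k)" if "c \<in> {a, a', a''}" for c
      using that e[OF ijk(1), of "a i" "a' j" "a'' k"] e[OF ijk(2), of "a i" "a' j" "a'' k"]
        e[OF ijk(3), of "a i" "a' j" "a'' k"] ijk a
      by (auto simp: r f t bI bI' scaleR_conv_of_real)
    show ?thesis
    proof (cases "a = a' \<and> a' = a''")
      \<comment> \<open>If both signs occur among the arguments, the rotations of the corresponding
        lines give the value as both \<open>- \<i>\<close> and \<open>\<i>\<close> times the same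
        number.\<close>
      case False
      hence m: "w \<in> {a, a', a''}" "J \<circ> w \<in> {a, a', a''}" using a by blast+
      have "\<sigma> w = 1" "\<sigma> (J \<circ> w) = - 1" using JI by (simp_all add: \<sigma>_def)
      hence "b (a i) (a' j) (a'' k) = - \<i> * b (I (a i)) (a' j) (a'' k)"
        "b (a i) (a' j) (a'' k) = \<i> * b (I (a i)) (a' j) (a'' k)"
        using 1[OF m(1)] 1[OF m(2)] by simp_all
      thus ?thesis by simp
    next
      \<comment> \<open>Exchanging the line of the first argument with another one changes the sign,
        and so does exchanging the last two arguments. So the value is invariant under cyclic
        permutations, and the vanishing cyclic sum is three times it.\<close>
      case True
      have s: "b (a i) (a j) (a k) = - b (a j) (a i) (a k)"
      proof -
        define u' where "u' = (1 / sqrt 2) *\<^sub>R (w i - w j)"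
        note r = rot_rot_swap[OF u[OF ijk(1)] u[OF ijk(2)] h[OF ijk(1,2,4)], folded u'_def]
        have "rot u' (rot u' (w k)) = w k" using ijk by (intro r(4) h) auto
        with r(2,3) a have "rot u' (rot u' (a i)) = a j" "rot u' (rot u' (a j)) = a i" "rot u' (rot u' (a k)) = a k"
          by (auto simp: rot_commute)
        thus ?thesis using swap[OF ijk(1,2,4) u'_def, of "a i" "a j" "a k"] by simp
      qed
      have s': "b (a i) (a j) (a k) = - b (a k) (a j) (a i)"
      proof -
        define u' where "u' = (1 / sqrt 2) *\<^sub>R (w i - w k)"
        note r = rot_rot_swap[OF u[OF ijk(1)] u[OF ijk(3)] h[OF ijk(1,3,5)], folded u'_def]
        have "rot u' (rot u' (w j)) = w j" using ijk by (intro r(4) h) auto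
        with r(2,3) a have "rot u' (rot u' (a i)) = a k" "rot u' (rot u' (a k)) = a i" "rot u' (rot u' (a j)) = a j"
          by (auto simp: rot_commute)
        thus ?thesis using swap[OF ijk(1,3,5) u'_def, of "a i" "a j" "a k"] by simp
      qed
      have "b (a j) (a k) (a i) = b (a i) (a j) (a k)" using s s23[of "a j" "a i" "a k"] by simp
      moreover have "b (a k) (a i) (a j) = b (a i) (a j) (a k)" using s' s23[of "a k" "a i" "a j"] by simp
      ultimately have "3 * b (a i) (a j) (a k) = 0" using cyc[of "a i" "a j" "a k"] by simp
      thus ?thesis using True by simp
    qed
  qed
  have block: "b (proj (w i) X) (proj (w j) Y) (proj (w k) Z) = 0"
    if ijk: "i < 3" "j < 3" "k < 3" "i \<noteq> j" "i \<noteq> k" "j \<noteq> k" for i j k X Y Z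
  proof -
    have IA: "b (I (a i)) (a' j) (a'' k) = 0"
      if "a \<in> {w, J \<circ> w}" "a' \<in> {w, J \<circ> w}" "a'' \<in> {w, J \<circ> w}" for a a' a''
    proof -
      have "b (rot (w i) (a i)) (a' j) (a'' k) = 0"
        using e[OF ijk(1), of "a i" "a' j" "a'' k"] core[OF ijk that] that ijk
        by (auto simp: fixd rot_commute)
      thus ?thesis using that(1) ijk by (auto simp: rot_u[OF u] rot_block[OF u] t)
    qed
    have c: "b (w i) (w j) (w k) = 0" "b (w i) (w j) (J (w k)) = 0" "b (w i) (J (w j)) (w k) = 0"
      "b (w i) (J (w j)) (J (w k)) = 0" "b (J (w i)) (w j) (w k) = 0" "b (J (w i)) (w j) (J (w k)) = 0"
      "b (J (w i)) (J (w j)) (w k) = 0" "b (J (w i)) (J (w j)) (J (w k)) = 0"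
      using core[OF ijk, of w w w] core[OF ijk, of w w "J \<circ> w"] core[OF ijk, of w "J \<circ> w" w]
        core[OF ijk, of w "J \<circ> w" "J \<circ> w"] core[OF ijk, of "J \<circ> w" w w] core[OF ijk, of "J \<circ> w" w "J \<circ> w"]
        core[OF ijk, of "J \<circ> w" "J \<circ> w" w] core[OF ijk, of "J \<circ> w" "J \<circ> w" "J \<circ> w"] by simp_all
    have c': "b (I (w i)) (w j) (w k) = 0" "b (I (w i)) (w j) (J (w k)) = 0" "b (I (w i)) (J (w j)) (w k) = 0"
      "b (I (w i)) (J (w j)) (J (w k)) = 0" "b (I (J (w i))) (w j) (w k) = 0" "b (I (J (w i))) (w j) (J (w k)) = 0"
      "b (I (J (w i))) (J (w j)) (w k) = 0" "b (I (J (w i))) (J (w j)) (J (w k)) = 0"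
      using IA[of w w w] IA[of w w "J \<circ> w"] IA[of w "J \<circ> w" w]
        IA[of w "J \<circ> w" "J \<circ> w"] IA[of "J \<circ> w" w w] IA[of "J \<circ> w" w "J \<circ> w"]
        IA[of "J \<circ> w" "J \<circ> w" w] IA[of "J \<circ> w" "J \<circ> w" "J \<circ> w"] by simp_all
    show ?thesis
      by (simp add: qmap_def K_eq t bI bI' IJK_simps c c')
  qed
  \<comment> \<open>The index 3 denotes the part orthogonal to the three lines.\<close>
  define comp where "comp i X = (if i < 3 then proj (w i) X
    else X - proj (w 0) X - proj (w 1) X - proj (w 2) X)" for i X
  have comp_horth: "horth (comp i X) (w m)" if "m < 3" "i \<noteq> m" for i m X
  proof -
    have p: "horth (proj (w i) X) (w m)" if "i < 3" "i \<noteq> m" for i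
      unfolding qmap_def using h[of i m] that \<open>m < 3\<close> by (simp add: horth_add horth_mult)
    show ?thesis
    proof (cases "i < 3")
      case True thus ?thesis using p that by (simp add: comp_def)
    next
      case False
      note q = proj_orth[OF u[OF \<open>m < 3\<close>], of X]
      have "horth ((X - proj (w m) X) - proj (w i) X - proj (w j) X) (w m)"
        if "i < 3" "i \<noteq> m" "j < 3" "j \<noteq> m" for i j
        by (intro horth_add(2) q p that)
      from this[of 1 2] this[of 0 2] this[of 0 1] have
        "horth (X - proj (w 0) X - proj (w 1) X - proj (w 2) X) (w m)"
        using \<open>m < 3\<close> by (auto simp: less_3_cases algebra_simps)
      thus ?thesis using False by (simp add: comp_def)
    qed
  qed
  have zero: "b (comp i X) (comp j Y) (comp k Z) = 0" if "i < 4" "j < 4" "k < 4" for i j k X Y Z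
  proof (cases "\<exists>m<3. m \<noteq> i \<and> m \<noteq> j \<and> m \<noteq> k")
    case True
    then obtain m where m: "m < 3" "i \<noteq> m" "j \<noteq> m" "k \<noteq> m" by metis
    have "b (comp i X) (comp j Y) (comp k Z) = - \<i> * b (comp i X) (comp j Y) (comp k Z)"
      using e[OF m(1), of "comp i X" "comp j Y" "comp k Z"]
      by (simp only: rot_horth[OF comp_horth[OF m(1,2)]] rot_horth[OF comp_horth[OF m(1,3)]]
          rot_horth[OF comp_horth[OF m(1,4)]])
    thus ?thesis by (rule i_cancel)
  next
    case False
    have "m \<in> {i, j, k}" if "m < 3" for m using False that by blast
    from this[of 0] this[of 1] this[of 2]
    have "i < 3" "j < 3" "k < 3" "i \<noteq> j" "i \<noteq> k" "j \<noteq> k" by auto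
    thus ?thesis using block by (simp add: comp_def)
  qed
  have dec: "(\<Sum>i<4. comp i X) = X" for X by (simp add: comp_def eval_nat_numeral)
  have "b (comp i X) (comp j Y) Z = 0" if "i < 4" "j < 4" for i j X Y Z
    using linear_sum[OF trilinear_linear(3)[OF b, where X="comp i X" and Y="comp j Y"], of "\<lambda>k. comp k Z" "{..<4}"] zero that
    by (simp add: dec)
  hence "b (comp i X) Y Z = 0" if "i < 4" for i X Y Z
    using linear_sum[OF trilinear_linear(2)[OF b, where X="comp i X" and Z=Z], of "\<lambda>k. comp k Y" "{..<4}"] that
    by (simp add: dec)
  hence "b X Y Z = 0" for X Y Z
    using linear_sum[OF trilinear_linear(1)[OF b, where Y=Y and Z=Z], of "\<lambda>k. comp k X" "{..<4}"]
    by (simp add: dec)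
  thus ?thesis by (simp add: fun_eq_iff)
qed

text \<open>After transport to \<open>L30E\<close> it suffices to treat the spanning forms
  \<open>wedge3\<close>; their images inherit the symmetries that force them to vanish.\<close>

lemma type_3_no_hom:
  assumes dim: "DIM('v) = 4 * N" "N \<ge> 2"
    and V: "\<And>b w. b \<in> V \<Longrightarrow> wedge_symmetric w b \<Longrightarrow> b = 0"
  shows "no_hom (type_3 g I J K) V"
  unfolding no_hom_def
proof (intro allI impI ballI)
  fix S f b
  assume S: "sp_module g I J K S" and T: "type_3 g I J K S" and f: "sp_hom S f" and fV: "f ` S \<subseteq> V" and b: "b \<in> S"
  obtain h where bij: "bij_betw h S (L30E g I J K)" and h: "sp_hom S h"
    using T unfolding type_3_def sp_isomorphic_def sp_hom_def by blast
  have h': "sp_hom (L30E g I J K) (inv_into S h)" by (rule sp_hom_inv[OF S h bij])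
  have "inv_into S h ` L30E g I J K = S"
    using bij_betw_inv_into[OF bij] by (simp add: bij_betw_def)
  let ?F = "f \<circ> inv_into S h"
  have F: "sp_hom (L30E g I J K) ?F"
    by (rule sp_hom_compose[OF h' f]) (simp add: \<open>_ = S\<close>)
  have FV: "?F c \<in> V" if "c \<in> L30E g I J K" for c
    using that fV \<open>_ = S\<close> by auto
  have sub: "tensors.subspace {c \<in> L30E g I J K. ?F c = 0}"
    by (rule hom_kernel_subspace[OF subspace_L30E F])
  have "wedge3 x y z \<in> {c \<in> L30E g I J K. ?F c = 0}" if t: "(x, y, z) \<in> triples" for x y z
  proof -
    define w where "w i = (if i = 0 then x else if i = 1 then y else z)" for i :: nat
    have w: "\<forall>i<3. g (w i) (w i) = 1" "\<forall>i<3. \<forall>j<3. i \<noteq> j \<longrightarrow> horth (w i) (w j)"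
      using t horth_sym by (auto simp: triples_def w_def)
    have m: "wedge3 (w 0) (w 1) (w 2) \<in> L30E g I J K" using wedge3_L30E[OF t] by (simp add: w_def)
    have "?F (wedge3 (w 0) (w 1) (w 2)) = 0"
      by (rule V[OF FV[OF m] wedge_symmetric_hom[OF F w]])
    thus ?thesis using m by (simp add: w_def)
  qed
  hence "tensors.span ((\<lambda>(x, y, z). wedge3 x y z) ` triples) \<subseteq> {c \<in> L30E g I J K. ?F c = 0}"
    by (intro tensors.span_minimal sub) auto
  moreover have "h b \<in> L30E g I J K" using bij b by (auto simp: bij_betw_def)
  ultimately have "?F (h b) = 0" using L30E_span[OF dim] by blast
  thus "f b = 0" using bij_betw_inv_into_left[OF bij b] by simp
qed

end

section \<open>Complexifications\<close>

lemma linear_Re_Im: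
  "linear (f :: 'v::real_vector \<Rightarrow> complex) \<longleftrightarrow> linear (\<lambda>x. Re (f x)) \<and> linear (\<lambda>x. Im (f x))"
  unfolding linear_iff complex_eq_iff plus_complex.sel scaleR_complex.sel by (auto simp: algebra_simps)

lemma trilinear_Re_Im:
  "trilinear b \<longleftrightarrow> trilinear (\<lambda>X Y Z. Re (b X Y Z)) \<and> trilinear (\<lambda>X Y Z. Im (b X Y Z))"
  unfolding trilinear_def by (subst (1 2 3) linear_Re_Im) blast

lemma basis_sum_Re_Im: "Re (basis_sum g f) = basis_sum g (\<lambda>e. Re (f e))"
  "Im (basis_sum g f) = basis_sum g (\<lambda>e. Im (f e))"
  by (simp_all add: basis_sum_def)

lemma eq_Re_Im3: "(\<forall>X Y Z. a X Y Z = b X Y Z) \<longleftrightarrow>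
    (\<forall>X Y Z. Re (a X Y Z) = Re (b X Y Z)) \<and> (\<forall>X Y Z. Im (a X Y Z) = Im (b X Y Z))"
  unfolding complex_eq_iff by blast

lemma eq_Re_Im2: "(\<forall>X Y. a X Y = b X Y) \<longleftrightarrow>
    (\<forall>X Y. Re (a X Y) = Re (b X Y)) \<and> (\<forall>X Y. Im (a X Y) = Im (b X Y))"
  unfolding complex_eq_iff by blast

lemma eq_Re_Im1: "(\<forall>X. a X = b X) \<longleftrightarrow> (\<forall>X. Re (a X) = Re (b X)) \<and> (\<forall>X. Im (a X) = Im (b X))"
  unfolding complex_eq_iff by blast

context qh
begin

text \<open>These predicates describe the spaces of tensors at a point and, for complex values, their
  complexifications.\<close>

definition is_TL20 :: "('v \<Rightarrow> 'v \<Rightarrow> 'v \<Rightarrow> 'a::real_vector) \<Rightarrow> bool" where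
  "is_TL20 b \<longleftrightarrow> trilinear b \<and> (\<forall>X Y Z. b X Z Y = b X Y Z) \<and> (\<forall>X Y Z. b X (I Y) (I Z) = b X Y Z) \<and>
     (\<forall>X Y Z. b X (J Y) (J Z) = b X Y Z) \<and> (\<forall>X. basis_sum g (\<lambda>e. b X e e) = 0)"

definition is_GH :: "('v \<Rightarrow> 'v \<Rightarrow> 'v \<Rightarrow> 'a::real_vector) \<Rightarrow> bool" where
  "is_GH b \<longleftrightarrow> trilinear b \<and> (\<forall>X Y Z. b X Z Y = - b X Y Z) \<and> (\<forall>X Y Z. b X (I Y) (I Z) = - b X Y Z)"

definition is_GH1 :: "('v \<Rightarrow> 'v \<Rightarrow> 'v \<Rightarrow> 'a::real_vector) \<Rightarrow> bool" where
  "is_GH1 b \<longleftrightarrow> is_GH b \<and> (\<forall>X Z. b X X Z = 0)"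

definition is_GH2 :: "('v \<Rightarrow> 'v \<Rightarrow> 'v \<Rightarrow> 'a::real_vector) \<Rightarrow> bool" where
  "is_GH2 b \<longleftrightarrow> is_GH b \<and> (\<forall>X Y Z. b X Y Z + b Y Z X + b Z X Y = 0)"

definition is_GH3 :: "('v \<Rightarrow> 'v \<Rightarrow> 'v \<Rightarrow> 'a::real_vector) \<Rightarrow> bool" where
  "is_GH3 b \<longleftrightarrow> is_GH b \<and> (\<forall>X Y Z. b (I X) (I Y) Z = b X Y Z) \<and> (\<forall>Z. basis_sum g (\<lambda>e. b e e Z) = 0)"

text \<open>\<open>\<W>\<^sub>1 + \<W>\<^sub>2\<close> for \<open>A = I\<close> and \<open>\<W>\<^sub>3 + \<W>\<^sub>4\<close> for \<open>A = - I\<close>\<close>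

definition is_GH_type :: "'v endo \<Rightarrow> ('v \<Rightarrow> 'v \<Rightarrow> 'v \<Rightarrow> 'a::real_vector) \<Rightarrow> bool" where
  "is_GH_type A b \<longleftrightarrow> is_GH b \<and> (\<forall>X Y Z. b (A X) (I Y) Z = - b X Y Z)"

lemma TL20_eq: "TL20 g I J K = {b. is_TL20 b}"
proof (intro set_eqI iffI)
  fix b :: "'v tensor3" assume "b \<in> TL20 g I J K"
  hence "trilinear b" "\<And>X Y Z. b X Y Z = b X Z Y" "\<And>X Y Z. b X (I Y) (I Z) = b X Y Z"
    "\<And>X Y Z. b X (J Y) (J Z) = b X Y Z" "\<And>X. basis_sum g (\<lambda>e. b X e e) = 0"
    unfolding TL20_def by blast+
  thus "b \<in> {b. is_TL20 b}" unfolding is_TL20_def by blast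
next
  fix b :: "'v tensor3" assume b: "b \<in> {b. is_TL20 b}"
  hence "b X (K Y) (K Z) = b X Y Z" for X Y Z
    by (simp add: is_TL20_def K_eq)
  with b show "b \<in> TL20 g I J K"
    unfolding is_TL20_def TL20_def mem_Collect_eq ball_simps by metis
qed

lemma GH_eq: "GH I = {b. is_GH b}"
  unfolding GH_def is_GH_def by (metis (no_types, lifting) minus_minus)

lemma GHi_eq: "GH1 I = {b. is_GH1 b}" "GH2 I = {b. is_GH2 b}" "GH3 g I = {b. is_GH3 b}"
  by (simp_all add: GH1_def GH2_def GH3_def is_GH1_def is_GH2_def is_GH3_def GH_eq)

lemma is_TL20_Re_Im: "is_TL20 b \<longleftrightarrow> is_TL20 (\<lambda>X Y Z. Re (b X Y Z)) \<and> is_TL20 (\<lambda>X Y Z. Im (b X Y Z))"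
  unfolding is_TL20_def trilinear_Re_Im[of b] eq_Re_Im3 eq_Re_Im1 basis_sum_Re_Im zero_complex.sel by blast

lemma is_GH_Re_Im: "is_GH b \<longleftrightarrow> is_GH (\<lambda>X Y Z. Re (b X Y Z)) \<and> is_GH (\<lambda>X Y Z. Im (b X Y Z))"
  unfolding is_GH_def trilinear_Re_Im[of b] eq_Re_Im3 uminus_complex.sel by blast

lemma is_GHi_Re_Im:
  "is_GH1 b \<longleftrightarrow> is_GH1 (\<lambda>X Y Z. Re (b X Y Z)) \<and> is_GH1 (\<lambda>X Y Z. Im (b X Y Z))"
  "is_GH2 b \<longleftrightarrow> is_GH2 (\<lambda>X Y Z. Re (b X Y Z)) \<and> is_GH2 (\<lambda>X Y Z. Im (b X Y Z))"
  "is_GH3 b \<longleftrightarrow> is_GH3 (\<lambda>X Y Z. Re (b X Y Z)) \<and> is_GH3 (\<lambda>X Y Z. Im (b X Y Z))"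
  unfolding is_GH1_def is_GH2_def is_GH3_def is_GH_Re_Im[of b] eq_Re_Im3 eq_Re_Im2 eq_Re_Im1
    basis_sum_Re_Im zero_complex.sel plus_complex.sel by blast+

lemma complexification_eq:
  "complexification (TL20 g I J K) = {b. is_TL20 b}" "complexification (GH1 I) = {b. is_GH1 b}"
  "complexification (GH2 I) = {b. is_GH2 b}" "complexification (GH3 g I) = {b. is_GH3 b}"
  unfolding complexification_def TL20_eq GHi_eq mem_Collect_eq
    is_TL20_Re_Im[symmetric] is_GHi_Re_Im[symmetric] by simp_all

lemma is_TL20D:
  assumes "is_TL20 b"
  shows "trilinear b" "b X Z Y = b X Y Z" "b X Y (I Z) = - b X (I Y) Z" "b X Y (J Z) = - b X (J Y) Z"
    "basis_sum g (\<lambda>e. b X e e) = 0"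
proof -
  show 1: "trilinear b" "basis_sum g (\<lambda>e. b X e e) = 0" "b X Z Y = b X Y Z"
    using assms unfolding is_TL20_def by blast+
  have 2: "b X (I Y) (I Z) = b X Y Z" "b X (J Y) (J Z) = b X Y Z" for X Y Z
    using assms unfolding is_TL20_def by blast+
  have "- b X Y (I Z) = b X (I Y) Z" using 2(1)[of X "I Y" Z] by (simp add: IJK_simps trilinear_simps[OF 1(1)])
  thus "b X Y (I Z) = - b X (I Y) Z" by (metis minus_minus)
  have "- b X Y (J Z) = b X (J Y) Z" using 2(2)[of X "J Y" Z] by (simp add: IJK_simps trilinear_simps[OF 1(1)])
  thus "b X Y (J Z) = - b X (J Y) Z" by (metis minus_minus)
qed

lemma is_GHD:
  assumes "is_GH b"
  shows "trilinear b" "b X Z Y = - b X Y Z" "b X Y (I Z) = b X (I Y) Z"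
proof -
  show 1: "trilinear b" "b X Z Y = - b X Y Z" using assms unfolding is_GH_def by blast+
  have 2: "b X (I Y) (I Z) = - b X Y Z" for X Y Z using assms unfolding is_GH_def by blast
  show "b X Y (I Z) = b X (I Y) Z" using 2[of X "I Y" Z] by (simp add: IJK_simps trilinear_simps[OF 1(1)])
qed

lemma is_GHI:
  assumes "trilinear b" "\<And>X Y Z. b X Z Y = - b X Y Z" "\<And>X Y Z. b X Y (I Z) = b X (I Y) Z"
  shows "is_GH b"
proof -
  have "b X (I Y) (I Z) = - b X Y Z" for X Y Z
    by (simp add: assms(3) IJK_simps trilinear_simps[OF assms(1)])
  thus ?thesis unfolding is_GH_def using assms(1,2) by blast
qed

lemma is_TL20I:
  assumes "trilinear b" "\<And>X Y Z. b X Z Y = b X Y Z" "\<And>X Y Z. b X Y (I Z) = - b X (I Y) Z"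
    "\<And>X Y Z. b X Y (J Z) = - b X (J Y) Z" "\<And>X. basis_sum g (\<lambda>e. b X e e) = 0"
  shows "is_TL20 b"
proof -
  have "b X (I Y) (I Z) = b X Y Z" "b X (J Y) (J Z) = b X Y Z" for X Y Z
    by (simp_all add: assms(3,4) IJK_simps trilinear_simps[OF assms(1)])
  thus ?thesis unfolding is_TL20_def using assms(1,2,5) by blast
qed

text \<open>\<open>- p X (J Y) Z - q X (K Y) Z\<close> is the form \<open>g Y ((J p\<^sub>X + K q\<^sub>X) Z)\<close>, where \<open>p, q\<close> are regarded as
  endomorphism-valued one-forms; it lies in \<open>\<W>\<^sub>1 + \<W>\<^sub>2\<close> or \<open>\<W>\<^sub>3 + \<W>\<^sub>4\<close> if \<open>q\<close> is \<open>p\<close> with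
  first argument multiplied by \<open>I\<close> or \<open>- I\<close>.\<close>

definition Phi :: "'v endo \<Rightarrow> ('v \<Rightarrow> 'v \<Rightarrow> 'v \<Rightarrow> 'a::real_vector) \<Rightarrow> 'v \<Rightarrow> 'v \<Rightarrow> 'v \<Rightarrow> 'a" where
  "Phi A p = (\<lambda>X Y Z. - p X (J Y) Z - p (A X) (K Y) Z)"

text \<open>The inverse of \<open>Phi A\<close>: it extracts the factor p of J p + K q, because the
  contributions of K q to the two terms cancel. Up to sign it is the part of the formula for
  \<alpha> built from \<open>slot2\<close> and \<open>slot3\<close>.\<close>

definition Theta :: "('v \<Rightarrow> 'v \<Rightarrow> 'v \<Rightarrow> 'a::real_vector) \<Rightarrow> 'v \<Rightarrow> 'v \<Rightarrow> 'v \<Rightarrow> 'a" where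
  "Theta b = (\<lambda>X Y Z. (1/2) *\<^sub>R (b X (J Y) Z - b X Y (J Z)))"

text \<open>The two signs treat W1 + W2 and W3 + W4 uniformly.\<close>

definition signs :: "'v endo set" where "signs = {I, \<lambda>X. - I X}"

lemma signsD:
  assumes "A \<in> signs"
  shows "linear A" "A (A X) = - X" "A (I X) = I (A X)" "g (A X) (A Y) = g X Y"
    "A (X + Y) = A X + A Y" "A (- X) = - A X" "A (r *\<^sub>R X) = r *\<^sub>R A X"
proof -
  show l: "linear A"
    using assms linear_IJK(1) linear_compose_neg[OF linear_IJK(1)] by (auto simp: signs_def)
  show "A (A X) = - X" "A (I X) = I (A X)" "g (A X) (A Y) = g X Y"
    using assms by (auto simp: signs_def IJK_simps g_simps g_IJK)
  show "A (X + Y) = A X + A Y" "A (- X) = - A X" "A (r *\<^sub>R X) = r *\<^sub>R A X"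
    using l by (simp_all add: linear_add linear_neg linear_cmul)
qed

lemma trilinear_Phi:
  assumes "trilinear p" "A \<in> signs"
  shows "trilinear (Phi A p)"
  unfolding Phi_def using assms linear_IJK signsD(1)[OF assms(2)]
  by (intro trilinear_diff trilinear_neg) (auto intro: trilinear_compose linear_ident)

lemma trilinear_Theta:
  assumes "trilinear p"
  shows "trilinear (Theta p)"
  unfolding Theta_def using assms linear_IJK
  by (intro trilinear_diff trilinear_scaleR) (auto intro: trilinear_compose linear_ident)

lemma Phi_GH:
  assumes p: "is_TL20 p" and A: "A \<in> signs"
  shows "is_GH_type A (Phi A p)"
proof -
  note t = trilinear_simps[OF is_TL20D(1)[OF p]]
  note s = is_TL20D(3,4)[OF p]
  have "is_GH (Phi A p)"
  proof (rule is_GHI[OF trilinear_Phi[OF is_TL20D(1)[OF p] A]])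
    fix X Y Z
    show "Phi A p X Z Y = - Phi A p X Y Z"
      using is_TL20D(2)[OF p, where X=X and Y="J Y" and Z=Z] is_TL20D(2)[OF p, where X="A X" and Y="I (J Y)" and Z=Z]
      by (simp add: Phi_def K_eq IJK_simps t s flip: is_TL20D(2)[OF p, where Y=Y])
    show "Phi A p X Y (I Z) = Phi A p X (I Y) Z"
      by (simp add: Phi_def K_eq IJK_simps t s)
  qed
  moreover have "Phi A p (A X) (I Y) Z = - Phi A p X Y Z" for X Y Z
    by (simp add: Phi_def K_eq IJK_simps t s signsD[OF A])
  ultimately show ?thesis by (simp add: is_GH_type_def)
qed

lemma Theta_Phi:
  assumes p: "is_TL20 p" and A: "A \<in> signs"
  shows "Theta (Phi A p) = p"
proof (intro ext)
  fix X Y Z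
  show "Theta (Phi A p) X Y Z = p X Y Z"
    by (simp add: Theta_def Phi_def K_eq IJK_simps trilinear_simps[OF is_TL20D(1)[OF p]] is_TL20D(3,4)[OF p]
        scaleR_2[symmetric])
qed

text \<open>All conditions but the trace follow from skewness and the rule for \<open>I\<close>. For
  the covariant derivative of omega_I the trace in the hypothesis is 4n times
  \<open>\<lambda>\<^sub>K\<close>; on modules of good type it vanishes.\<close>

lemma Theta_TL20:
  assumes b: "is_GH b" and tr: "\<And>X. basis_sum g (\<lambda>e. b X (J e) e) = 0"
  shows "is_TL20 (Theta b)"
proof (rule is_TL20I[OF trilinear_Theta[OF is_GHD(1)[OF b]]])
  note t = trilinear_simps[OF is_GHD(1)[OF b]]
  fix X Y Z
  show "Theta b X Z Y = Theta b X Y Z"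
    using is_GHD(2)[OF b, where X=X and Y="J Y" and Z=Z] is_GHD(2)[OF b, where X=X and Y=Y and Z="J Z"]
    by (simp add: Theta_def)
  show "Theta b X Y (I Z) = - Theta b X (I Y) Z"
    by (simp add: Theta_def IJK_simps t is_GHD(3)[OF b] flip: scaleR_minus_right)
  show "Theta b X Y (J Z) = - Theta b X (J Y) Z"
    by (simp add: Theta_def IJK_simps t flip: scaleR_minus_right)
  have "b X e (J e) = - b X (J e) e" for e
    by (rule is_GHD(2)[OF b])
  hence "Theta b X e e = b X (J e) e" for e
    by (simp add: Theta_def scaleR_2[symmetric])
  thus "basis_sum g (\<lambda>e. Theta b X e e) = 0" using tr by simp
qed

lemma Phi_Theta:
  assumes "is_GH_type A b" and A: "A \<in> signs"
  shows "Phi A (Theta b) = b"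
proof (intro ext)
  fix X Y Z
  have b: "is_GH b" and A': "\<And>X Y Z. b (A X) (I Y) Z = - b X Y Z"
    using assms(1) by (auto simp: is_GH_type_def)
  note t = trilinear_simps[OF is_GHD(1)[OF b]]
  show "Phi A (Theta b) X Y Z = b X Y Z"
    by (simp add: Theta_def Phi_def K_eq IJK_simps t A' scaleR_2[symmetric] flip: scaleR_minus_right scaleR_diff_right)
qed

section \<open>Isotypic components\<close>

lemma sp_module_image:
  assumes S: "sp_module g I J K S" and f: "sp_hom S f" and t: "\<And>b. b \<in> S \<Longrightarrow> trilinear (f b)"
  shows "sp_module g I J K (f ` S)"
proof -
  note s = sp_moduleD[OF S]
  have "tensors.subspace (f ` S)"
  proof (rule tensors.subspaceI)
    have "f 0 = 0"
      using sp_homD(2)[OF f tensors.subspace_0[OF s(2)], of 0] by (simp add: tscale_zero)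
    thus "0 \<in> f ` S" using tensors.subspace_0[OF s(2)] by (metis imageI)
  next
    fix x y assume "x \<in> f ` S" "y \<in> f ` S"
    then obtain b c where *: "b \<in> S" "c \<in> S" and "x = f b" "y = f c" by blast
    thus "x + y \<in> f ` S"
      using sp_homD(1)[OF f *] tensors.subspace_add[OF s(2) *] by (metis imageI)
  next
    fix r x assume "x \<in> f ` S"
    then obtain b where *: "b \<in> S" and "x = f b" by blast
    thus "tscale r x \<in> f ` S"
      using sp_homD(2)[OF f *, of r] tensors.subspace_scale[OF s(2) *, of r] by (metis imageI)
  qed
  moreover have "act a (f b) \<in> f ` S" if "a \<in> Sp g I J K" "b \<in> S" for a b
    using sp_homD(3)[OF f that] s(3)[OF that] by (metis imageI)
  ultimately show ?thesis using t unfolding sp_module_def by blast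
qed

lemma type_3_image:
  assumes S: "sp_module g I J K S" and f: "sp_hom S f" and inj: "inj_on f S" and T: "type_3 g I J K S"
  shows "type_3 g I J K (f ` S)"
proof -
  obtain h where bij: "bij_betw h S (L30E g I J K)" and h: "sp_hom S h"
    using T unfolding type_3_def sp_isomorphic_def sp_hom_def by blast
  have fb: "bij_betw f S (f ` S)" using inj by (simp add: bij_betw_def)
  have "sp_hom (f ` S) (h \<circ> inv_into S f)"
    by (rule sp_hom_compose[OF sp_hom_inv[OF S f fb] h])
      (use bij_betw_inv_into[OF fb] in \<open>simp add: bij_betw_def\<close>)
  moreover have "bij_betw (h \<circ> inv_into S f) (f ` S) (L30E g I J K)"
    by (rule bij_betw_trans[OF bij_betw_inv_into[OF fb] bij])
  ultimately show ?thesis unfolding type_3_def sp_isomorphic_def sp_hom_def by blast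
qed

text \<open>Preimages of submodules are submodules, and an injective equivariant map preserves and
  reflects weights.\<close>

lemma type_K_image:
  assumes S: "sp_module g I J K S" and f: "sp_hom S f" and inj: "inj_on f S" and T: "type_K g I J K S"
    and M: "sp_module g I J K (f ` S)"
  shows "type_K g I J K (f ` S)"
proof -
  note s = sp_moduleD[OF S]
  have 0: "0 \<in> S" by (rule tensors.subspace_0[OF s(2)])
  have f0: "f 0 = 0"
    using sp_homD(2)[OF f 0, of 0] by (simp add: tscale_zero)
  have fz: "b = 0" if "b \<in> S" "f b = 0" for b
    using inj_onD[OF inj _ that(1) 0] that f0 by simp
  have irr: "R = {0} \<or> R = S" if "R \<subseteq> S" "sp_module g I J K R" for R
    using T that unfolding type_K_def sp_irreducible_def by blast
  have "S \<noteq> {0}" using T by (simp add: type_K_def sp_irreducible_def)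
  hence "f ` S \<noteq> {0}" using fz 0 by blast
  moreover have "R = {0} \<or> R = f ` S" if R: "R \<subseteq> f ` S" "sp_module g I J K R" for R
  proof -
    note r = sp_moduleD[OF R(2)]
    define Q where "Q = {b \<in> S. f b \<in> R}"
    have "tensors.subspace Q"
      unfolding Q_def
    proof (rule tensors.subspaceI)
      show "0 \<in> {b \<in> S. f b \<in> R}" using 0 f0 tensors.subspace_0[OF r(2)] by simp
      show "x + y \<in> {b \<in> S. f b \<in> R}" if "x \<in> {b \<in> S. f b \<in> R}" "y \<in> {b \<in> S. f b \<in> R}" for x y
        using that sp_homD(1)[OF f, of x y] tensors.subspace_add[OF s(2), of x y] tensors.subspace_add[OF r(2), of "f x" "f y"]
        by simp
      show "tscale c x \<in> {b \<in> S. f b \<in> R}" if "x \<in> {b \<in> S. f b \<in> R}" for c x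
        using that sp_homD(2)[OF f, of x c] tensors.subspace_scale[OF s(2), of x c] tensors.subspace_scale[OF r(2), of "f x" c]
        by simp
    qed
    moreover have "act a b \<in> Q" if "a \<in> Sp g I J K" "b \<in> Q" for a b
      using that sp_homD(3)[OF f, of a b] s(3)[of a b] r(3)[of a "f b"] by (simp add: Q_def)
    moreover have "Q \<subseteq> {b. trilinear b}" using s(1) by (auto simp: Q_def)
    ultimately have "sp_module g I J K Q" unfolding sp_module_def by blast
    hence "Q = {0} \<or> Q = S" using irr[of Q] by (auto simp: Q_def)
    moreover have "R = f ` Q" using R(1) by (auto simp: Q_def)
    ultimately show ?thesis using f0 by auto
  qed
  ultimately have "sp_irreducible g I J K (f ` S)"
    using M unfolding sp_irreducible_def by blast
  moreover have w: "weight_vector g I J K e m (f b) \<longleftrightarrow> weight_vector g I J K e m b" if b: "b \<in> S" for e m b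
  proof -
    have "act a (f b) = tscale r (f b) \<longleftrightarrow> act a b = tscale r b" if "a \<in> Sp g I J K" for a r
      using sp_homD(2)[OF f b, of r] sp_homD(3)[OF f that b]
        inj_on_eq_iff[OF inj s(3)[OF that b] tensors.subspace_scale[OF s(2) b, of r]] by simp
    thus ?thesis unfolding weight_vector_def by blast
  qed
  have "has_highest_weight g I J K l (f ` S)" if hw: "has_highest_weight g I J K l S" for l
  proof -
    obtain e where e: "quaternionic_frame g I J K e" "\<exists>b\<in>S. b \<noteq> 0 \<and> weight_vector g I J K e l b"
      "\<forall>m. (\<exists>b\<in>S. b \<noteq> 0 \<and> weight_vector g I J K e m b) \<longrightarrow> weight_le (DIM('v) div 4) m l"
      using hw unfolding has_highest_weight_def by blast
    have c: "(f b \<noteq> 0 \<and> weight_vector g I J K e m (f b)) = (b \<noteq> 0 \<and> weight_vector g I J K e m b)"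
      if "b \<in> S" for b m
      using w[OF that, of e m] fz[OF that] f0 by metis
    have "(\<exists>c\<in>f ` S. c \<noteq> 0 \<and> weight_vector g I J K e m c) \<longleftrightarrow> (\<exists>b\<in>S. b \<noteq> 0 \<and> weight_vector g I J K e m b)" for m
      unfolding bex_simps(7) by (rule bex_cong[OF refl c])
    thus ?thesis unfolding has_highest_weight_def using e by (intro exI[of _ e]) simp
  qed
  ultimately show ?thesis using T by (simp add: type_K_def)
qed

text \<open>The common part of both types: traces vanish on such modules, and the type survives the
  passage along \<open>Phi\<close> and \<open>Theta\<close>.\<close>

definition good_type :: "('v ctensor3 set \<Rightarrow> bool) \<Rightarrow> bool" where
  "good_type \<tau> \<longleftrightarrow> no_hom \<tau> V1 \<and>
     (\<forall>S f. sp_module g I J K S \<longrightarrow> \<tau> S \<longrightarrow> sp_hom S f \<longrightarrow> inj_on f S \<longrightarrow> sp_module g I J K (f ` S) \<longrightarrow> \<tau> (f ` S))"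

lemma sp_hom_pointwise:
  assumes "\<And>b b' X Y Z. f (b + b') X Y Z = f b X Y Z + f b' X Y Z"
    and "\<And>r b X Y Z. f (tscale r b) X Y Z = r * f b X Y Z"
    and "\<And>a b X Y Z. a \<in> Sp g I J K \<Longrightarrow> b \<in> S \<Longrightarrow> f (act a b) X Y Z = f b (inv a X) (inv a Y) (inv a Z)"
  shows "sp_hom S f"
  unfolding sp_hom_def using assms by (auto simp: fun_eq_iff act_def)

lemma sp_hom_Phi:
  assumes "A \<in> signs"
  shows "sp_hom S (Phi A)"
  using assms
  by (intro sp_hom_pointwise)
    (auto simp: Phi_def act_def algebra_simps signs_def Sp_D(3,5)[OF inv_Sp] Sp_D(4)[OF inv_Sp]
      linear_neg[OF Sp_D(1)[OF inv_Sp]])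

lemma sp_hom_Theta: "sp_hom S Theta"
  by (intro sp_hom_pointwise) (auto simp: Theta_def act_def algebra_simps Sp_D(4)[OF inv_Sp] scaleR_conv_of_real)

lemma exists_unit: "\<exists>u. g u u > 0"
  using g_pos nonzero_Basis SOME_Basis by blast

text \<open>Both contractions are equivariant maps to one-forms. Tensoring with \<open>g\<close>
  puts them into \<open>V1\<close>, and evaluation at \<open>u, u\<close> recovers the
  one-form.\<close>

lemma no_hom_contraction:
  assumes \<tau>: "no_hom \<tau> V1" and S: "sp_module g I J K S" "\<tau> S" and b: "b \<in> S"
  shows "basis_sum g (\<lambda>e. b X (J e) e) = 0" "basis_sum g (\<lambda>e. b e e X) = 0"
proof -
  have bil: "bilinear (\<lambda>e e'. c X (J e) e')" "bilinear (\<lambda>e e'. c e e' X)" if "c \<in> S" for c X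
    unfolding bilinear_def
    by (auto intro!: linearI simp: trilinear_simps[OF sp_moduleD(1)[OF S(1) that]] IJK_simps)
  obtain u where u: "g u u > 0" using exists_unit by blast
  define F where "F \<phi> b = (\<lambda>X Y Z. g Y Z *\<^sub>R basis_sum g (\<phi> b X) :: complex)" for \<phi> :: "'v ctensor3 \<Rightarrow> 'v \<Rightarrow> 'v \<Rightarrow> complex" and b
  have gi: "g (inv a Y) (inv a Z) = g Y Z" if "a \<in> Sp g I J K" for a Y Z
    by (rule Sp_D(2)[OF inv_Sp[OF that]])
  have V: "F \<phi> b \<in> V1" if "linear (\<lambda>X. basis_sum g (\<phi> b X))" for \<phi> b
    unfolding V1_def F_def mem_Collect_eq using that by (intro exI[of _ "\<lambda>X. basis_sum g (\<phi> b X)"]) simp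
  have z: "basis_sum g (\<phi> b X) = 0" if "sp_hom S (F \<phi>)" "\<And>c. c \<in> S \<Longrightarrow> linear (\<lambda>X. basis_sum g (\<phi> c X))" for \<phi>
  proof -
    have "F \<phi> ` S \<subseteq> V1" 
    proof (rule image_subsetI)
      fix c assume "c \<in> S"
      show "F \<phi> c \<in> V1" by (rule V) (rule that(2)[OF \<open>c \<in> S\<close>])
    qed
    hence "F \<phi> b = 0" using \<tau>[unfolded no_hom_def, rule_format, OF S that(1)] b by simp
    hence "F \<phi> b X u u = 0" by simp
    thus ?thesis using u by (simp add: F_def)
  qed
  show "basis_sum g (\<lambda>e. b X (J e) e) = 0"
  proof (rule z[of "\<lambda>b X e. b X (J e) e"])
    show "sp_hom S (F (\<lambda>b X e. b X (J e) e))"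
    proof (rule sp_hom_pointwise)
      fix a c X Y Z assume a: "a \<in> Sp g I J K" and c: "c \<in> S"
      have "basis_sum g (\<lambda>e. c (inv a X) (J (inv a e)) (inv a e)) = basis_sum g (\<lambda>e. c (inv a X) (J e) e)"
        by (rule basis_sum_isometry[OF Sp_D(1,2)[OF inv_Sp[OF a]] bil(1)[OF c]])
      thus "F (\<lambda>b X e. b X (J e) e) (act a c) X Y Z = F (\<lambda>b X e. b X (J e) e) c (inv a X) (inv a Y) (inv a Z)"
        by (simp add: F_def act_def gi[OF a] Sp_D(4)[OF inv_Sp[OF a]])
    qed (simp_all add: F_def basis_sum_add basis_sum_mult algebra_simps)
    show "linear (\<lambda>X. basis_sum g (\<lambda>e. c X (J e) e))" if "c \<in> S" for c
      by (intro linear_on_basis_sum trilinear_linear(1) sp_moduleD(1)[OF S(1) that])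
  qed
  show "basis_sum g (\<lambda>e. b e e X) = 0"
  proof (rule z[of "\<lambda>b X e. b e e X"])
    show "sp_hom S (F (\<lambda>b X e. b e e X))"
    proof (rule sp_hom_pointwise)
      fix a c X Y Z assume a: "a \<in> Sp g I J K" and c: "c \<in> S"
      have "basis_sum g (\<lambda>e. c (inv a e) (inv a e) (inv a X)) = basis_sum g (\<lambda>e. c e e (inv a X))"
        by (rule basis_sum_isometry[OF Sp_D(1,2)[OF inv_Sp[OF a]] bil(2)[OF c]])
      thus "F (\<lambda>b X e. b e e X) (act a c) X Y Z = F (\<lambda>b X e. b e e X) c (inv a X) (inv a Y) (inv a Z)"
        by (simp add: F_def act_def gi[OF a])
    qed (simp_all add: F_def basis_sum_add basis_sum_mult algebra_simps)
    show "linear (\<lambda>X. basis_sum g (\<lambda>e. c e e X))" if "c \<in> S" for c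
      by (intro linear_on_basis_sum trilinear_linear(3) sp_moduleD(1)[OF S(1) that])
  qed
qed

lemma span_image_subset:
  assumes add: "\<And>b b'. f (b + b') = f b + f b'" and scl: "\<And>r b. f (tscale r b) = tscale r (f b)"
    and U: "\<And>b. b \<in> U \<Longrightarrow> f b \<in> tensors.span U'" and b: "b \<in> tensors.span U"
  shows "f b \<in> tensors.span U'"
proof -
  have "tensors.span U \<subseteq> {b. f b \<in> tensors.span U'}"
  proof (rule tensors.span_minimal)
    show "U \<subseteq> {b. f b \<in> tensors.span U'}" using U by blast
    show "tensors.subspace {b. f b \<in> tensors.span U'}"
    proof (rule tensors.subspaceI)
      have "f 0 = 0" using scl[of 0 0] by (simp add: tscale_def zero_fun_def)
      thus "0 \<in> {b. f b \<in> tensors.span U'}" by (simp add: tensors.span_zero)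
    qed (simp_all add: add scl tensors.span_add tensors.span_scale)
  qed
  thus ?thesis using b by blast
qed

abbreviation of_real3 :: "'v tensor3 \<Rightarrow> 'v ctensor3" where
  "of_real3 b \<equiv> (\<lambda>X Y Z. complex_of_real (b X Y Z))"

text \<open>The inclusion \<open>W\<close> is demanded for submodules of type \<tau> only.
  \<open>Phi A\<close> sends general elements of \<open>TL20\<close> to W1 + W2 or W3 + W4 rather
  than to a single summand, and \<open>Theta\<close> of a general element may have a trace.\<close>

lemma isotypic_transfer:
  assumes \<tau>: "\<And>S f. sp_module g I J K S \<Longrightarrow> \<tau> S \<Longrightarrow> sp_hom S f \<Longrightarrow> inj_on f S \<Longrightarrow>
      sp_module g I J K (f ` S) \<Longrightarrow> \<tau> (f ` S)"
    and F: "\<And>S. sp_hom S F" "\<And>b b'. F (b + b') = F b + F b'" "\<And>r b. F (tscale r b) = tscale r (F b)"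
    and W: "\<And>S. sp_module g I J K S \<Longrightarrow> \<tau> S \<Longrightarrow> S \<subseteq> complexification W \<Longrightarrow> F ` S \<subseteq> complexification W'"
    and inv: "\<And>b. b \<in> complexification W \<Longrightarrow> F' (F b) = b"
    and tri: "\<And>b. b \<in> complexification W' \<Longrightarrow> trilinear b"
    and b: "b \<in> isotypic_component g I J K \<tau> W"
  shows "F b \<in> isotypic_component g I J K \<tau> W'"
  unfolding isotypic_component_def
proof (rule span_image_subset[OF F(2,3) _ b[unfolded isotypic_component_def]])
  fix c assume "c \<in> \<Union>{S. S \<subseteq> complexification W \<and> sp_module g I J K S \<and> \<tau> S}"
  then obtain S where S: "S \<subseteq> complexification W" "sp_module g I J K S" "\<tau> S" and c: "c \<in> S" by blast
  note FS = W[OF S(2,3,1)]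
  have "inj_on F S" using inv S(1) by (intro inj_on_inverseI[of _ F']) blast
  moreover have "sp_module g I J K (F ` S)"
    using FS tri by (intro sp_module_image[OF S(2) F(1)]) blast
  ultimately have "\<tau> (F ` S)" using \<tau> S F(1) by blast
  hence "F ` S \<in> {S. S \<subseteq> complexification W' \<and> sp_module g I J K S \<and> \<tau> S}"
    using FS \<open>sp_module g I J K (F ` S)\<close> by blast
  thus "F c \<in> tensors.span (\<Union>{S. S \<subseteq> complexification W' \<and> sp_module g I J K S \<and> \<tau> S})"
    using c by (intro tensors.span_base) blast
qed

lemma isotypic_subset:
  assumes "tensors.subspace (complexification W)"
  shows "isotypic_component g I J K \<tau> W \<subseteq> complexification W"
  unfolding isotypic_component_def by (rule tensors.span_minimal[OF _ assms]) blast

lemma Phi_linear: "Phi A (b + b') = Phi A b + Phi A b'" "Phi A (tscale r (c :: 'v ctensor3)) = tscale r (Phi A c)"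
  by (simp_all add: Phi_def fun_eq_iff algebra_simps)

lemma Theta_linear: "Theta (b + b') = Theta b + Theta b'" "Theta (tscale r (c :: 'v ctensor3)) = tscale r (Theta c)"
  by (simp_all add: Theta_def fun_eq_iff algebra_simps)

lemma of_real3_commute: "Phi A (of_real3 p) = of_real3 (Phi A p)" "Theta (of_real3 p) = of_real3 (Theta p)"
  by (simp_all add: Phi_def Theta_def fun_eq_iff scaleR_conv_of_real)

lemma of_real3_complexification:
  assumes "of_real3 b \<in> complexification W"
  shows "b \<in> W"
  using assms by (simp add: complexification_def)

lemma is_TL20_subspace: "tensors.subspace {b :: 'v \<Rightarrow> 'v \<Rightarrow> 'v \<Rightarrow> 'a::real_normed_field. is_TL20 b}"
proof (rule tensors.subspaceI; (unfold mem_Collect_eq)?)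
  show "is_TL20 (0 :: 'v \<Rightarrow> 'v \<Rightarrow> 'v \<Rightarrow> 'a)"
    by (simp add: is_TL20_def trilinear_0 basis_sum_0)
next
  fix a b :: "'v \<Rightarrow> 'v \<Rightarrow> 'v \<Rightarrow> 'a" assume a: "is_TL20 a" and b: "is_TL20 b"
  have s: "(a + b) X Z Y = (a + b) X Y Z" for X Y Z
    by (simp only: plus_fun_apply is_TL20D(2)[OF a, where X=X and Y=Y and Z=Z]
        is_TL20D(2)[OF b, where X=X and Y=Y and Z=Z])
  show "is_TL20 (a + b)"
    by (rule is_TL20I[where b = "a + b", OF trilinear_plus[OF is_TL20D(1)[OF a] is_TL20D(1)[OF b]] s])
      (simp_all add: is_TL20D(1,3,4,5)[OF a] is_TL20D(1,3,4,5)[OF b] basis_sum_add)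
next
  fix r and a :: "'v \<Rightarrow> 'v \<Rightarrow> 'v \<Rightarrow> 'a" assume a: "is_TL20 a"
  have s: "tscale r a X Z Y = tscale r a X Y Z" for X Y Z
    by (simp only: tscale_apply is_TL20D(2)[OF a, where X=X and Y=Y and Z=Z])
  show "is_TL20 (tscale r a)"
    by (rule is_TL20I[where b = "tscale r a", OF trilinear_tscale[OF is_TL20D(1)[OF a]] s])
      (simp_all add: is_TL20D(1,3,4,5)[OF a] basis_sum_mult)
qed

lemma is_GH_subspace: "tensors.subspace {b :: 'v \<Rightarrow> 'v \<Rightarrow> 'v \<Rightarrow> 'a::real_normed_field. is_GH b}"
proof (rule tensors.subspaceI; (unfold mem_Collect_eq)?)
  show "is_GH (0 :: 'v \<Rightarrow> 'v \<Rightarrow> 'v \<Rightarrow> 'a)"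
    by (simp add: is_GH_def trilinear_0)
next
  fix a b :: "'v \<Rightarrow> 'v \<Rightarrow> 'v \<Rightarrow> 'a" assume a: "is_GH a" and b: "is_GH b"
  have s: "(a + b) X Z Y = - (a + b) X Y Z" for X Y Z
    by (simp only: plus_fun_apply is_GHD(2)[OF a, where X=X and Y=Y and Z=Z]
        is_GHD(2)[OF b, where X=X and Y=Y and Z=Z] minus_add_distrib)
  show "is_GH (a + b)"
    by (rule is_GHI[OF trilinear_plus[OF is_GHD(1)[OF a] is_GHD(1)[OF b]] s])
      (simp add: is_GHD(3)[OF a] is_GHD(3)[OF b])
next
  fix r and a :: "'v \<Rightarrow> 'v \<Rightarrow> 'v \<Rightarrow> 'a" assume a: "is_GH a"
  have s: "tscale r a X Z Y = - tscale r a X Y Z" for X Y Z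
    by (simp only: tscale_apply is_GHD(2)[OF a, where X=X and Y=Y and Z=Z] mult_minus_right)
  show "is_GH (tscale r a)"
    by (rule is_GHI[OF trilinear_tscale[OF is_GHD(1)[OF a]] s]) (simp add: is_GHD(3)[OF a])
qed

text \<open>\<open>Phi A\<close> and \<open>Theta\<close> carry submodules of type \<tau> to each
  other: in one direction by the hypothesis \<open>W\<close>, in the other because traces vanish on
  them. The real points follow since both maps commute with the inclusion of real tensors.\<close>

lemma real_isotypic_Phi:
  assumes A: "A \<in> signs" and \<tau>: "good_type \<tau>"
    and sub: "tensors.subspace (complexification W)"
    and type: "\<And>b. b \<in> complexification W \<Longrightarrow> is_GH_type A b"
    and W: "\<And>S. sp_module g I J K S \<Longrightarrow> \<tau> S \<Longrightarrow> S \<subseteq> {b. is_GH_type A b} \<Longrightarrow> S \<subseteq> complexification W"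
  shows "real_isotypic_component g I J K \<tau> W = Phi A ` real_isotypic_component g I J K \<tau> (TL20 g I J K)"
proof -
  have V1: "no_hom \<tau> V1" and inv: "\<And>S f. sp_module g I J K S \<Longrightarrow> \<tau> S \<Longrightarrow> sp_hom S f \<Longrightarrow> inj_on f S \<Longrightarrow>
      sp_module g I J K (f ` S) \<Longrightarrow> \<tau> (f ` S)"
    using \<tau> unfolding good_type_def by blast+
  have tri: "trilinear b" if "is_GH_type A b" for b :: "'v ctensor3"
    using that is_GHD(1) by (auto simp: is_GH_type_def)
  have PS: "Phi A ` S \<subseteq> complexification W"
    if S: "sp_module g I J K S" "\<tau> S" "S \<subseteq> complexification (TL20 g I J K)" for S
  proof -
    have ty: "Phi A ` S \<subseteq> {b. is_GH_type A b}"
      using S(3) Phi_GH[OF _ A] by (auto simp: complexification_eq)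
    have i: "inj_on (Phi A) S"
      using S(3) Theta_Phi[OF _ A] by (intro inj_on_inverseI[of _ Theta]) (auto simp: complexification_eq)
    have m: "sp_module g I J K (Phi A ` S)"
      using ty tri by (intro sp_module_image[OF S(1) sp_hom_Phi[OF A]]) blast
    show ?thesis by (rule W[OF m inv[OF S(1,2) sp_hom_Phi[OF A] i m] ty])
  qed
  have TS: "Theta ` S \<subseteq> complexification (TL20 g I J K)"
    if S: "sp_module g I J K S" "\<tau> S" "S \<subseteq> complexification W" for S
    using no_hom_contraction(1)[OF V1 S(1,2)] S(3) type
    by (auto simp: complexification_eq is_GH_type_def intro!: Theta_TL20)
  show ?thesis
  proof (intro set_eqI iffI)
    fix b assume "b \<in> real_isotypic_component g I J K \<tau> W"
    hence b: "b \<in> W" "of_real3 b \<in> isotypic_component g I J K \<tau> W"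
      by (auto simp: real_isotypic_component_def)
    have ty: "is_GH_type A (of_real3 b)" using b(2) isotypic_subset[OF sub] type by blast
    have "Theta (of_real3 b) \<in> isotypic_component g I J K \<tau> (TL20 g I J K)"
      by (rule isotypic_transfer[where F = Theta and F' = "Phi A", OF inv sp_hom_Theta Theta_linear TS _ _ b(2)])
        (simp_all add: complexification_eq type Phi_Theta A is_TL20D)
    hence m: "of_real3 (Theta b) \<in> isotypic_component g I J K \<tau> (TL20 g I J K)"
      by (simp add: of_real3_commute)
    hence "of_real3 (Theta b) \<in> complexification (TL20 g I J K)"
      using isotypic_subset[of "TL20 g I J K"] is_TL20_subspace by (auto simp: complexification_eq)
    hence "Theta b \<in> TL20 g I J K" by (rule of_real3_complexification)
    with m have "Theta b \<in> real_isotypic_component g I J K \<tau> (TL20 g I J K)"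
      by (simp add: real_isotypic_component_def)
    moreover have "of_real3 (Phi A (Theta b)) = of_real3 b"
      using Phi_Theta[OF ty A] by (simp only: of_real3_commute)
    hence "Phi A (Theta b) = b" by (simp add: fun_eq_iff)
    ultimately show "b \<in> Phi A ` real_isotypic_component g I J K \<tau> (TL20 g I J K)"
      by (metis imageI)
  next
    fix b assume "b \<in> Phi A ` real_isotypic_component g I J K \<tau> (TL20 g I J K)"
    then obtain p where p: "of_real3 p \<in> isotypic_component g I J K \<tau> (TL20 g I J K)" and b: "b = Phi A p"
      by (auto simp: real_isotypic_component_def)
    have "Phi A (of_real3 p) \<in> isotypic_component g I J K \<tau> W"
      by (rule isotypic_transfer[where F = "Phi A" and F' = Theta, OF inv sp_hom_Phi[OF A] Phi_linear PS _ _ p])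
        (simp_all add: complexification_eq type tri Theta_Phi A)
    hence m: "of_real3 b \<in> isotypic_component g I J K \<tau> W" by (simp only: of_real3_commute b)
    hence "of_real3 b \<in> complexification W" using isotypic_subset[OF sub] by blast
    hence "b \<in> W" by (rule of_real3_complexification)
    with m show "b \<in> real_isotypic_component g I J K \<tau> W"
      by (simp add: real_isotypic_component_def)
  qed
qed

section \<open>The spaces W1, W2, W3 inside W1 + W2 and W3 + W4\<close>

lemma subspace_restrict:
  fixes S :: "('v \<Rightarrow> 'v \<Rightarrow> 'v \<Rightarrow> 'a::field) set"
  assumes "tensors.subspace S" and "P 0"
    and "\<And>a b. a \<in> S \<Longrightarrow> b \<in> S \<Longrightarrow> P a \<Longrightarrow> P b \<Longrightarrow> P (a + b)" and "\<And>r a. a \<in> S \<Longrightarrow> P a \<Longrightarrow> P (tscale r a)"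
  shows "tensors.subspace {b \<in> S. P b}"
  using assms(2-4) tensors.subspace_0[OF assms(1)] tensors.subspace_add[OF assms(1)]
    tensors.subspace_scale[OF assms(1)]
  by (intro tensors.subspaceI) auto

lemma is_GHi_subspace:
  shows "tensors.subspace {b :: 'v \<Rightarrow> 'v \<Rightarrow> 'v \<Rightarrow> 'a::real_normed_field. is_GH1 b}"
    "tensors.subspace {b :: 'v \<Rightarrow> 'v \<Rightarrow> 'v \<Rightarrow> 'a. is_GH2 b}"
    "tensors.subspace {b :: 'v \<Rightarrow> 'v \<Rightarrow> 'v \<Rightarrow> 'a. is_GH3 b}"
proof -
  let ?S = "{b :: 'v \<Rightarrow> 'v \<Rightarrow> 'v \<Rightarrow> 'a. is_GH b}"
  have "tensors.subspace {b \<in> ?S. \<forall>X Z. b X X Z = 0}"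
    by (rule subspace_restrict[OF is_GH_subspace]) simp_all
  thus "tensors.subspace {b :: 'v \<Rightarrow> 'v \<Rightarrow> 'v \<Rightarrow> 'a. is_GH1 b}"
    by (simp add: is_GH1_def)
  have "tensors.subspace {b \<in> ?S. \<forall>X Y Z. b X Y Z + b Y Z X + b Z X Y = 0}"
  proof (rule subspace_restrict[OF is_GH_subspace]; (intro allI)?)
    fix a b :: "'v \<Rightarrow> 'v \<Rightarrow> 'v \<Rightarrow> 'a" and X Y Z
    assume *: "\<forall>X Y Z. a X Y Z + a Y Z X + a Z X Y = 0" "\<forall>X Y Z. b X Y Z + b Y Z X + b Z X Y = 0"
    have "(a + b) X Y Z + (a + b) Y Z X + (a + b) Z X Y
        = (a X Y Z + a Y Z X + a Z X Y) + (b X Y Z + b Y Z X + b Z X Y)" by (simp add: add_ac)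
    also have "\<dots> = 0" by (simp only: *) simp
    finally show "(a + b) X Y Z + (a + b) Y Z X + (a + b) Z X Y = 0" .
  next
    fix r and a :: "'v \<Rightarrow> 'v \<Rightarrow> 'v \<Rightarrow> 'a" and X Y Z
    assume *: "\<forall>X Y Z. a X Y Z + a Y Z X + a Z X Y = 0"
    have "tscale r a X Y Z + tscale r a Y Z X + tscale r a Z X Y = r * (a X Y Z + a Y Z X + a Z X Y)"
      by (simp add: algebra_simps)
    also have "\<dots> = 0" by (simp only: *) simp
    finally show "tscale r a X Y Z + tscale r a Y Z X + tscale r a Z X Y = 0" .
  qed simp
  thus "tensors.subspace {b :: 'v \<Rightarrow> 'v \<Rightarrow> 'v \<Rightarrow> 'a. is_GH2 b}"
    by (simp add: is_GH2_def)
  have "tensors.subspace {b \<in> ?S. (\<forall>X Y Z. b (I X) (I Y) Z = b X Y Z) \<and> (\<forall>Z. basis_sum g (\<lambda>e. b e e Z) = 0)}"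
    by (rule subspace_restrict[OF is_GH_subspace]) (simp_all add: basis_sum_0 basis_sum_add basis_sum_mult)
  thus "tensors.subspace {b :: 'v \<Rightarrow> 'v \<Rightarrow> 'v \<Rightarrow> 'a. is_GH3 b}"
    by (simp add: is_GH3_def)
qed

text \<open>The tensor is alternating, so the condition on the last two arguments carries over to
  the first two.\<close>

lemma is_GH1_type:
  assumes "is_GH1 b"
  shows "is_GH_type I b"
proof -
  have G: "is_GH b" and d: "\<And>X Z. b X X Z = 0" using assms by (auto simp: is_GH1_def)
  note t = trilinear_simps[OF is_GHD(1)[OF G]]
  have s: "b Y X Z = - b X Y Z" for X Y Z
  proof -
    have "b Y X Z + b X Y Z = 0" using d[of "X + Y" Z] d[of X Z] d[of Y Z] by (simp add: t add.commute)
    thus ?thesis by (simp only: eq_neg_iff_add_eq_0)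
  qed
  have "b (I X) (I Y) Z = - b X Y Z" for X Y Z
  proof -
    have "b (I X) (I Y) Z = - b (I X) Z (I Y)" by (rule is_GHD(2)[OF G])
    also have "\<dots> = b Z (I X) (I Y)" using s[of Z "I X" "I Y"] by simp
    also have "\<dots> = - b Z X Y" by (simp add: is_GHD(3)[OF G] IJK_simps t)
    also have "\<dots> = b X Z Y" using s[of X Z Y] by simp
    also have "\<dots> = - b X Y Z" by (rule is_GHD(2)[OF G])
    finally show ?thesis .
  qed
  thus ?thesis using G by (simp add: is_GH_type_def)
qed

text \<open>\<open>b (I X) (I Y) Z + b X Y Z\<close> is symmetric in \<open>X, Y\<close> by the cyclic identities for \<open>(Z, X, Y)\<close> and
  \<open>(Z, I X, I Y)\<close>, and alternating in \<open>Y, Z\<close>.\<close>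

lemma is_GH2_type:
  assumes "is_GH2 (b :: 'v \<Rightarrow> 'v \<Rightarrow> 'v \<Rightarrow> 'a::real_normed_field)"
  shows "is_GH_type I b"
proof -
  have G: "is_GH b" and cyc: "\<And>X Y Z. b X Y Z + b Y Z X + b Z X Y = 0" using assms by (auto simp: is_GH2_def)
  note t = trilinear_simps[OF is_GHD(1)[OF G]]
  note sk = is_GHD(2)[OF G]
  define c where "c X Y Z = b (I X) (I Y) Z + b X Y Z" for X Y Z
  have s23: "c X Z Y = - c X Y Z" for X Y Z
    using sk[where X=X and Y=Y and Z=Z] sk[where X="I X" and Y=Y and Z="I Z"]
    by (simp add: c_def is_GHD(3)[OF G])
  have s12: "c Y X Z = c X Y Z" for X Y Z
  proof -
    have "b Z (I X) (I Y) + b (I X) (I Y) Z + b (I Y) Z (I X) = 0" "b Z X Y + b X Y Z + b Y Z X = 0" by (rule cyc)+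
    moreover have "b Z (I X) (I Y) = - b Z X Y" by (simp add: is_GHD(3)[OF G] IJK_simps t)
    moreover have "b (I Y) Z (I X) = - b (I Y) (I X) Z" "b Y Z X = - b Y X Z" by (rule sk)+
    ultimately have "c X Y Z - c Y X Z = 0" by (simp add: c_def algebra_simps)
    thus ?thesis by simp
  qed
  have c0: "c X Y Z = 0" for X Y Z
  proof -
    have "c X Y Z = - c X Z Y" by (rule s23)
    also have "c X Z Y = c Z X Y" by (rule s12)
    also have "c Z X Y = - c Z Y X" by (rule s23)
    also have "c Z Y X = c Y Z X" by (rule s12)
    also have "c Y Z X = - c Y X Z" by (rule s23)
    also have "c Y X Z = c X Y Z" by (rule s12)
    finally show ?thesis by simp
  qed
  have "b (I X) (I Y) Z = - b X Y Z" for X Y Z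
    unfolding eq_neg_iff_add_eq_0 using c0[of X Y Z] by (simp only: c_def)
  thus ?thesis using G by (simp add: is_GH_type_def)
qed

lemma is_GH3_type: "is_GH3 b \<Longrightarrow> is_GH_type (\<lambda>X. - I X) b"
  by (auto simp: is_GH3_def is_GH_type_def trilinear_simps[OF is_GHD(1)])

lemma is_GH_typeD:
  assumes "is_GH_type I b"
  shows "is_GH b" "b (I X) Y Z = b X (I Y) Z"
proof -
  show G: "is_GH b" using assms by (simp add: is_GH_type_def)
  have "b (I X) (I (- I Y)) Z = - b X (- I Y) Z" using assms by (simp add: is_GH_type_def)
  thus "b (I X) Y Z = b X (I Y) Z" by (simp add: IJK_simps trilinear_simps[OF is_GHD(1)[OF G]])
qed

text \<open>On W1 + W2 a third of it is the projection to W1 with kernel W2.\<close>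

definition cyclic_sum :: "'v ctensor3 \<Rightarrow> 'v ctensor3" where
  "cyclic_sum b = (\<lambda>X Y Z. b X Y Z + b Y Z X + b Z X Y)"

lemma cyclic_sum_hom: "sp_hom S cyclic_sum" "sp_hom S (\<lambda>b. b - tscale (1/3) (cyclic_sum b))"
  by (intro sp_hom_pointwise; simp add: cyclic_sum_def act_def algebra_simps)+

text \<open>A cyclic sum of a tensor skew in two arguments is alternating, and on this type
  \<open>I\<close> may be moved from any argument to any other.\<close>

lemma cyclic_sum_Vskew:
  assumes "is_GH_type I b"
  shows "cyclic_sum b \<in> Vskew"
proof -
  note G = is_GHD[OF is_GH_typeD(1)[OF assms]]
  have s: "cyclic_sum b Y X Z = - cyclic_sum b X Y Z" "cyclic_sum b X Z Y = - cyclic_sum b X Y Z"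
    "cyclic_sum b (I X) Y Z = cyclic_sum b X (I Y) Z" for X Y Z
    using G(2)[where X=X and Y=Y and Z=Z] G(2)[where X=Y and Y=Z and Z=X] G(2)[where X=Z and Y=X and Z=Y]
    by (simp_all add: cyclic_sum_def is_GH_typeD(2)[OF assms] G(3))
  have "trilinear (cyclic_sum b)"
    unfolding cyclic_sum_def 
    by (rule trilinear_add[OF trilinear_add[OF G(1) trilinear_perm(3)[OF G(1)]] trilinear_perm(4)[OF G(1)]])
  thus ?thesis unfolding Vskew_def using s by blast
qed

lemma cyclic_sum_Vcyc:
  assumes "is_GH_type I b"
  shows "b - tscale (1/3) (cyclic_sum b) \<in> Vcyc"
proof -
  note G = is_GHD[OF is_GH_typeD(1)[OF assms]]
  let ?c = "b - tscale (1/3) (cyclic_sum b)"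
  have "cyclic_sum b \<in> Vskew" by (rule cyclic_sum_Vskew[OF assms])
  hence s: "cyclic_sum b X Z Y = - cyclic_sum b X Y Z" "cyclic_sum b (I X) Y Z = cyclic_sum b X (I Y) Z"
    "trilinear (cyclic_sum b)" for X Y Z
    unfolding Vskew_def by blast+
  have "?c X Z Y = - ?c X Y Z" for X Y Z
    by (simp only: fun_diff_def tscale_apply G(2)[where X=X and Y=Y and Z=Z] s(1)[of X Z Y]) simp
  moreover have "?c (I X) Y Z = ?c X (I Y) Z" for X Y Z
    by (simp add: is_GH_typeD(2)[OF assms] s(2))
  moreover have "?c X Y Z + ?c Y Z X + ?c Z X Y = 0" for X Y Z
    by (simp add: cyclic_sum_def field_simps)
  moreover have "trilinear ?c" by (intro trilinear_minus trilinear_tscale G(1) s(3))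
  ultimately show ?thesis unfolding Vcyc_def by blast
qed

context
  fixes N assumes dim: "DIM('v) = 4 * N" "N \<ge> 2"
begin

lemma good_type_3: "good_type (type_3 g I J K)"
  unfolding good_type_def
proof (intro conjI allI impI)
  show "no_hom (type_3 g I J K) V1" by (rule type_3_no_hom[OF dim V1_wedge_symmetric_zero])
qed (rule type_3_image)

lemma good_type_K: "good_type (type_K g I J K)"
  unfolding good_type_def
proof (intro conjI allI impI)
  show "no_hom (type_K g I J K) V1" using dim by (intro type_K_no_hom[OF _ V1_eigen_zero]) auto
qed (rule type_K_image)

text \<open>On such a module the part in \<open>Vcyc\<close> vanishes, so each element is a third of
  its cyclic sum and hence alternating.\<close>

lemma real_isotypic_3_GH1:
  "real_isotypic_component g I J K (type_3 g I J K) (GH1 I)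
    = Phi I ` real_isotypic_component g I J K (type_3 g I J K) (TL20 g I J K)"
proof (rule real_isotypic_Phi[OF _ good_type_3])
  fix S assume S: "sp_module g I J K S" "type_3 g I J K S" and ty: "S \<subseteq> {b. is_GH_type I b}"
  have n: "no_hom (type_3 g I J K) Vcyc"
    by (rule type_3_no_hom[OF dim Vcyc_wedge_symmetric_zero])
  show "S \<subseteq> complexification (GH1 I)"
    unfolding complexification_eq
  proof
    fix b assume b: "b \<in> S"
    have "(\<lambda>b. b - tscale (1/3) (cyclic_sum b)) ` S \<subseteq> Vcyc" using cyclic_sum_Vcyc ty by blast
    hence "b - tscale (1/3) (cyclic_sum b) = 0"
      using n[unfolded no_hom_def, rule_format, OF S cyclic_sum_hom(2)] b by simp
    hence c: "b X Y Z = (1/3) * cyclic_sum b X Y Z" for X Y Z by (simp add: fun_eq_iff)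
    have T: "is_GH_type I b" using b ty by blast
    note sk = is_GHD(2)[OF is_GH_typeD(1)[OF T]]
    have "cyclic_sum b X X Z = 0" for X Z
      using sk[where X=X and Y=X and Z=Z] sk[where X=Z and Y=X and Z=X] by (simp add: cyclic_sum_def)
    hence "b X X Z = 0" for X Z by (simp only: c) simp
    thus "b \<in> {b. is_GH1 b}" using is_GH_typeD(1)[OF T] by (simp add: is_GH1_def)
  qed
qed (simp_all add: signs_def complexification_eq is_GHi_subspace is_GH1_type)

lemma real_isotypic_K_GH2:
  "real_isotypic_component g I J K (type_K g I J K) (GH2 I)
    = Phi I ` real_isotypic_component g I J K (type_K g I J K) (TL20 g I J K)"
proof (rule real_isotypic_Phi[OF _ good_type_K])
  fix S assume S: "sp_module g I J K S" "type_K g I J K S" and ty: "S \<subseteq> {b. is_GH_type I b}"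
  have n: "no_hom (type_K g I J K) Vskew"
    using dim by (intro type_K_no_hom[OF _ Vskew_eigen_zero]) auto
  show "S \<subseteq> complexification (GH2 I)"
    unfolding complexification_eq
  proof
    fix b assume b: "b \<in> S"
    have "cyclic_sum ` S \<subseteq> Vskew" using cyclic_sum_Vskew ty by blast
    hence "cyclic_sum b = 0"
      using n[unfolded no_hom_def, rule_format, OF S cyclic_sum_hom(1)] b by simp
    moreover have "is_GH b" using b ty is_GH_typeD(1) by blast
    ultimately show "b \<in> {b. is_GH2 b}" by (simp add: is_GH2_def cyclic_sum_def fun_eq_iff)
  qed
qed (simp_all add: signs_def complexification_eq is_GHi_subspace is_GH2_type)

text \<open>Beyond its type, W3 only asks for a vanishing contraction, which holds on every module
  without homomorphisms to one-forms.\<close>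

lemma real_isotypic_GH3:
  assumes "good_type \<tau>"
  shows "real_isotypic_component g I J K \<tau> (GH3 g I)
    = Phi (\<lambda>X. - I X) ` real_isotypic_component g I J K \<tau> (TL20 g I J K)"
proof (rule real_isotypic_Phi[OF _ assms])
  fix S assume S: "sp_module g I J K S" "\<tau> S" and ty: "S \<subseteq> {b. is_GH_type (\<lambda>X. - I X) b}"
  have n: "no_hom \<tau> V1" using assms by (simp add: good_type_def)
  show "S \<subseteq> complexification (GH3 g I)"
    unfolding complexification_eq
  proof
    fix b assume b: "b \<in> S"
    have "is_GH_type (\<lambda>X. - I X) b" using b ty by blast
    hence "is_GH b" "b (- I X) (I Y) Z = - b X Y Z" for X Y Z by (simp_all add: is_GH_type_def)
    hence "is_GH b" "b (I X) (I Y) Z = b X Y Z" for X Y Z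
      by (simp_all add: trilinear_simps[OF is_GHD(1)])
    thus "b \<in> {b. is_GH3 b}"
      using no_hom_contraction(2)[OF n S b] by (simp add: is_GH3_def)
  qed
qed (simp_all add: signs_def complexification_eq is_GHi_subspace is_GH3_type)

end

end

section \<open>Projections to isotypic components\<close>

context euclidean
begin

lemma inner3_isometry:
  assumes a: "trilinear a" and b: "trilinear b" and P: "linear P" "\<And>X Y. g (P X) (P Y) = g X Y"
  shows "inner3 g (\<lambda>X Y Z. a (P X) Y Z) (\<lambda>X Y Z. b (P X) Y Z) = inner3 g a b"
    "inner3 g (\<lambda>X Y Z. a X (P Y) Z) (\<lambda>X Y Z. b X (P Y) Z) = inner3 g a b"
proof -
  have "bilinear (\<lambda>X X'. basis_sum g (\<lambda>Y. basis_sum g (\<lambda>Z. a X Y Z * b X' Y Z)))"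
    unfolding bilinear_def
    by (intro conjI allI linear_on_basis_sum)
      (auto intro!: linearI simp: trilinear_simps[OF a] trilinear_simps[OF b] algebra_simps)
  from basis_sum_isometry[OF P this]
  show "inner3 g (\<lambda>X Y Z. a (P X) Y Z) (\<lambda>X Y Z. b (P X) Y Z) = inner3 g a b"
    by (simp add: inner3_def)
  have "bilinear (\<lambda>Y Y'. basis_sum g (\<lambda>Z. a X Y Z * b X Y' Z))" for X
    unfolding bilinear_def
    by (intro conjI allI linear_on_basis_sum)
      (auto intro!: linearI simp: trilinear_simps[OF a] trilinear_simps[OF b] algebra_simps)
  from basis_sum_isometry[OF P this]
  show "inner3 g (\<lambda>X Y Z. a X (P Y) Z) (\<lambda>X Y Z. b X (P Y) Z) = inner3 g a b"
    by (simp add: inner3_def)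
qed

lemma inner3_neg: "inner3 g (\<lambda>X Y Z. - a X Y Z) b = - inner3 g a b"
  "inner3 g a (\<lambda>X Y Z. - b X Y Z) = - inner3 g a b"
  by (simp_all add: inner3_def basis_sum_neg)

lemma inner3_anti_isometry:
  assumes a: "trilinear a" and b: "trilinear b" and P: "linear P" "\<And>X Y. g (P X) (P Y) = g X Y"
    and PP: "\<And>X. P (P X) = - X"
  shows "inner3 g (\<lambda>X Y Z. a (P X) Y Z) b = - inner3 g a (\<lambda>X Y Z. b (P X) Y Z)"
    "inner3 g (\<lambda>X Y Z. a X (P Y) Z) b = - inner3 g a (\<lambda>X Y Z. b X (P Y) Z)"
proof -
  have "trilinear (\<lambda>X Y Z. b (P X) Y Z)" "trilinear (\<lambda>X Y Z. b X (P Y) Z)"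
    using b P(1) by (auto intro: trilinear_compose linear_ident)
  from inner3_isometry(1)[OF a this(1) P] inner3_isometry(2)[OF a this(2) P]
  show "inner3 g (\<lambda>X Y Z. a (P X) Y Z) b = - inner3 g a (\<lambda>X Y Z. b (P X) Y Z)"
    "inner3 g (\<lambda>X Y Z. a X (P Y) Z) b = - inner3 g a (\<lambda>X Y Z. b X (P Y) Z)"
    by (simp_all add: PP trilinear_simps[OF b] inner3_neg)
qed

lemma inner3_swap23: "inner3 g (\<lambda>X Y Z. a X Z Y) (\<lambda>X Y Z. b X Z Y) = inner3 g a b"
  unfolding inner3_def by (subst basis_sum_swap) (rule refl)

lemma inner3_trace:
  assumes s: "trilinear s" "\<And>X. basis_sum g (\<lambda>e. s X e e) = 0"
  shows "inner3 g (\<lambda>X Y Z. l X * g Y Z) s = 0"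
proof -
  have "basis_sum g (\<lambda>Z. g Y Z * s X Y Z) = s X Y Y" for X Y
    using basis_sum_g_contract[OF trilinear_linear(3)[OF s(1)], of Y X Y] by simp
  thus ?thesis
    by (simp add: inner3_def mult.assoc basis_sum_mult s(2) basis_sum_0)
qed

end

context qh
begin

lemma linear_K_isometry: "linear K" "g (K X) (K Y) = g X Y" "K (K X) = - X"
  by (simp_all add: linear_IJK g_IJK qsimps)

text \<open>The term with \<open>l\<close> is orthogonal to trace-free tensors. As \<Omega> is skew
  and \<open>s\<close> symmetric in the last two arguments, \<open>slot2\<close> and
  \<open>- slot3\<close> contribute equally, and \<open>Q\<close> is skew-adjoint.\<close>

lemma inner3_alpha:
  assumes \<Omega>: "trilinear \<Omega>" "\<And>X Y Z. \<Omega> X Z Y = - \<Omega> X Y Z" and s: "is_TL20 s"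
    and Q: "linear Q" "\<And>X Y. g (Q X) (Q Y) = g X Y" "\<And>X. Q (Q X) = - X"
  shows "inner3 g (- (\<lambda>X Y Z. l X * g Y Z) + tscale (1/2) (slot2 Q \<Omega> - slot3 Q \<Omega>)) s
    = inner3 g \<Omega> (\<lambda>X Y Z. s X (Q Y) Z)"
proof -
  note s' = is_TL20D(1,2,5)[OF s]
  define N where "N = inner3 g (\<lambda>X Y Z. \<Omega> X (Q Y) Z) s"
  have sw: "(\<lambda>X Y Z. s X Z Y) = s" by (intro ext) (rule s'(2))
  have "slot2 Q \<Omega> = (\<lambda>X Y Z. - \<Omega> X (Q Y) Z)" by (simp add: slot2_def)
  hence 2: "inner3 g (slot2 Q \<Omega>) s = - N" by (simp add: inner3_neg N_def)
  have "slot3 Q \<Omega> X Y Z = \<Omega> X (Q Z) Y" for X Y Z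
    unfolding slot3_def by (rule \<Omega>(2)[symmetric])
  hence "slot3 Q \<Omega> = (\<lambda>X Y Z. \<Omega> X (Q Z) Y)" by (intro ext)
  hence 3: "inner3 g (slot3 Q \<Omega>) s = N"
    using inner3_swap23[of "\<lambda>X Y Z. \<Omega> X (Q Y) Z" s] by (simp add: N_def sw)
  have 1: "inner3 g (\<lambda>X Y Z. l X * g Y Z) s = 0"
    by (rule inner3_trace[OF s'(1,3)])
  have "N = - inner3 g \<Omega> (\<lambda>X Y Z. s X (Q Y) Z)"
    unfolding N_def by (rule inner3_anti_isometry(2)[OF \<Omega>(1) s'(1) Q])
  thus ?thesis by (simp add: inner3_add inner3_tscale inner3_diff 1 2 3)
qed

lemma trilinear_slots:
  assumes "trilinear p" "A \<in> signs"
  shows "trilinear (\<lambda>X Y Z. p (A X) Y Z)" "trilinear (\<lambda>X Y Z. p X (I Y) Z)" "trilinear (\<lambda>X Y Z. p X (J Y) Z)"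
    "trilinear (\<lambda>X Y Z. p X (K Y) Z)" "trilinear (\<lambda>X Y Z. p (A X) (K Y) Z)" "trilinear (\<lambda>X Y Z. p (A X) (I Y) Z)"
  using assms(1) linear_IJK signsD(1)[OF assms(2)] by (auto intro: trilinear_compose linear_ident)

text \<open>Both summands of \<open>Phi\<close> are isometric. The mixed products vanish: moving
  \<open>J\<close> across leaves the symmetric \<open>p\<close> paired with
  \<open>t (A X) (I Y) Z\<close>, which is skew in \<open>Y, Z\<close>.\<close>

lemma inner3_Phi:
  assumes p: "is_TL20 p" and t: "is_TL20 t" and A: "A \<in> signs"
  shows "inner3 g (Phi A p) (Phi A t) = 2 * inner3 g p t"
proof -
  note p' = is_TL20D(1)[OF p] and t' = is_TL20D(1)[OF t]
  have cross: "inner3 g (\<lambda>X Y Z. p X (J Y) Z) (\<lambda>X Y Z. t (A X) (K Y) Z) = 0"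
    if p: "is_TL20 p" and t: "is_TL20 t" for p t
  proof -
    note p' = is_TL20D(1)[OF p] and t' = is_TL20D(1)[OF t]
    define N where "N = inner3 g p (\<lambda>X Y Z. t (A X) (I Y) Z)"
    have "inner3 g (\<lambda>X Y Z. p X (J Y) Z) (\<lambda>X Y Z. t (A X) (K Y) Z) = N"
      using inner3_anti_isometry(2)[OF p' trilinear_slots(5)[OF t' A] linear_IJK(2) g_IJK(2) IJK_simps(2)]
      by (simp add: N_def qsimps trilinear_simps[OF t'] inner3_neg)
    moreover have "N = - N"
    proof -
      have 1: "(\<lambda>X Y Z. p X Z Y) = p" by (intro ext) (rule is_TL20D(2)[OF p])
      have "t (A X) (I Z) Y = - t (A X) (I Y) Z" for X Y Z
        using is_TL20D(2)[OF t, where X="A X" and Y="I Y" and Z=Z] is_TL20D(3)[OF t, where X="A X" and Y=Z and Z=Y]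
        by simp
      hence 2: "(\<lambda>X Y Z. t (A X) (I Z) Y) = (\<lambda>X Y Z. - t (A X) (I Y) Z)" by (intro ext)
      have "N = inner3 g (\<lambda>X Y Z. p X Z Y) (\<lambda>X Y Z. t (A X) (I Z) Y)"
        unfolding N_def by (rule inner3_swap23[symmetric])
      also have "\<dots> = - N" unfolding 1 2 N_def by (rule inner3_neg(2))
      finally show ?thesis .
    qed
    ultimately show ?thesis by simp
  qed
  have Phi: "Phi A p = - ((\<lambda>X Y Z. p X (J Y) Z) + (\<lambda>X Y Z. p (A X) (K Y) Z))" for p :: "'v tensor3"
    by (simp add: Phi_def fun_eq_iff)
  have 1: "inner3 g (\<lambda>X Y Z. p X (J Y) Z) (\<lambda>X Y Z. t X (J Y) Z) = inner3 g p t"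
    by (rule inner3_isometry(2)[OF p' t' linear_IJK(2) g_IJK(2)])
  have 2: "inner3 g (\<lambda>X Y Z. p (A X) (K Y) Z) (\<lambda>X Y Z. t (A X) (K Y) Z) = inner3 g p t"
    using inner3_isometry(2)[OF trilinear_slots(1)[OF p' A] trilinear_slots(1)[OF t' A] linear_K_isometry(1,2)]
      inner3_isometry(1)[OF p' t' signsD(1,4)[OF A]] by simp
  have add2: "inner3 g a (b + c) = inner3 g a b + inner3 g a c" for a b c
    using inner3_add[of b c a] by (simp add: inner3_sym[of a])
  have neg2: "inner3 g (- a) (- b) = inner3 g a b" for a b
    by (simp add: inner3_def)
  show ?thesis
    unfolding Phi neg2 inner3_add add2 1 2 cross[OF p t]
    using cross[OF t p] by (simp add: inner3_sym[of "\<lambda>X Y Z. p (A X) (K Y) Z"])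
qed

lemma TL20_tri: "TL20 g I J K \<subseteq> {b. trilinear b}"
  using is_TL20D(1) by (auto simp: TL20_eq)

lemma real_isotypic_subspace:
  assumes "tensors.subspace W"
  shows "tensors.subspace (real_isotypic_component g I J K \<tau> W)"
  unfolding real_isotypic_component_def
proof (rule subspace_restrict[OF assms])
  let ?C = "isotypic_component g I J K \<tau> W"
  have sub: "tensors.subspace ?C" unfolding isotypic_component_def by simp
  show "of_real3 0 \<in> ?C" using tensors.subspace_0[OF sub] by (simp add: zero_fun_def)
  show "of_real3 (a + b) \<in> ?C" if "of_real3 a \<in> ?C" "of_real3 b \<in> ?C" for a b
    using tensors.subspace_add[OF sub that] by (simp add: plus_fun_def)
  show "of_real3 (tscale r a) \<in> ?C" if "of_real3 a \<in> ?C" for r a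
    using tensors.subspace_scale[OF sub that, of "of_real r"] by (simp add: tscale_def)
qed

text \<open>Rotating the first argument commutes with Sp(n) and is invertible, so it preserves the
  component.\<close>

lemma real_isotypic_slot1:
  assumes A: "A \<in> signs" and \<tau>: "good_type \<tau>" and b: "b \<in> real_isotypic_component g I J K \<tau> (TL20 g I J K)"
  shows "(\<lambda>X Y Z. b (A X) Y Z) \<in> real_isotypic_component g I J K \<tau> (TL20 g I J K)"
proof -
  let ?F = "\<lambda>b X Y Z. b (A X) Y Z" and ?F' = "\<lambda>b X Y Z. - b (A X) Y Z"
  have inv: "\<And>S f. sp_module g I J K S \<Longrightarrow> \<tau> S \<Longrightarrow> sp_hom S f \<Longrightarrow> inj_on f S \<Longrightarrow>
      sp_module g I J K (f ` S) \<Longrightarrow> \<tau> (f ` S)"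
    using \<tau> unfolding good_type_def by blast
  have T: "is_TL20 (?F c)" if c: "is_TL20 c" for c :: "'v \<Rightarrow> 'v \<Rightarrow> 'v \<Rightarrow> 'a::real_vector"
  proof (rule is_TL20I)
    show "trilinear (?F c)" by (rule trilinear_slots(1)[OF is_TL20D(1)[OF c] A])
  qed (rule is_TL20D[OF c])+
  have "?F (of_real3 b) \<in> isotypic_component g I J K \<tau> (TL20 g I J K)"
  proof (rule isotypic_transfer[where \<tau> = \<tau> and F = ?F and F' = ?F', OF inv])
    show "sp_hom S (?F :: 'v ctensor3 \<Rightarrow> 'v ctensor3)" for S
      using A by (intro sp_hom_pointwise)
        (auto simp: act_def signs_def Sp_D(3)[OF inv_Sp] linear_neg[OF Sp_D(1)[OF inv_Sp]])
    show "of_real3 b \<in> isotypic_component g I J K \<tau> (TL20 g I J K)"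
      using b by (simp add: real_isotypic_component_def)
    show "?F' (?F c) = c" if "c \<in> complexification (TL20 g I J K)" for c
      using that by (auto simp: complexification_eq signsD[OF A] fun_eq_iff trilinear_simps[OF is_TL20D(1)])
  qed (auto simp: fun_eq_iff complexification_eq T is_TL20D(1))
  moreover have "?F b \<in> TL20 g I J K"
    using b T by (auto simp: real_isotypic_component_def TL20_eq)
  ultimately show ?thesis by (simp add: real_isotypic_component_def)
qed

text \<open>Pairing \<Omega> with \<open>Phi A t\<close> gives \<open>aK\<close> paired with
  \<open>t\<close> minus \<open>aJ\<close> paired with the rotated \<open>t\<close>. The rotation is
  skew-adjoint and moves to \<open>aJ\<close> with a change of sign; the factor 1/2 compensates the
  2 of \<open>inner3_Phi\<close>.\<close>

lemma orth_proj_component: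
  fixes \<tau>
  defines "R \<equiv> real_isotypic_component g I J K \<tau> (TL20 g I J K)"
  assumes A: "A \<in> signs" and \<tau>: "good_type \<tau>"
    and W: "tensors.subspace W" "W \<subseteq> {b. trilinear b}" "real_isotypic_component g I J K \<tau> W = Phi A ` R"
    and \<Omega>: "trilinear \<Omega>"
    and aJ: "\<And>s. is_TL20 s \<Longrightarrow> inner3 g aJ s = inner3 g \<Omega> (\<lambda>X Y Z. s X (K Y) Z)"
    and aK: "\<And>s. is_TL20 s \<Longrightarrow> inner3 g aK s = - inner3 g \<Omega> (\<lambda>X Y Z. s X (J Y) Z)"
  shows "orth_proj g (real_isotypic_component g I J K \<tau> W) (orth_proj g W \<Omega>)
    = Phi A (tscale (1/2) (orth_proj g R aK + (\<lambda>X Y Z. orth_proj g R aJ (A X) Y Z)))" (is "_ = Phi A ?p")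
proof -
  let ?S = "real_isotypic_component g I J K \<tau> W"
  have subT: "tensors.subspace (TL20 g I J K)" by (simp add: TL20_eq is_TL20_subspace)
  have R: "tensors.subspace R" unfolding R_def by (rule real_isotypic_subspace[OF subT])
  have RT: "is_TL20 t" if "t \<in> R" for t
    using that by (simp add: R_def real_isotypic_component_def TL20_eq)
  have Rt: "R \<subseteq> {b. trilinear b}" using RT is_TL20D(1) by blast
  have S: "tensors.subspace ?S" by (rule real_isotypic_subspace[OF W(1)])
  have SW: "?S \<subseteq> W" by (auto simp: real_isotypic_component_def)
  note J = orth_proj_mem[OF R Rt, where b = aJ] and Kp = orth_proj_mem[OF R Rt, where b = aK]
  have slot: "(\<lambda>X Y Z. t (A X) Y Z) \<in> R" if "t \<in> R" for t
    using that unfolding R_def by (rule real_isotypic_slot1[OF A \<tau>])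
  have p: "?p \<in> R"
    by (intro tensors.subspace_scale[OF R] tensors.subspace_add[OF R] Kp(1) slot J(1))
  show ?thesis
  proof (rule orth_proj_unique[OF S order_trans[OF SW W(2)]])
    show "Phi A ?p \<in> ?S" unfolding W(3) using p by (rule imageI)
    fix u assume u: "u \<in> ?S"
    then obtain t where t: "t \<in> R" and ut: "u = Phi A t" unfolding W(3) by blast
    note t' = is_TL20D(1)[OF RT[OF t]]
    have "inner3 g (orth_proj g W \<Omega>) u = inner3 g \<Omega> u"
      using u SW by (intro orth_proj_mem(2)[OF W(1,2)]) blast
    also have "\<dots> = - inner3 g \<Omega> (\<lambda>X Y Z. t X (J Y) Z) - inner3 g \<Omega> (\<lambda>X Y Z. t (A X) (K Y) Z)"
    proof -
      have "u = (\<lambda>X Y Z. - t X (J Y) Z) - (\<lambda>X Y Z. t (A X) (K Y) Z)"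
        by (simp add: ut Phi_def fun_eq_iff)
      thus ?thesis
        using inner3_diff[of "\<lambda>X Y Z. - t X (J Y) Z" "\<lambda>X Y Z. t (A X) (K Y) Z" \<Omega>]
        by (simp add: inner3_sym[of \<Omega>] inner3_neg)
    qed
    also have "\<dots> = inner3 g aK t - inner3 g aJ (\<lambda>X Y Z. t (A X) Y Z)"
      using aK[OF RT[OF t]] aJ[OF RT[OF slot[OF t]]] by simp
    also have "\<dots> = inner3 g (orth_proj g R aK) t - inner3 g (orth_proj g R aJ) (\<lambda>X Y Z. t (A X) Y Z)"
      using Kp(2)[OF t] J(2)[OF slot[OF t]] by simp
    also have "\<dots> = inner3 g (orth_proj g R aK + (\<lambda>X Y Z. orth_proj g R aJ (A X) Y Z)) t"
      using inner3_anti_isometry(1)[OF is_TL20D(1)[OF RT[OF J(1)]] t' signsD(1,4,2)[OF A]]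
      by (simp add: inner3_add)
    also have "\<dots> = 2 * inner3 g ?p t" by (simp add: inner3_tscale)
    also have "\<dots> = inner3 g (Phi A ?p) u"
      unfolding ut by (rule inner3_Phi[OF RT[OF p] RT[OF t] A, symmetric])
    finally show "inner3 g (orth_proj g W \<Omega> - Phi A ?p) u = 0" by (simp add: inner3_diff)
  qed
qed

end

text \<open>For s = J_(1) q - K_(1) p one has s(K X) = - (p(X) + q(I X)) and s(J X) = q(X) - p(I X),
  so with \<epsilon> = 1 this is \<open>Phi I\<close> applied to half of p + q(I .). With a plus
  sign in s, \<epsilon> = - 1 does the same for the sign - I.\<close>

definition component_map :: "real \<Rightarrow> 'v::euclidean_space qh_map" where
  "component_map \<epsilon> g I J K s = (\<lambda>X Y Z. (\<epsilon> * s (K X) (J Y) Z + s (J X) (K Y) Z) / 2)"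

context qh
begin

lemma component_map_Phi:
  assumes p: "is_TL20 p" and q: "is_TL20 q"
  shows "component_map 1 g I J K (slot1 J q - slot1 K p) = Phi I (tscale (1/2) (p + (\<lambda>X Y Z. q (I X) Y Z)))"
    "component_map (- 1) g I J K (slot1 J q + slot1 K p)
      = Phi (\<lambda>X. - I X) (tscale (1/2) (p + (\<lambda>X Y Z. q (- I X) Y Z)))"
  by (simp_all add: component_map_def Phi_def slot1_def fun_eq_iff qsimps
      trilinear_simps[OF is_TL20D(1)[OF p]] trilinear_simps[OF is_TL20D(1)[OF q]] field_simps)

text \<open>For a difference \<open>d\<close> in the kernel,
  \<open>\<epsilon> * d (K X) Y Z = d (J X) Y (I Z)\<close>. The left side is symmetric and the
  right side skew in \<open>Y, Z\<close>, so both vanish.\<close>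

lemma component_map_inj:
  assumes \<epsilon>: "\<epsilon> \<noteq> 0" and s: "is_TL20 s" and t: "is_TL20 t"
    and eq: "component_map \<epsilon> g I J K s = component_map \<epsilon> g I J K t"
  shows "s = t"
proof -
  define d where "d = s - t"
  have "s \<in> {b. is_TL20 b}" "t \<in> {b. is_TL20 b}" using s t by simp_all
  hence d: "is_TL20 d" using tensors.subspace_diff[OF is_TL20_subspace] unfolding d_def by blast
  note t = trilinear_simps[OF is_TL20D(1)[OF d]]
  have e: "\<epsilon> * d (K X) (J Y) Z + d (J X) (K Y) Z = 0" for X Y Z
    using fun_cong[OF fun_cong[OF fun_cong[OF eq]], of X Y Z]
    by (simp add: component_map_def d_def algebra_simps)
  have e': "\<epsilon> * d (K X) Y Z = d (J X) Y (I Z)" for X Y Z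
    using e[of X "- J Y" Z] by (simp add: qsimps t is_TL20D(3)[OF d])
  have "d (K X) Y Z = 0" for X Y Z
  proof -
    have "d (J X) Z (I Y) = - d (J X) (I Z) Y" by (rule is_TL20D(3)[OF d])
    also have "\<dots> = - d (J X) Y (I Z)" by (simp add: is_TL20D(2)[OF d, where Y = Y])
    finally have "\<epsilon> * d (K X) Z Y = - (\<epsilon> * d (K X) Y Z)" by (simp add: e')
    thus ?thesis using \<epsilon> is_TL20D(2)[OF d, where X = "K X" and Y = Y and Z = Z] by simp
  qed
  hence "d (K (- K X)) Y Z = 0" for X Y Z by blast
  hence "d = 0" by (simp add: qsimps fun_eq_iff)
  thus ?thesis by (simp add: d_def)
qed

end

lemma component_map_natural:
  assumes "\<epsilon> \<noteq> 0"
  shows "injective_natural_map (component_map \<epsilon> :: 'v::euclidean_space qh_map)"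
  unfolding injective_natural_map_def
proof (intro allI impI)
  fix g :: "'v form2" and I J K
  assume q: "quaternion_hermitian g I J K"
  interpret qh g I J K
  proof unfold_locales
    show "euclidean_form g" using q unfolding quaternion_hermitian_def by blast
  qed (rule q)
  let ?L = "component_map \<epsilon>"
  have tri: "trilinear (?L g I J K s)" if "s \<in> TL20 g I J K" for s
  proof -
    have s: "trilinear s" using that TL20_tri by blast
    have "trilinear (\<lambda>X Y Z. (1/2) *\<^sub>R (\<epsilon> * s (K X) (J Y) Z + s (J X) (K Y) Z))"
      by (intro trilinear_scaleR trilinear_add trilinear_mult)
        (use s linear_IJK in \<open>auto intro: trilinear_compose linear_ident\<close>)
    thus ?thesis by (simp add: component_map_def)
  qed
  have "inj_on (?L g I J K) (TL20 g I J K)"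
    by (rule inj_onI) (auto simp: TL20_eq intro: component_map_inj[OF assms])
  moreover have "?L (pull_form P g) (pull_endo P I) (pull_endo P J) (pull_endo P K) (pull_tensor P s)
      = pull_tensor P (?L g I J K s)" if "bij P" for P s
    using that by (simp add: component_map_def pull_endo_def pull_tensor_def surj_f_inv_f bij_is_surj)
  moreover have "?L g I J K (s + t) = ?L g I J K s + ?L g I J K t"
    "?L g I J K (tscale r s) = tscale r (?L g I J K s)" for r s t
    by (simp_all add: component_map_def fun_eq_iff algebra_simps add_divide_distrib)
  ultimately show "(\<forall>s\<in>TL20 g I J K. trilinear (?L g I J K s)) \<and>
     (\<forall>s\<in>TL20 g I J K. \<forall>t\<in>TL20 g I J K. ?L g I J K (s + t) = ?L g I J K s + ?L g I J K t) \<and>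
     (\<forall>r. \<forall>s\<in>TL20 g I J K. ?L g I J K (tscale r s) = tscale r (?L g I J K s)) \<and>
     inj_on (?L g I J K) (TL20 g I J K) \<and>
     (\<forall>P. linear P \<and> bij P \<longrightarrow> (\<forall>s\<in>TL20 g I J K.
        ?L (pull_form P g) (pull_endo P I) (pull_endo P J) (pull_endo P K) (pull_tensor P s)
          = pull_tensor P (?L g I J K s)))"
    using tri by blast
qed

section \<open>Covariant derivatives in a chart\<close>

lemma bilinear_expand:
  fixes \<beta> :: "'v::euclidean_space \<Rightarrow> 'v \<Rightarrow> real"
  assumes "bilinear \<beta>"
  shows "\<beta> U V = (\<Sum>i\<in>Basis. \<Sum>j\<in>Basis. (U \<bullet> i) * (V \<bullet> j) * \<beta> i j)"
proof -
  have "\<beta> U V = \<beta> (\<Sum>i\<in>Basis. (U \<bullet> i) *\<^sub>R i) (\<Sum>j\<in>Basis. (V \<bullet> j) *\<^sub>R j)"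
    by (simp add: euclidean_representation)
  also have "\<dots> = (\<Sum>(i, j)\<in>Basis \<times> Basis. \<beta> ((U \<bullet> i) *\<^sub>R i) ((V \<bullet> j) *\<^sub>R j))"
    by (rule bilinear_sum[OF assms])
  also have "\<dots> = (\<Sum>i\<in>Basis. \<Sum>j\<in>Basis. (U \<bullet> i) * (V \<bullet> j) * \<beta> i j)"
    by (simp add: sum.cartesian_product' bilinear_lmul[OF assms] bilinear_rmul[OF assms] mult_ac)
  finally show ?thesis .
qed

section \<open>The Levi-Civita connection of a coordinate metric\<close>

locale coordinate_metric =
  fixes h :: "'v::euclidean_space \<Rightarrow> 'v form2" and p :: 'v and S :: "'v set"
  assumes S: "open S" "p \<in> S"
    and euclidean_h: "\<And>q. q \<in> S \<Longrightarrow> euclidean_form (h q)"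
    and diff_h: "\<And>X Y. (\<lambda>q. h q X Y) differentiable at p"
begin

definition D :: "'v \<Rightarrow> 'v \<Rightarrow> 'v \<Rightarrow> real" where
  "D X Y Z = frechet_derivative (\<lambda>q. h q Y Z) (at p) X"

lemma bilinear_h: "q \<in> S \<Longrightarrow> bilinear (h q)" and sym_h: "q \<in> S \<Longrightarrow> h q X Y = h q Y X"
  using euclidean_h unfolding euclidean_form_def by blast+

lemma has_derivative_h: "((\<lambda>q. h q Y Z) has_derivative (\<lambda>X. D X Y Z)) (at p)"
  using diff_h[of Y Z] unfolding D_def frechet_derivative_works by simp

text \<open>An algebraic identity valid at all points of the neighbourhood \<open>S\<close> may be
  differentiated at \<open>p\<close>.\<close>

lemma deriv_unique:
  assumes "(f has_derivative f') (at p)" "(f2 has_derivative f2') (at p)" "\<And>q. q \<in> S \<Longrightarrow> f q = f2 q"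
  shows "f' X = f2' X"
proof -
  have "(f2 has_derivative f') (at p)"
    by (rule has_derivative_transform_within_open[OF assms(1) S]) (rule assms(3))
  thus ?thesis using has_derivative_unique assms(2) by metis
qed

lemma D_sym: "D X Y Z = D X Z Y"
  by (rule deriv_unique[OF has_derivative_h has_derivative_h]) (rule sym_h)

lemma linear_D: "linear (\<lambda>X. D X Y Z)"
  using has_derivative_h has_derivative_linear by blast

lemma bilinear_D: "bilinear (D X)"
proof -
  have r: "linear (D X Y)" for Y
  proof (rule linearI)
    show "D X Y (Z + Z') = D X Y Z + D X Y Z'" for Z Z'
      by (rule deriv_unique[OF has_derivative_h has_derivative_add[OF has_derivative_h has_derivative_h]])
        (rule bilinear_radd[OF bilinear_h])
    show "D X Y (r *\<^sub>R Z) = r *\<^sub>R D X Y Z" for r Z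
      by (rule deriv_unique[OF has_derivative_h has_derivative_scaleR_right[OF has_derivative_h]])
        (rule bilinear_rmul[OF bilinear_h])
  qed
  have "linear (\<lambda>Y. D X Y Z)" for Z using r[of Z] D_sym[of X _ Z] by simp
  with r show ?thesis by (simp add: bilinear_def)
qed

sublocale euclidean "h p"
  using euclidean_h[OF S(2)] by unfold_locales

text \<open>Existence and uniqueness by the Koszul formula: \<open>k\<close> is the value of
  \<open>h p (\<Gamma> X Y) Z\<close> forced by metricity and symmetry, and contraction with an
  orthonormal basis recovers the vector.\<close>

lemma levi_civita:
  shows "bilinear (levi_civita h p)" "D X Y Z = h p (levi_civita h p X Y) Z + h p Y (levi_civita h p X Z)"
proof -
  define k where "k X Y Z = (D X Y Z + D Y X Z - D Z X Y) / 2" for X Y Z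
  define \<Gamma> where "\<Gamma> X Y = basis_sum (h p) (\<lambda>e. k X Y e *\<^sub>R e)" for X Y
  note l = linear_D[THEN linear_add] linear_D[THEN linear_cmul]
    bilinear_ladd[OF bilinear_D] bilinear_radd[OF bilinear_D] bilinear_lmul[OF bilinear_D] bilinear_rmul[OF bilinear_D]
  have k: "linear (k X Y)" "linear (\<lambda>X. k X Y Z)" "linear (\<lambda>Y. k X Y Z)" for X Y Z
    by (auto intro!: linearI simp: k_def l field_simps)
  have \<Gamma>: "h p (\<Gamma> X Y) Z = k X Y Z" for X Y Z
  proof -
    have "h p (\<Gamma> X Y) Z = basis_sum (h p) (\<lambda>e. h p Z e *\<^sub>R k X Y e)"
      unfolding \<Gamma>_def basis_sum_onb g_sum_left by (simp add: g_simps g_sym mult.commute)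
    thus ?thesis using basis_sum_g_contract[OF k(1)] by simp
  qed
  have "bilinear \<Gamma>"
    unfolding bilinear_def \<Gamma>_def
    by (intro conjI allI linear_on_basis_sum)
      (auto intro!: linearI simp: k[THEN linear_add] k[THEN linear_cmul] algebra_simps)
  moreover have "\<Gamma> X Y = \<Gamma> Y X" for X Y
    using D_sym[of _ X Y] by (simp add: \<Gamma>_def k_def add.commute)
  moreover have "frechet_derivative (\<lambda>q. h q Y Z) (at p) X = h p (\<Gamma> X Y) Z + h p Y (\<Gamma> X Z)" for X Y Z
    unfolding g_sym[of Y "\<Gamma> X Z"] \<Gamma> k_def D_def[symmetric] D_sym[of X Z Y] by (simp add: field_simps)
  ultimately have ex: "bilinear \<Gamma> \<and> (\<forall>X Y. \<Gamma> X Y = \<Gamma> Y X) \<and>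
     (\<forall>X Y Z. frechet_derivative (\<lambda>q. h q Y Z) (at p) X = h p (\<Gamma> X Y) Z + h p Y (\<Gamma> X Z))" by blast
  have "levi_civita h p = \<Gamma>"
    unfolding levi_civita_def
  proof (rule the_equality, rule ex)
    fix \<Gamma>' assume \<Gamma>': "bilinear \<Gamma>' \<and> (\<forall>X Y. \<Gamma>' X Y = \<Gamma>' Y X) \<and>
     (\<forall>X Y Z. frechet_derivative (\<lambda>q. h q Y Z) (at p) X = h p (\<Gamma>' X Y) Z + h p Y (\<Gamma>' X Z))"
    hence s: "\<Gamma>' X Y = \<Gamma>' Y X" and m: "D X Y Z = h p (\<Gamma>' X Y) Z + h p Y (\<Gamma>' X Z)" for X Y Z
      unfolding D_def by blast+
    have "h p (\<Gamma>' X Y) Z = k X Y Z" for X Y Z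
      using m[of X Y Z] m[of Y X Z] m[of Z X Y] s[of X Y] s[of X Z] s[of Y Z]
        g_sym[of Y "\<Gamma>' X Z"] g_sym[of X "\<Gamma>' Y Z"] by (simp add: k_def)
    hence "h p (\<Gamma>' X Y - \<Gamma> X Y) Z = 0" for X Y Z by (simp add: g_simps \<Gamma>)
    hence "\<Gamma>' X Y - \<Gamma> X Y = 0" for X Y using g_eq_0_iff by blast
    thus "\<Gamma>' = \<Gamma>" by (simp add: fun_eq_iff)
  qed
  with ex show "bilinear (levi_civita h p)" "D X Y Z = h p (levi_civita h p X Y) Z + h p Y (levi_civita h p X Z)"
    unfolding D_def by blast+
qed

text \<open>The metric is known to be differentiable for fixed arguments only, so the product rule
  is applied to the expansion in the standard basis.\<close>

lemma has_derivative_pair: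
  assumes u: "(u has_derivative u') (at p)" and v: "(v has_derivative v') (at p)"
  shows "((\<lambda>q. h q (u q) (v q)) has_derivative
    (\<lambda>X. h p (u' X) (v p) + h p (u p) (v' X) + D X (u p) (v p))) (at p)"
proof -
  have "((\<lambda>q. \<Sum>i\<in>Basis. \<Sum>j\<in>Basis. (u q \<bullet> i) * (v q \<bullet> j) * h q i j) has_derivative
    (\<lambda>X. \<Sum>i\<in>Basis. \<Sum>j\<in>Basis. (u p \<bullet> i) * (v p \<bullet> j) * D X i j
      + ((u p \<bullet> i) * (v' X \<bullet> j) + (u' X \<bullet> i) * (v p \<bullet> j)) * h p i j)) (at p)"
    by (intro has_derivative_sum has_derivative_mult has_derivative_inner_left has_derivative_h u v)
  moreover have "(\<Sum>i\<in>Basis. \<Sum>j\<in>Basis. (u p \<bullet> i) * (v p \<bullet> j) * D X i j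
      + ((u p \<bullet> i) * (v' X \<bullet> j) + (u' X \<bullet> i) * (v p \<bullet> j)) * h p i j)
    = h p (u' X) (v p) + h p (u p) (v' X) + D X (u p) (v p)" for X
    unfolding bilinear_expand[OF bilinear_g, of "u' X" "v p"] bilinear_expand[OF bilinear_g, of "u p" "v' X"]
      bilinear_expand[OF bilinear_D, of X "u p" "v p"]
    by (simp add: sum.distrib algebra_simps)
  ultimately have "((\<lambda>q. \<Sum>i\<in>Basis. \<Sum>j\<in>Basis. (u q \<bullet> i) * (v q \<bullet> j) * h q i j) has_derivative
    (\<lambda>X. h p (u' X) (v p) + h p (u p) (v' X) + D X (u p) (v p))) (at p)" by simp
  thus ?thesis
    by (rule has_derivative_transform_within_open[OF _ S]) (rule bilinear_expand[OF bilinear_h, symmetric])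
qed

end

section \<open>Covariant derivatives of the three fundamental forms\<close>

locale coordinate_qh = coordinate_metric h p S
  for h :: "'v::euclidean_space \<Rightarrow> 'v form2" and p S +
  fixes I J K :: "'v \<Rightarrow> 'v endo"
  assumes qh_q: "\<And>q. q \<in> S \<Longrightarrow> quaternion_hermitian (h q) (I q) (J q) (K q)"
    and diff_IJK: "\<And>A X. A \<in> {I, J, K} \<Longrightarrow> (\<lambda>q. A q X) differentiable at p"
begin

sublocale qh "h p" "I p" "J p" "K p"
  using qh_q[OF S(2)] by unfold_locales

abbreviation \<Gamma> :: "'v \<Rightarrow> 'v \<Rightarrow> 'v" where "\<Gamma> \<equiv> levi_civita h p"

definition DA :: "('v \<Rightarrow> 'v endo) \<Rightarrow> 'v \<Rightarrow> 'v \<Rightarrow> 'v" where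
  "DA A X Z = frechet_derivative (\<lambda>q. A q Z) (at p) X"

definition \<Omega> :: "('v \<Rightarrow> 'v endo) \<Rightarrow> 'v tensor3" where
  "\<Omega> A = cov_deriv h (\<lambda>q. fundamental_form (h q) (A q)) p"

lemma linear_Aq: "q \<in> S \<Longrightarrow> A \<in> {I, J, K} \<Longrightarrow> linear (A q)"
  using qh_q[of q] unfolding quaternion_hermitian_def by auto

lemma skew_Aq: "q \<in> S \<Longrightarrow> A \<in> {I, J, K} \<Longrightarrow> h q (A q X) Y = - h q X (A q Y)"
proof -
  assume q: "q \<in> S" and A: "A \<in> {I, J, K}"
  interpret Q: qh "h q" "I q" "J q" "K q"
    using euclidean_h[OF q] qh_q[OF q] by unfold_locales
  show ?thesis using A by (auto simp: Q.qsimps)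
qed

lemma has_derivative_A: "A \<in> {I, J, K} \<Longrightarrow> ((\<lambda>q. A q Z) has_derivative (\<lambda>X. DA A X Z)) (at p)"
  using diff_IJK[of A Z] unfolding DA_def frechet_derivative_works by simp

lemma linear_DA:
  assumes "A \<in> {I, J, K}"
  shows "linear (\<lambda>X. DA A X Z)" "linear (DA A X)"
proof -
  show "linear (\<lambda>X. DA A X Z)"
    using has_derivative_A[OF assms] has_derivative_linear by blast
  show "linear (DA A X)"
  proof (rule linearI)
    show "DA A X (Z + Z') = DA A X Z + DA A X Z'" for Z Z'
      by (rule deriv_unique[OF has_derivative_A[OF assms]
            has_derivative_add[OF has_derivative_A[OF assms] has_derivative_A[OF assms]]])
        (rule linear_add[OF linear_Aq[OF _ assms]])
    show "DA A X (r *\<^sub>R Z) = r *\<^sub>R DA A X Z" for r Z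
      by (rule deriv_unique[OF has_derivative_A[OF assms] has_derivative_scaleR_right[OF has_derivative_A[OF assms]]])
        (rule linear_cmul[OF linear_Aq[OF _ assms]])
  qed
qed

text \<open>The covariant derivative of the vector field A Z for constant \<open>Z\<close>.\<close>

definition N :: "('v \<Rightarrow> 'v endo) \<Rightarrow> 'v \<Rightarrow> 'v \<Rightarrow> 'v" where
  "N A X Z = DA A X Z + \<Gamma> X (A p Z)"

text \<open>Metricity cancels the derivative of \<open>h\<close> against the connection term of
  \<open>Y\<close>; what remains pairs \<open>Y\<close> with the covariant derivative of A applied
  to \<open>Z\<close>.\<close>

lemma Omega_eq:
  assumes "A \<in> {I, J, K}"
  shows "\<Omega> A X Y Z = h p Y (N A X Z - A p (\<Gamma> X Z))"
proof -
  have "((\<lambda>q. h q Y (A q Z)) has_derivative (\<lambda>X. h p 0 (A p Z) + h p Y (DA A X Z) + D X Y (A p Z))) (at p)"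
    by (rule has_derivative_pair[OF has_derivative_const has_derivative_A[OF assms]])
  from fun_cong[OF frechet_derivative_at[OF this], of X]
  have "frechet_derivative (\<lambda>q. h q Y (A q Z)) (at p) X = h p 0 (A p Z) + h p Y (DA A X Z) + D X Y (A p Z)"
    by (rule sym)
  thus ?thesis
    by (simp add: \<Omega>_def cov_deriv_def fundamental_form_def levi_civita(2) N_def g_simps)
qed

lemma trilinear_Omega:
  assumes A: "A \<in> {I, J, K}"
  shows "trilinear (\<Omega> A)"
  by (rule trilinearI)
    (simp_all add: Omega_eq[OF A] N_def g_simps linear_DA[OF A, THEN linear_add] linear_DA[OF A, THEN linear_cmul]
      bilinear_ladd[OF levi_civita(1)] bilinear_radd[OF levi_civita(1)] bilinear_lmul[OF levi_civita(1)]
      bilinear_rmul[OF levi_civita(1)] linear_Aq[OF S(2) A, THEN linear_add] linear_Aq[OF S(2) A, THEN linear_cmul]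
      algebra_simps)

text \<open>The hypothesis \<open>eq\<close> is differentiated at \<open>p\<close>; metricity
  absorbs the derivatives of \<open>h\<close> into \<open>N\<close>.\<close>

lemma deriv_product_cancel:
  assumes A: "A \<in> {I, J, K}" and B: "B \<in> {I, J, K}"
    and eq: "\<And>q. q \<in> S \<Longrightarrow> h q (A q Y) (B q Z) = - h q (B q Y) (A q Z)"
  shows "h p (N A X Y) (B p Z) + h p (A p Y) (N B X Z) + h p (N B X Y) (A p Z) + h p (B p Y) (N A X Z) = 0"
proof -
  have "h p (DA A X Y) (B p Z) + h p (A p Y) (DA B X Z) + D X (A p Y) (B p Z)
    = - (h p (DA B X Y) (A p Z) + h p (B p Y) (DA A X Z) + D X (B p Y) (A p Z))"
    by (rule deriv_unique[OF has_derivative_pair[OF has_derivative_A[OF A] has_derivative_A[OF B]]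
      has_derivative_minus[OF has_derivative_pair[OF has_derivative_A[OF B] has_derivative_A[OF A]]]]) (rule eq)
  thus ?thesis by (simp add: N_def levi_civita(2) g_simps)
qed

lemma Omega_skew:
  assumes A: "A \<in> {I, J, K}"
  shows "\<Omega> A X Z Y = - \<Omega> A X Y Z"
proof -
  have "h p Z (DA A X Y) + D X Z (A p Y) = - (h p Y (DA A X Z) + D X Y (A p Z))"
  proof -
    note d = has_derivative_pair[OF has_derivative_const has_derivative_A[OF A]]
    have "h p 0 (A p Y) + h p Z (DA A X Y) + D X Z (A p Y) = - (h p 0 (A p Z) + h p Y (DA A X Z) + D X Y (A p Z))"
      by (rule deriv_unique[OF d has_derivative_minus[OF d]]) (metis skew_Aq[OF _ A] sym_h)
    thus ?thesis by (simp add: g_simps)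
  qed
  moreover have "h p (\<Gamma> X Z) (A p Y) = - h p Y (A p (\<Gamma> X Z))" "h p (\<Gamma> X Y) (A p Z) = - h p Z (A p (\<Gamma> X Y))"
    using skew_Aq[OF S(2) A] g_sym by metis+
  ultimately show ?thesis
    by (simp add: Omega_eq[OF A] N_def g_simps levi_civita(2))
qed

text \<open>The derivative of \<open>IJ + JI = 0\<close>\<close>

lemma Omega_IJ: "slot2 (I p) (\<Omega> J) - slot3 (I p) (\<Omega> J) = - (slot2 (J p) (\<Omega> I) - slot3 (J p) (\<Omega> I))"
proof (intro ext)
  fix X Y Z
  have IJ: "I \<in> {I, J, K}" "J \<in> {I, J, K}" by simp_all
  have eq: "h q (I q Y) (J q Z) = - h q (J q Y) (I q Z)" if "q \<in> S" for q
  proof -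
    interpret Q: qh "h q" "I q" "J q" "K q"
      using euclidean_h[OF that] qh_q[OF that] by unfold_locales
    show ?thesis by (simp add: Q.qsimps)
  qed
  have "\<Omega> J X (I p Y) Z + \<Omega> J X (I p Z) Y + \<Omega> I X (J p Y) Z + \<Omega> I X (J p Z) Y = 0"
    using deriv_product_cancel[OF IJ eq, of X]
    by (simp add: Omega_eq IJ g_simps g_sym[of _ "N J X Y"] g_sym[of _ "N I X Y"]
      g_sym[of "I p Z"] g_sym[of "J p Z"]) (simp add: qsimps)
  thus "(slot2 (I p) (\<Omega> J) - slot3 (I p) (\<Omega> J)) X Y Z = (- (slot2 (J p) (\<Omega> I) - slot3 (J p) (\<Omega> I))) X Y Z"
    using Omega_skew[OF IJ(1), of X "J p Z" Y] Omega_skew[OF IJ(2), of X "I p Z" Y]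
    by (simp add: slot2_def slot3_def fun_Compl_def)
qed

end

section \<open>Pointwise formulas for the four components\<close>

lemma (in qh) orth_proj_isotypic_TL20:
  "is_TL20 (orth_proj g (real_isotypic_component g I J K \<tau> (TL20 g I J K)) b)"
proof -
  have "tensors.subspace (TL20 g I J K)" by (simp add: TL20_eq is_TL20_subspace)
  moreover have "real_isotypic_component g I J K \<tau> (TL20 g I J K) \<subseteq> TL20 g I J K"
    by (auto simp: real_isotypic_component_def)
  ultimately have "orth_proj g (real_isotypic_component g I J K \<tau> (TL20 g I J K)) b \<in> TL20 g I J K"
    using orth_proj_mem(1)[OF real_isotypic_subspace order_trans[OF _ TL20_tri]] by blast
  thus ?thesis by (simp add: TL20_eq)
qed

text \<open>Here \<open>\<Omega>\<close> and \<open>\<Omega>'\<close> stand for the covariant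
  derivatives of omega_I and omega_J, and \<open>l, l'\<close> for \<open>\<lambda>\<^sub>J\<close>
  and \<open>\<lambda>\<^sub>K\<close>, which trace-free tensors do not see.\<close>

lemma (in qh) component_formulas:
  fixes \<Omega> \<Omega>' :: "'v tensor3" and l l' :: "'v \<Rightarrow> real"
  assumes dim: "DIM('v) = 4 * N" "N \<ge> 2"
    and \<Omega>: "trilinear \<Omega>" "\<And>X Y Z. \<Omega> X Z Y = - \<Omega> X Y Z"
    and \<Omega>': "slot2 I \<Omega>' - slot3 I \<Omega>' = - (slot2 J \<Omega> - slot3 J \<Omega>)"
  defines "aJ \<equiv> - (\<lambda>X Y Z. l X * g Y Z) + tscale (1/2) (slot2 K \<Omega> - slot3 K \<Omega>)"
    and "aK \<equiv> - (\<lambda>X Y Z. l' X * g Y Z) + tscale (1/2) (slot2 I \<Omega>' - slot3 I \<Omega>')"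
    and "T \<equiv> TL20 g I J K" and "p3 \<equiv> part_3 g I J K" and "pK \<equiv> part_K g I J K"
  shows "p3 (GH1 I) (orth_proj g (GH1 I) \<Omega>)
      = component_map 1 g I J K (slot1 J (p3 T aJ) - slot1 K (p3 T aK))"
    and "p3 (GH3 g I) (orth_proj g (GH3 g I) \<Omega>)
      = component_map (- 1) g I J K (slot1 J (p3 T aJ) + slot1 K (p3 T aK))"
    and "pK (GH2 I) (orth_proj g (GH2 I) \<Omega>)
      = component_map 1 g I J K (slot1 J (pK T aJ) - slot1 K (pK T aK))"
    and "pK (GH3 g I) (orth_proj g (GH3 g I) \<Omega>)
      = component_map (- 1) g I J K (slot1 J (pK T aJ) + slot1 K (pK T aK))"
proof -
  have J: "inner3 g aJ s = inner3 g \<Omega> (\<lambda>X Y Z. s X (K Y) Z)" if "is_TL20 s" for s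
    unfolding aJ_def by (rule inner3_alpha[OF \<Omega> that linear_K_isometry])
  have Kp: "inner3 g aK s = - inner3 g \<Omega> (\<lambda>X Y Z. s X (J Y) Z)" if "is_TL20 s" for s
  proof -
    \<comment> \<open>The relation \<open>\<Omega>'\<close> rewrites \<open>aK\<close> as minus a
      tensor of the shape in \<open>inner3_alpha\<close>, with \<open>J\<close> acting on
      \<open>\<Omega>\<close> and the one-form negated.\<close>
    have "aK = (\<lambda>X Y Z. - (- (\<lambda>X Y Z. - l' X * g Y Z) + tscale (1/2) (slot2 J \<Omega> - slot3 J \<Omega>)) X Y Z)"
      unfolding aK_def \<Omega>' by (simp add: fun_eq_iff field_simps)
    thus ?thesis
      using inner3_alpha[OF \<Omega> that linear_IJK(2) g_IJK(2) IJK_simps(2), of "\<lambda>X. - l' X"]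
      by (simp only: inner3_neg)
  qed
  have signs: "I \<in> signs" "(\<lambda>X. - I X) \<in> signs" by (simp_all add: signs_def)
  have W: "tensors.subspace (GH1 I)" "tensors.subspace (GH2 I)" "tensors.subspace (GH3 g I)"
    by (simp_all add: GHi_eq is_GHi_subspace)
  have Wt: "GH1 I \<subseteq> {b. trilinear b}" "GH2 I \<subseteq> {b. trilinear b}" "GH3 g I \<subseteq> {b. trilinear b}"
    by (auto simp: GH1_def GH2_def GH3_def GH_def)
  note t3 = good_type_3[OF dim] and tK = good_type_K[OF dim]
  note C = orth_proj_component[OF _ _ _ _ _ \<Omega>(1) J Kp]
  note [simp] = component_map_Phi[OF orth_proj_isotypic_TL20 orth_proj_isotypic_TL20]
  show "p3 (GH1 I) (orth_proj g (GH1 I) \<Omega>)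
      = component_map 1 g I J K (slot1 J (p3 T aJ) - slot1 K (p3 T aK))"
    unfolding p3_def part_3_def T_def
    using C[OF signs(1) t3 W(1) Wt(1) real_isotypic_3_GH1[OF dim]] by simp
  show "p3 (GH3 g I) (orth_proj g (GH3 g I) \<Omega>)
      = component_map (- 1) g I J K (slot1 J (p3 T aJ) + slot1 K (p3 T aK))"
    unfolding p3_def part_3_def T_def
    using C[OF signs(2) t3 W(3) Wt(3) real_isotypic_GH3[OF dim t3]] by simp
  show "pK (GH2 I) (orth_proj g (GH2 I) \<Omega>)
      = component_map 1 g I J K (slot1 J (pK T aJ) - slot1 K (pK T aK))"
    unfolding pK_def part_K_def T_def
    using C[OF signs(1) tK W(2) Wt(2) real_isotypic_K_GH2[OF dim]] by simp
  show "pK (GH3 g I) (orth_proj g (GH3 g I) \<Omega>)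
      = component_map (- 1) g I J K (slot1 J (pK T aJ) + slot1 K (pK T aK))"
    unfolding pK_def part_K_def T_def
    using C[OF signs(2) tK W(3) Wt(3) real_isotypic_GH3[OF dim tK]] by simp
qed

section \<open>The components of the covariant derivative\<close>

lemma smooth_on_differentiable: "smooth_on S f \<Longrightarrow> x \<in> S \<Longrightarrow> f differentiable at x"
  unfolding smooth_on_def by (drule spec[of _ "Suc 0"]) simp

text \<open>The coordinate image of the intersection of \<open>U\<close> with the chart domain is
  open because the chart is a homeomorphism, which makes it the neighbourhood needed for
  differentiating the algebraic relations.\<close>

lemma chart_coordinate_qh:
  fixes M :: "'m topology" and \<A> :: "('m, 'v::euclidean_space) chart set"
  assumes M: "almost_quaternion_hermitian M \<A> g Q" and B: "local_adapted_basis M \<A> g Q U I J K"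
    and c: "c \<in> \<A>" and x: "x \<in> U \<inter> fst c"
  shows "coordinate_qh (local_rep c g) (snd c x) (snd c ` (U \<inter> fst c))
    (local_rep c I) (local_rep c J) (local_rep c K)"
    and "local_rep c T (snd c x) = T c x"
proof -
  have man: "smooth_manifold M \<A>" and met: "riemannian_metric \<A> g"
    using M by (simp_all add: almost_quaternion_hermitian_def)
  have oc: "openin M (fst c)" "open (snd c ` fst c)"
    and hom: "homeomorphic_map (subtopology M (fst c)) (top_of_set (snd c ` fst c)) (snd c)"
    using man c by (simp_all add: smooth_manifold_def)
  have U: "openin M U" using B by (simp add: local_adapted_basis_def)
  have sub: "topspace (subtopology M (fst c)) = fst c"
    using openin_subset[OF oc(1)] by auto
  have inj: "inj_on (snd c) (fst c)"
    using homeomorphic_imp_injective_map[OF hom] by (simp only: sub)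
  have rep: "local_rep c T (snd c y) = T c y" if "y \<in> fst c"
    for T :: "('m, 'v) chart \<Rightarrow> 'm \<Rightarrow> 'b" and y
    by (simp add: local_rep_def inv_into_f_f[OF inj that])
  show "local_rep c T (snd c x) = T c x" using x by (intro rep) blast
  have "openin (subtopology M (fst c)) (U \<inter> fst c)"
    using U by (rule openin_subtopology_Int)
  hence "openin (top_of_set (snd c ` fst c)) (snd c ` (U \<inter> fst c))"
    using homeomorphic_map_openness[OF hom, of "U \<inter> fst c"]
    by (simp add: sub openin_subset[OF U] le_infI1)
  hence op: "open (snd c ` (U \<inter> fst c))"
    using oc(2) by (simp add: openin_open_eq)
  show "coordinate_qh (local_rep c g) (snd c x) (snd c ` (U \<inter> fst c))
    (local_rep c I) (local_rep c J) (local_rep c K)"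
  proof unfold_locales
    show "open (snd c ` (U \<inter> fst c))" by (rule op)
    show "snd c x \<in> snd c ` (U \<inter> fst c)" using x by (rule imageI)
    show "euclidean_form (local_rep c g q)" if "q \<in> snd c ` (U \<inter> fst c)" for q
      using that met c by (auto simp: rep riemannian_metric_def)
    show "(\<lambda>q. local_rep c g q X Y) differentiable at (snd c x)" for X Y
      using met c x unfolding riemannian_metric_def
      by (intro smooth_on_differentiable[of "snd c ` fst c"]) auto
    show "quaternion_hermitian (local_rep c g q) (local_rep c I q) (local_rep c J q) (local_rep c K q)"
      if "q \<in> snd c ` (U \<inter> fst c)" for q
      using that B c by (auto simp: rep local_adapted_basis_def)
    show "(\<lambda>q. A q X) differentiable at (snd c x)"
      if "A \<in> {local_rep c I, local_rep c J, local_rep c K}" for A X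
    proof -
      have "smooth_endo_field \<A> U I" "smooth_endo_field \<A> U J" "smooth_endo_field \<A> U K"
        using B by (simp_all add: local_adapted_basis_def)
      hence "smooth_on (snd c ` (U \<inter> fst c)) (\<lambda>q. A q X)"
        using that c by (auto simp: smooth_endo_field_def)
      thus ?thesis using x by (intro smooth_on_differentiable) auto
    qed
  qed
qed

theorem proposition3p2:
  fixes n :: nat
  assumes "n \<ge> 2" and "DIM('v::euclidean_space) = 4 * n"
  shows "\<exists>La Lb Lc Ld :: 'v qh_map.
    injective_natural_map La \<and> injective_natural_map Lb \<and>
    injective_natural_map Lc \<and> injective_natural_map Ld \<and>
    (\<forall>(M :: 'm topology) (\<A> :: ('m, 'v) chart set) g Q U I J K c x.
      almost_quaternion_hermitian M \<A> g Q \<longrightarrow> local_adapted_basis M \<A> g Q U I J K \<longrightarrow>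
      c \<in> \<A> \<longrightarrow> x \<in> U \<inter> fst c \<longrightarrow>
      (let gx = g c x; Ix = I c x; Jx = J c x; Kx = K c x;
           \<Omega> = nabla_omega g I c x;
           \<alpha>J = alpha g J K I c x;
           \<alpha>K = alpha g K I J c x;
           T = TL20 gx Ix Jx Kx;
           p3 = part_3 gx Ix Jx Kx;
           pK = part_K gx Ix Jx Kx
       in p3 (GH1 Ix) (orth_proj gx (GH1 Ix) \<Omega>)
            = La gx Ix Jx Kx (slot1 Jx (p3 T \<alpha>J) - slot1 Kx (p3 T \<alpha>K)) \<and>
          p3 (GH3 gx Ix) (orth_proj gx (GH3 gx Ix) \<Omega>)
            = Lb gx Ix Jx Kx (slot1 Jx (p3 T \<alpha>J) + slot1 Kx (p3 T \<alpha>K)) \<and>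
          pK (GH2 Ix) (orth_proj gx (GH2 Ix) \<Omega>)
            = Lc gx Ix Jx Kx (slot1 Jx (pK T \<alpha>J) - slot1 Kx (pK T \<alpha>K)) \<and>
          pK (GH3 gx Ix) (orth_proj gx (GH3 gx Ix) \<Omega>)
            = Ld gx Ix Jx Kx (slot1 Jx (pK T \<alpha>J) + slot1 Kx (pK T \<alpha>K))))"
proof -
  have "let gx = g c x; Ix = I c x; Jx = J c x; Kx = K c x;
           \<Omega> = nabla_omega g I c x;
           \<alpha>J = alpha g J K I c x;
           \<alpha>K = alpha g K I J c x;
           T = TL20 gx Ix Jx Kx;
           p3 = part_3 gx Ix Jx Kx;
           pK = part_K gx Ix Jx Kx
       in p3 (GH1 Ix) (orth_proj gx (GH1 Ix) \<Omega>)
            = component_map 1 gx Ix Jx Kx (slot1 Jx (p3 T \<alpha>J) - slot1 Kx (p3 T \<alpha>K)) \<and>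
          p3 (GH3 gx Ix) (orth_proj gx (GH3 gx Ix) \<Omega>)
            = component_map (- 1) gx Ix Jx Kx (slot1 Jx (p3 T \<alpha>J) + slot1 Kx (p3 T \<alpha>K)) \<and>
          pK (GH2 Ix) (orth_proj gx (GH2 Ix) \<Omega>)
            = component_map 1 gx Ix Jx Kx (slot1 Jx (pK T \<alpha>J) - slot1 Kx (pK T \<alpha>K)) \<and>
          pK (GH3 gx Ix) (orth_proj gx (GH3 gx Ix) \<Omega>)
            = component_map (- 1) gx Ix Jx Kx (slot1 Jx (pK T \<alpha>J) + slot1 Kx (pK T \<alpha>K))"
    if "almost_quaternion_hermitian M \<A> g Q" "local_adapted_basis M \<A> g Q U I J K" "c \<in> \<A>" "x \<in> U \<inter> fst c"
    for M :: "'m topology" and \<A> :: "('m, 'v) chart set" and g Q U I J K c x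
  proof -
    note rep = chart_coordinate_qh(2)[OF that]
    interpret coordinate_qh "local_rep c g" "snd c x" "snd c ` (U \<inter> fst c)"
      "local_rep c I" "local_rep c J" "local_rep c K"
      by (rule chart_coordinate_qh(1)[OF that])
    have O: "nabla_omega g A c x = \<Omega> (local_rep c A)" for A
      by (simp add: nabla_omega_def \<Omega>_def)
    show ?thesis
      using component_formulas[OF assms(2,1) trilinear_Omega Omega_skew Omega_IJ,
          of "lambda_form g J K I c x" "lambda_form g K I J c x"]
      unfolding rep Let_def alpha_def O by simp
  qed
  moreover have "injective_natural_map (component_map 1 :: 'v qh_map)"
    "injective_natural_map (component_map (- 1) :: 'v qh_map)"
    by (simp_all add: component_map_natural)
  \<comment> \<open>The sign is 1 for the components in W1 and W2 and -1 for the two in W3.\<close>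
  ultimately show ?thesis
    by - (rule exI[of _ "component_map 1"], rule exI[of _ "component_map (- 1)"],
      rule exI[of _ "component_map 1"], rule exI[of _ "component_map (- 1)"], intro conjI allI impI)
qed

end
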